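(* Let $\mathbb{F}$ be a field of characteristic $0$ and let $\mathcal{W}(1)$ be the Lie conformal algebra that is the free $\mathbb{F}[\partial]$-module on $L,H$ with $[L_\lambda L]=(\partial+2\lambda)L$, $[L_\lambda H]=\partial H$, $[H_\lambda L]=-\partial H$, $[H_\lambda H]=0$. Then the basic and reduced cohomology of $\mathcal{W}(1)$ with coefficients in its adjoint module satisfy, for $q\ge 0$, $$\dim\widetilde{\mathrm{H}}^q(\mathcal{W}(1),\mathcal{W}(1))=\begin{cases}2,& q=2,3,\\ 0,&\text{otherwise,}\end{cases}\qquad \dim\mathrm{H}^q(\mathcal{W}(1),\mathcal{W}(1))=\begin{cases}2,& q=1,3,\\ 4,& q=2,\\ 0,&\text{otherwise.}\end{cases}$$
   Context: Lie conformal algebra (LCA): an $\mathbb{F}[\partial]$-module $\mathcal{A}$ with an $\mathbb{F}$-bilinear $\lambda$-bracket $\mathcal{A}\otimes\mathcal{A}\to\mathcal{A}[\lambda]$, $a\otimes b\mapsto[a_\lambda b]$, such that $[\partial a_\lambda b]=-\lambda[a_\lambda b]$, $[a_\lambda\partial b]=(\partial+\lambda)[a_\lambda b]$, $[a_\lambda b]=-[b_{-\lambda-\partial}a]$, and $[a_\lambda[b_\mu c]]=[[a_\lambda b]_{\lambda+\mu}c]+[b_\mu[a_\lambda c]]$. The $\lambda$-bracket on $\mathbb{F}[\partial]$-generators determines it everywhere. An $\mathcal{A}$-module is an $\mathbb{F}[\partial]$-module $M$ with an $\mathbb{F}$-bilinear $\lambda$-action $a\otimes m\mapsto a_\lambda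 m\in M[\lambda]$ such that $(\partial a)_\lambda m=-\lambda a_\lambda m$, $a_\lambda(\partial m)=(\partial+\lambda)a_\lambda m$, $a_\lambda(b_\mu m)-b_\mu(a_\lambda m)=[a_\lambda b]_{\lambda+\mu}m$. The adjoint module is $M=\mathcal{A}$ with $a_\lambda m=[a_\lambda m]$. Write $\partial^M$ for the action of $\partial$ on $M$. Basic complex: for $q\ge 1$, $\widetilde{C}^q(\mathcal{A},M)$ is the space of $\mathbb{F}$-linear maps $f:\mathcal{A}^{\otimes q}\to M[\lambda_1,\dots,\lambda_q]$, $a_1\otimes\cdots\otimes a_q\mapsto f_{\lambda_1,\dots,\lambda_q}(a_1,\dots,a_q)$, with $f_{\lambda_1,\dots,\lambda_q}(a_1,\dots,\partial a_i,\dots,a_q)=-\lambda_i f_{\lambda_1,\dots,\lambda_q}(a_1,\dots,a_q)$ for all $i$, and skew-symmetric under simultaneous permutations of the $a_i$ and the $\lambda_i$. Also $\widetilde{C}^0(\mathcal{A},M)=M$. The differential is $$(\mathbf{d}f)_{\lambda_1,\dots,\lambda_{q+1}}(a_1,\dots,a_{q+1})=\sum_{k}(-1)^{k+1}a_{k\,\lambda_k}f_{\lambda_1,\dots,\hat\lambda_k,\dots,\lambda_{q+1}}(a_1,\dots,\hat a_k,\dots,a_{q+1})+\sum_{k<l}(-1)^{k+l}f_{\lambda_k+\lambda_l,\lambda_1,\dots,\hat\lambda_k,\dots,\hat\lambda_l,\dots,\lambda_{q+1}}([a_{k\,\lambda_k}a_l],a_1,\dots,\hat a_k,\dots,\hat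 a_l,\dots,a_{q+1}),$$ with $(\mathbf{d}m)_\lambda(a)=a_\lambda m$ for $m\in M$; hats denote omission, and polynomial coefficients in the $\lambda$'s are extended linearly. One has $\mathbf{d}^2=0$. Define $(\partial f)_{\lambda_1,\dots,\lambda_q}(a_1,\dots,a_q)=(\partial^M+\sum_{k=1}^q\lambda_k)f_{\lambda_1,\dots,\lambda_q}(a_1,\dots,a_q)$; then $\mathbf{d}\partial=\partial\mathbf{d}$. The reduced complex is $C^\bullet(\mathcal{A},M)=\widetilde{C}^\bullet(\mathcal{A},M)/\partial\widetilde{C}^\bullet(\mathcal{A},M)$. The basic cohomology $\widetilde{\mathrm{H}}^\bullet(\mathcal{A},M)$ is the cohomology of $\widetilde{C}^\bullet(\mathcal{A},M)$; the reduced cohomology $\mathrm{H}^\bullet(\mathcal{A},M)$ is the cohomology of $C^\bullet(\mathcal{A},M)$. Dimensions are over $\mathbb{F}$. *)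

theory Defs
  imports
    Complex_Main
    "HOL-Library.Poly_Mapping"
    "HOL-Library.Product_Plus"
    "HOL-Computational_Algebra.Polynomial"
    "HOL-Combinatorics.Permutations"
begin

section \<open>Vector spaces with an explicit carrier: quotients, dimension, cohomology\<close>

record ('f, 'v) vspace =
  vcarrier :: "'v set"
  vzero :: 'v
  vadd :: "'v \<Rightarrow> 'v \<Rightarrow> 'v"
  vsmult :: "'f \<Rightarrow> 'v \<Rightarrow> 'v"

definition coset :: "('f, 'v) vspace \<Rightarrow> 'v set \<Rightarrow> 'v \<Rightarrow> 'v set"
  where "coset S W x = {vadd S x w | w. w \<in> W}"

text \<open>The quotient by a subspace \<open>W\<close>.  Scalar multiplication adds \<open>W\<close> once more
  because the scalar may be zero.\<close>

definition quotient_space :: "('f, 'v) vspace \<Rightarrow> 'v set \<Rightarrow> ('f, 'v set) vspace"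
  where "quotient_space S W =
    \<lparr>vcarrier = coset S W ` vcarrier S,
     vzero = W,
     vadd = (\<lambda>X Y. {vadd S x y | x y. x \<in> X \<and> y \<in> Y}),
     vsmult = (\<lambda>c X. {vadd S (vsmult S c x) w | x w. x \<in> X \<and> w \<in> W})\<rparr>"

primrec lincomb :: "('f, 'v) vspace \<Rightarrow> ('f \<times> 'v) list \<Rightarrow> 'v"
  where
    "lincomb S [] = vzero S"
  | "lincomb S (p # ps) = vadd S (vsmult S (fst p) (snd p)) (lincomb S ps)"

definition is_basis :: "('f, 'v) vspace \<Rightarrow> 'v list \<Rightarrow> bool"
  where "is_basis S bs \<longleftrightarrow> set bs \<subseteq> vcarrier S \<and>
    (\<forall>x\<in>vcarrier S. \<exists>!cs. length cs = length bs \<and> x = lincomb S (zip cs bs))"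

text \<open>A relation and not a function, so that \<open>has_dim S 0\<close> does not hold for
  infinite-dimensional spaces.\<close>

definition has_dim :: "('f, 'v) vspace \<Rightarrow> nat \<Rightarrow> bool"
  where "has_dim S n \<longleftrightarrow> (\<exists>bs. length bs = n \<and> is_basis S bs)"

definition cohomology ::
    "(nat \<Rightarrow> ('f, 'v) vspace) \<Rightarrow> (nat \<Rightarrow> 'v \<Rightarrow> 'v) \<Rightarrow> nat \<Rightarrow> ('f, 'v set) vspace"
  where "cohomology C d q =
    quotient_space
      ((C q)\<lparr>vcarrier := {x \<in> vcarrier (C q). d q x = vzero (C (Suc q))}\<rparr>)
      (case q of 0 \<Rightarrow> {vzero (C 0)} | Suc p \<Rightarrow> d p ` vcarrier (C p))"


section \<open>Multivariate polynomials with coefficients in a vector space\<close>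

text \<open>An element of \<open>M[\<lambda>\<^sub>0, \<lambda>\<^sub>1, \<dots>]\<close> maps exponent vectors to coefficients;
  \<open>'f mpoly\<close> is the polynomial ring itself.  Univariate polynomials \<open>M[\<lambda>]\<close> are
  \<open>'m poly\<close>.  Indices start at 0.\<close>

type_synonym 'm mpoly = "(nat \<Rightarrow>\<^sub>0 nat) \<Rightarrow>\<^sub>0 'm"

definition mvar :: "nat \<Rightarrow> 'f::comm_ring_1 mpoly"
  where "mvar i = Poly_Mapping.single (Poly_Mapping.single i 1) 1"

definition mconst :: "'m::zero \<Rightarrow> 'm mpoly"
  where "mconst m = Poly_Mapping.single 0 m"

definition mmult :: "('f \<Rightarrow> 'm \<Rightarrow> 'm) \<Rightarrow> 'f::field mpoly \<Rightarrow> 'm::ab_group_add mpoly \<Rightarrow> 'm mpoly"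
  where "mmult scale p v =
    (\<Sum>s\<in>Poly_Mapping.keys p. \<Sum>t\<in>Poly_Mapping.keys v. Poly_Mapping.single (s + t) (scale (Poly_Mapping.lookup p s) (Poly_Mapping.lookup v t)))"

text \<open>Extension of a linear \<open>g : U \<rightarrow> M[\<lambda>\<^sub>0, \<dots>]\<close> to \<open>U[\<lambda>\<^sub>0, \<dots>]\<close> by linearity over polynomials.\<close>

definition mext :: "('f::field \<Rightarrow> 'm \<Rightarrow> 'm) \<Rightarrow> ('u::zero \<Rightarrow> 'm::ab_group_add mpoly) \<Rightarrow> 'u mpoly \<Rightarrow> 'm mpoly"
  where "mext scale g v = (\<Sum>t\<in>Poly_Mapping.keys v. mmult scale (Poly_Mapping.single t 1) (g (Poly_Mapping.lookup v t)))"

text \<open>\<open>at_var scale x p\<close> is \<open>p(x)\<close> for \<open>p \<in> M[\<lambda>]\<close>, and \<open>msubst scale zs v\<close> is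
  \<open>v(z\<^sub>0, z\<^sub>1, \<dots>)\<close>.\<close>

definition at_var :: "('f \<Rightarrow> 'm \<Rightarrow> 'm) \<Rightarrow> 'f::field mpoly \<Rightarrow> 'm::ab_group_add poly \<Rightarrow> 'm mpoly"
  where "at_var scale x p = (\<Sum>n\<le>degree p. mmult scale (x ^ n) (mconst (coeff p n)))"

definition msubst :: "('f \<Rightarrow> 'm \<Rightarrow> 'm) \<Rightarrow> 'f::field mpoly list \<Rightarrow> 'm::ab_group_add mpoly \<Rightarrow> 'm mpoly"
  where "msubst scale zs v =
    (\<Sum>t\<in>Poly_Mapping.keys v. mmult scale (\<Prod>i\<in>Poly_Mapping.keys t. (zs ! i) ^ Poly_Mapping.lookup t i) (mconst (Poly_Mapping.lookup v t)))"


section \<open>Lie conformal algebras and their modules\<close>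

text \<open>\<open>dplus D p\<close> is \<open>(\<partial> + \<lambda>) p\<close>.\<close>

definition dplus :: "('m \<Rightarrow> 'm) \<Rightarrow> 'm::ab_group_add poly \<Rightarrow> 'm poly"
  where "dplus D p = map_poly D p + pCons 0 p"

text \<open>The substitution \<open>\<lambda> \<mapsto> -\<lambda> - \<partial>\<close>, with powers of \<open>\<partial>\<close> acting on the coefficients.\<close>

definition flip_lambda :: "('m \<Rightarrow> 'm) \<Rightarrow> 'm::ab_group_add poly \<Rightarrow> 'm poly"
  where "flip_lambda D p = (\<Sum>n\<le>degree p. ((\<lambda>u. - dplus D u) ^^ n) [:coeff p n:])"

locale lie_conformal_algebra = vector_space scale
  for scale :: "'f::field \<Rightarrow> 'a::ab_group_add \<Rightarrow> 'a" +
  fixes D :: "'a \<Rightarrow> 'a"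
    and br :: "'a \<Rightarrow> 'a \<Rightarrow> 'a poly"
  assumes D_add: "D (a + b) = D a + D b"
    and D_scale: "D (scale k a) = scale k (D a)"
    and br_add_left: "br (a + a') b = br a b + br a' b"
    and br_add_right: "br a (b + b') = br a b + br a b'"
    and br_scale_left: "br (scale k a) b = map_poly (scale k) (br a b)"
    and br_scale_right: "br a (scale k b) = map_poly (scale k) (br a b)"
    and br_D_left: "br (D a) b = - pCons 0 (br a b)"
    and br_D_right: "br a (D b) = dplus D (br a b)"
    and br_skew: "br a b = - flip_lambda D (br b a)"
    and br_jacobi:
      "mext scale (\<lambda>u. at_var scale (mvar 0) (br a u)) (at_var scale (mvar 1) (br b c)) =
       mext scale (\<lambda>u. at_var scale (mvar 0 + mvar 1) (br u c)) (at_var scale (mvar 0) (br a b)) +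
       mext scale (\<lambda>u. at_var scale (mvar 1) (br b u)) (at_var scale (mvar 0) (br a c))"

locale lca_module =
  A: lie_conformal_algebra scaleA DA br + M: vector_space scaleM
  for scaleA :: "'f::field \<Rightarrow> 'a::ab_group_add \<Rightarrow> 'a"
    and DA :: "'a \<Rightarrow> 'a"
    and br :: "'a \<Rightarrow> 'a \<Rightarrow> 'a poly"
    and scaleM :: "'f \<Rightarrow> 'm::ab_group_add \<Rightarrow> 'm" +
  fixes DM :: "'m \<Rightarrow> 'm"
    and act :: "'a \<Rightarrow> 'm \<Rightarrow> 'm poly"
  assumes DM_add: "DM (m + m') = DM m + DM m'"
    and DM_scale: "DM (scaleM c m) = scaleM c (DM m)"
    and act_add_left: "act (a + a') m = act a m + act a' m"
    and act_add_right: "act a (m + m') = act a m + act a m'"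
    and act_scale_left: "act (scaleA c a) m = map_poly (scaleM c) (act a m)"
    and act_scale_right: "act a (scaleM c m) = map_poly (scaleM c) (act a m)"
    and act_D_left: "act (DA a) m = - pCons 0 (act a m)"
    and act_D_right: "act a (DM m) = dplus DM (act a m)"
    and act_bracket:
      "mext scaleM (\<lambda>u. at_var scaleM (mvar 0) (act a u)) (at_var scaleM (mvar 1) (act b m)) -
       mext scaleM (\<lambda>u. at_var scaleM (mvar 1) (act b u)) (at_var scaleM (mvar 0) (act a m)) =
       mext scaleM (\<lambda>u. at_var scaleM (mvar 0 + mvar 1) (act u m)) (at_var scaleA (mvar 0) (br a b))"
begin

text \<open>A \<open>q\<close>-cochain is a multilinear map on lists of length \<open>q\<close>; the value \<open>0\<close> on all other
  lists makes the representing function unique.  For \<open>q = 0\<close> only the value at the empty list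
  matters, a polynomial in no variables, i.e. an element of \<open>M\<close>.\<close>

definition cochains :: "nat \<Rightarrow> ('a list \<Rightarrow> 'm mpoly) set"
  where "cochains q = {f.
    (\<forall>as. length as \<noteq> q \<longrightarrow> f as = 0) \<and>
    (\<forall>as. \<forall>t\<in>Poly_Mapping.keys (f as). Poly_Mapping.keys t \<subseteq> {..<q}) \<and>
    (\<forall>as i a b. length as = q \<longrightarrow> i < q \<longrightarrow>
        f (as[i := a + b]) = f (as[i := a]) + f (as[i := b])) \<and>
    (\<forall>as i c a. length as = q \<longrightarrow> i < q \<longrightarrow>
        f (as[i := scaleA c a]) = mmult scaleM (mconst c) (f (as[i := a]))) \<and>
    (\<forall>as i. length as = q \<longrightarrow> i < q \<longrightarrow>
        f (as[i := DA (as ! i)]) = - mmult scaleM (mvar i) (f as)) \<and>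
    (\<forall>as \<pi>. length as = q \<longrightarrow> \<pi> permutes {..<q} \<longrightarrow>
        msubst scaleM (map (\<lambda>i. mvar (\<pi> i)) [0..<q]) (f (map (\<lambda>i. as ! \<pi> i) [0..<q])) =
        mmult scaleM (of_int (sign \<pi>)) (f as))}"

text \<open>The differential in all degrees: the degree of \<open>f\<close> is \<open>length as - 1\<close>.  With indices
  starting at 0 the sign in the first sum is \<open>(-1)\<^sup>k\<close>.\<close>

definition differential :: "('a list \<Rightarrow> 'm mpoly) \<Rightarrow> ('a list \<Rightarrow> 'm mpoly)"
  where "differential f as =
    (\<Sum>k<length as.
       let I = filter (\<lambda>i. i \<noteq> k) [0..<length as] in
       mmult scaleM ((-1) ^ k)
         (mext scaleM (\<lambda>u. at_var scaleM (mvar k) (act (as ! k) u))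
           (msubst scaleM (map mvar I) (f (map ((!) as) I))))) +
    (\<Sum>l<length as. \<Sum>k<l.
       let J = filter (\<lambda>i. i \<noteq> k \<and> i \<noteq> l) [0..<length as] in
       mmult scaleM ((-1) ^ (k + l))
         (mext scaleM
           (\<lambda>b. msubst scaleM ((mvar k + mvar l) # map mvar J) (f (b # map ((!) as) J)))
           (at_var scaleA (mvar k) (br (as ! k) (as ! l)))))"

definition cochain_D :: "('a list \<Rightarrow> 'm mpoly) \<Rightarrow> ('a list \<Rightarrow> 'm mpoly)"
  where "cochain_D f as =
    Poly_Mapping.map DM (f as) + mmult scaleM (\<Sum>k<length as. mvar k) (f as)"

definition basic_complex :: "nat \<Rightarrow> ('f, 'a list \<Rightarrow> 'm mpoly) vspace"
  where "basic_complex q =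
    \<lparr>vcarrier = cochains q,
     vzero = (\<lambda>as. 0),
     vadd = (\<lambda>f g as. f as + g as),
     vsmult = (\<lambda>c f as. mmult scaleM (mconst c) (f as))\<rparr>"

definition basic_cohomology :: "nat \<Rightarrow> ('f, ('a list \<Rightarrow> 'm mpoly) set) vspace"
  where "basic_cohomology = cohomology basic_complex (\<lambda>q. differential)"

definition reduced_complex :: "nat \<Rightarrow> ('f, ('a list \<Rightarrow> 'm mpoly) set) vspace"
  where "reduced_complex q = quotient_space (basic_complex q) (cochain_D ` cochains q)"

text \<open>The map on cosets induced by the differential.\<close>

definition reduced_differential ::
    "nat \<Rightarrow> ('a list \<Rightarrow> 'm mpoly) set \<Rightarrow> ('a list \<Rightarrow> 'm mpoly) set"
  where "reduced_differential q X =
    (\<Union>f\<in>X. coset (basic_complex (Suc q)) (cochain_D ` cochains (Suc q)) (differential f))"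

definition reduced_cohomology :: "nat \<Rightarrow> ('f, ('a list \<Rightarrow> 'm mpoly) set set) vspace"
  where "reduced_cohomology = cohomology reduced_complex reduced_differential"

end

sublocale lie_conformal_algebra \<subseteq> adjoint: lca_module scale D br scale D br
  by unfold_locales
    (simp_all only: D_add D_scale br_add_left br_add_right br_scale_left br_scale_right
      br_D_left br_D_right br_jacobi add_diff_cancel_right')


section \<open>The Lie conformal algebra W(1)\<close>

text \<open>The pair \<open>(p, r)\<close> stands for \<open>p(\<partial>) L + r(\<partial>) H\<close>.\<close>

type_synonym 'f w1 = "'f poly \<times> 'f poly"

definition w1_L :: "'f::field_char_0 w1"
  where "w1_L = (1, 0)"

definition w1_H :: "'f::field_char_0 w1"
  where "w1_H = (0, 1)"

definition w1_scale :: "'f::field_char_0 \<Rightarrow> 'f w1 \<Rightarrow> 'f w1"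
  where "w1_scale c a = (smult c (fst a), smult c (snd a))"

definition w1_D :: "'f::field_char_0 w1 \<Rightarrow> 'f w1"
  where "w1_D a = (pCons 0 (fst a), pCons 0 (snd a))"

text \<open>In \<open>F[\<partial>][\<lambda>]\<close>, realised as \<open>'f poly poly\<close>, \<open>subst_poly p x\<close> is \<open>p(x)\<close> for \<open>p \<in> F[\<partial>]\<close>.\<close>

abbreviation del_poly :: "'f::field_char_0 poly poly"
  where "del_poly \<equiv> [:[:0, 1:]:]"

abbreviation lambda_poly :: "'f::field_char_0 poly poly"
  where "lambda_poly \<equiv> [:0, 1:]"

definition subst_poly :: "'f::field_char_0 poly \<Rightarrow> 'f poly poly \<Rightarrow> 'f poly poly"
  where "subst_poly p x = poly (map_poly (\<lambda>c. [:[:c:]:]) p) x"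

definition w1_pair :: "'f::field_char_0 poly poly \<Rightarrow> 'f poly poly \<Rightarrow> 'f w1 poly"
  where "w1_pair u v = map_poly (\<lambda>p. (p, 0)) u + map_poly (\<lambda>r. (0, r)) v"

text \<open>The bracket determined by its values on the generators through
  \<open>[p(\<partial>)X\<^sub>\<lambda> r(\<partial>)Y] = p(-\<lambda>) r(\<partial> + \<lambda>) [X\<^sub>\<lambda> Y]\<close>.\<close>

definition w1_br :: "'f::field_char_0 w1 \<Rightarrow> 'f w1 \<Rightarrow> 'f w1 poly"
  where "w1_br a b =
    (let lft = (\<lambda>p. subst_poly p (- lambda_poly));
         rgt = (\<lambda>p. subst_poly p (del_poly + lambda_poly))
     in w1_pair
          (lft (fst a) * rgt (fst b) * (del_poly + 2 * lambda_poly))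
          (lft (fst a) * rgt (snd b) * del_poly - lft (snd a) * rgt (fst b) * del_poly))"


section \<open>W(1) is a Lie conformal algebra\<close>

lemma poly_mapping_sum_single:
  "(\<Sum>t\<in>Poly_Mapping.keys v. Poly_Mapping.single t (Poly_Mapping.lookup v t)) = (v :: 'k \<Rightarrow>\<^sub>0 'b::comm_monoid_add)"
  by (rule poly_mapping_eqI)
    (simp add: lookup_sum lookup_single when_def sum.delta in_keys_iff)

lemma poly_mapping_add_induct [case_names zero single add]:
  fixes v :: "'k \<Rightarrow>\<^sub>0 'b::comm_monoid_add"
  assumes "P 0" "\<And>t c. P (Poly_Mapping.single t c)" "\<And>v w. P v \<Longrightarrow> P w \<Longrightarrow> P (v + w)"
  shows "P v"
proof -
  have "P (\<Sum>t\<in>A. Poly_Mapping.single t (Poly_Mapping.lookup v t))" if "finite A" for A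
    using that by induction (auto intro: assms)
  from this[of "Poly_Mapping.keys v"] show ?thesis
    by (simp add: poly_mapping_sum_single)
qed

context vector_space
begin

lemma mmult_superset:
  assumes "finite A" "Poly_Mapping.keys p \<subseteq> A" "finite B" "Poly_Mapping.keys v \<subseteq> B"
  shows "mmult scale p v =
    (\<Sum>s\<in>A. \<Sum>t\<in>B. Poly_Mapping.single (s + t) (scale (Poly_Mapping.lookup p s) (Poly_Mapping.lookup v t)))"
proof -
  have "(\<Sum>t\<in>Poly_Mapping.keys v. Poly_Mapping.single (s + t) (scale (Poly_Mapping.lookup p s) (Poly_Mapping.lookup v t))) =
        (\<Sum>t\<in>B. Poly_Mapping.single (s + t) (scale (Poly_Mapping.lookup p s) (Poly_Mapping.lookup v t)))" for s
    by (rule sum.mono_neutral_left) (use assms in \<open>auto simp: in_keys_iff\<close>)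
  then have "mmult scale p v = (\<Sum>s\<in>Poly_Mapping.keys p. \<Sum>t\<in>B. Poly_Mapping.single (s + t) (scale (Poly_Mapping.lookup p s) (Poly_Mapping.lookup v t)))"
    by (simp add: mmult_def)
  also have "\<dots> = (\<Sum>s\<in>A. \<Sum>t\<in>B. Poly_Mapping.single (s + t) (scale (Poly_Mapping.lookup p s) (Poly_Mapping.lookup v t)))"
    by (rule sum.mono_neutral_left) (use assms in \<open>auto simp: in_keys_iff\<close>)
  finally show ?thesis .
qed

lemma mmult_zero_left [simp]: "mmult scale 0 v = 0"
  and mmult_zero_right [simp]: "mmult scale p 0 = 0"
  by (simp_all add: mmult_def)

lemma mmult_add_left: "mmult scale (p + p') v = mmult scale p v + mmult scale p' v"
proof -
  let ?A = "Poly_Mapping.keys p \<union> Poly_Mapping.keys p'" and ?B = "Poly_Mapping.keys v"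
  note * = mmult_superset[where A = ?A and B = ?B]
  show ?thesis
    using Poly_Mapping.keys_add[of p p']
    by (simp add: * lookup_add scale_left_distrib single_add sum.distrib)
qed

lemma mmult_add_right: "mmult scale p (v + v') = mmult scale p v + mmult scale p v'"
proof -
  let ?A = "Poly_Mapping.keys p" and ?B = "Poly_Mapping.keys v \<union> Poly_Mapping.keys v'"
  note * = mmult_superset[where A = ?A and B = ?B]
  show ?thesis
    using Poly_Mapping.keys_add[of v v']
    by (simp add: * lookup_add scale_right_distrib single_add sum.distrib)
qed

lemma mmult_minus_left: "mmult scale (- p) v = - mmult scale p v"
  using mmult_add_left[of "- p" p v] by (simp add: eq_neg_iff_add_eq_0)

lemma mmult_minus_right: "mmult scale p (- v) = - mmult scale p v"
  using mmult_add_right[of p "- v" v] by (simp add: eq_neg_iff_add_eq_0)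

lemma mmult_sum_left: "mmult scale (\<Sum>i\<in>I. f i) v = (\<Sum>i\<in>I. mmult scale (f i) v)"
  by (induction I rule: infinite_finite_induct) (simp_all add: mmult_add_left)

lemma mmult_sum_right: "mmult scale p (\<Sum>i\<in>I. f i) = (\<Sum>i\<in>I. mmult scale p (f i))"
  by (induction I rule: infinite_finite_induct) (simp_all add: mmult_add_right)

lemma mmult_single:
  "mmult scale (Poly_Mapping.single s c) (Poly_Mapping.single t m) = Poly_Mapping.single (s + t) (scale c m)"
  by (subst mmult_superset[where A = "{s}" and B = "{t}"]) (auto simp: split: if_splits)

lemma mmult_assoc: "mmult scale (p * q) v = mmult scale p (mmult scale q v)"
proof (induction p rule: poly_mapping_add_induct)
  case (single s c)
  show ?case
  proof (induction q rule: poly_mapping_add_induct)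
    case (single s' c')
    show ?case
      by (induction v rule: poly_mapping_add_induct)
        (simp_all add: mmult_single mult_single mmult_add_right add.assoc)
  qed (simp_all add: mmult_add_left mmult_add_right algebra_simps)
qed (simp_all add: mmult_add_left mmult_add_right algebra_simps)

lemma mmult_one [simp]: "mmult scale 1 v = v"
  by (induction v rule: poly_mapping_add_induct)
    (simp_all add: mmult_single mmult_add_right flip: single_one)

lemma mmult_commute: "mmult scale p (mmult scale q v) = mmult scale q (mmult scale p v)"
  by (simp add: mult.commute flip: mmult_assoc)

lemma mconst_zero [simp]: "mconst 0 = 0"
  by (simp add: mconst_def)

lemma mmult_mconst_mconst: "mmult scale (mconst c) (mconst m) = mconst (scale c m)"
  by (simp add: mconst_def mmult_single)

lemma mconst_add: "mconst (m + m') = mconst m + (mconst m' :: 'b mpoly)"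
  by (simp add: mconst_def single_add)

lemma mconst_minus: "mconst (- m) = - (mconst m :: 'b mpoly)"
  by (simp add: mconst_def single_uminus)

lemma at_var_superset:
  "degree p \<le> N \<Longrightarrow> at_var scale x p = (\<Sum>n\<le>N. mmult scale (x ^ n) (mconst (coeff p n)))"
  unfolding at_var_def
  by (rule sum.mono_neutral_left) (auto simp: coeff_eq_0)

lemma at_var_zero [simp]: "at_var scale x 0 = 0"
  by (simp add: at_var_def)

lemma at_var_add: "at_var scale x (p + p') = at_var scale x p + at_var scale x p'"
proof -
  let ?N = "max (degree p) (degree p')"
  have "degree (p + p') \<le> ?N"
    by (rule degree_add_le_max)
  then show ?thesis
    by (simp add: at_var_superset[where N = ?N] mconst_add mmult_add_right sum.distrib)
qed

lemma at_var_minus: "at_var scale x (- p) = - at_var scale x p"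
  using at_var_add[of x "- p" p] by (simp add: eq_neg_iff_add_eq_0)

lemma at_var_pCons: "at_var scale x (pCons m p) = mconst m + mmult scale x (at_var scale x p)"
proof -
  have "at_var scale x (pCons m p) = (\<Sum>n\<le>Suc (degree p). mmult scale (x ^ n) (mconst (coeff (pCons m p) n)))"
    by (rule at_var_superset) (rule degree_pCons_le)
  also have "\<dots> = mconst m + (\<Sum>n\<le>degree p. mmult scale (x ^ Suc n) (mconst (coeff p n)))"
    by (subst sum.atMost_Suc_shift) simp
  also have "(\<Sum>n\<le>degree p. mmult scale (x ^ Suc n) (mconst (coeff p n))) = mmult scale x (at_var scale x p)"
    by (simp add: at_var_def mmult_sum_right mmult_assoc)
  finally show ?thesis .
qed

lemma at_var_scale: "at_var scale x (map_poly (scale k) p) = mmult scale (mconst k) (at_var scale x p)"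
  by (induction p)
    (simp_all add: map_poly_pCons at_var_pCons mmult_add_right mmult_mconst_mconst mmult_commute)

lemma mext_superset:
  assumes "finite A" "Poly_Mapping.keys v \<subseteq> A" "g 0 = 0"
  shows "mext scale g v = (\<Sum>t\<in>A. mmult scale (Poly_Mapping.single t 1) (g (Poly_Mapping.lookup v t)))"
  unfolding mext_def
  by (rule sum.mono_neutral_left) (use assms in \<open>auto simp: in_keys_iff\<close>)

lemma mext_zero [simp]: "mext scale g 0 = 0"
  by (simp add: mext_def)

lemma mext_single:
  "g 0 = 0 \<Longrightarrow> mext scale g (Poly_Mapping.single t u) = mmult scale (Poly_Mapping.single t 1) (g u)"
  by (subst mext_superset[where A = "{t}"]) auto

lemma mext_mconst: "g 0 = 0 \<Longrightarrow> mext scale g (mconst u) = g u"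
  by (simp add: mconst_def mext_single)

lemma mext_add:
  fixes g :: "'u::comm_monoid_add \<Rightarrow> 'b mpoly"
  assumes "\<And>u u'. g (u + u') = g u + g u'"
  shows "mext scale g (v + v') = mext scale g v + mext scale g v'"
proof -
  let ?A = "Poly_Mapping.keys v \<union> Poly_Mapping.keys v'"
  have "g 0 = 0"
    using assms[of 0 0] by simp
  note * = mext_superset[where A = ?A and g = g, OF _ _ this]
  show ?thesis
    using Poly_Mapping.keys_add[of v v']
    by (simp add: * lookup_add assms mmult_add_right sum.distrib)
qed

lemma mext_minus:
  fixes g :: "'u::ab_group_add \<Rightarrow> 'b mpoly"
  assumes "\<And>u u'. g (u + u') = g u + g u'"
  shows "mext scale g (- v) = - mext scale g v"
  using mext_add[OF assms, of "- v" v] by (simp add: eq_neg_iff_add_eq_0)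

lemma mext_mmult:
  fixes g :: "'b \<Rightarrow> 'b mpoly"
  assumes add: "\<And>u u'. g (u + u') = g u + g u'"
    and scale: "\<And>c u. g (scale c u) = mmult scale (mconst c) (g u)"
  shows "mext scale g (mmult scale p v) = mmult scale p (mext scale g v)"
proof -
  have 0: "g 0 = 0"
    using add[of 0 0] by simp
  show ?thesis
  proof (induction p rule: poly_mapping_add_induct)
    case (single s c)
    have *: "Poly_Mapping.single (s + t) 1 * mconst c = Poly_Mapping.single s c * Poly_Mapping.single t 1" for t
      by (simp add: mconst_def mult_single)
    show ?case
      by (induction v rule: poly_mapping_add_induct)
        (simp_all add: mmult_add_right mext_add[OF add] mmult_single mext_single[where g = g, OF 0] scale *
          flip: mmult_assoc)
  qed (simp_all add: mmult_add_left mext_add[OF add])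
qed

lemma mext_comp:
  fixes g :: "'u::ab_group_add \<Rightarrow> 'b mpoly"
  assumes "\<And>v w. R (v + w) = R v + R w"
    and "\<And>p v. R (mmult scale p v) = mmult scale p (R v)"
  shows "mext scale (\<lambda>u. R (g u)) v = R (mext scale g v)"
proof -
  have 0: "R 0 = 0"
    using assms(1)[of 0 0] by simp
  have "R (\<Sum>i\<in>I. f i) = (\<Sum>i\<in>I. R (f i))" for f :: "(nat \<Rightarrow>\<^sub>0 nat) \<Rightarrow> 'b mpoly" and I
    by (induction I rule: infinite_finite_induct) (simp_all add: assms 0)
  then show ?thesis
    by (simp add: mext_def assms)
qed

lemma mext_add_fun: "mext scale (\<lambda>u. g u + h u) v = mext scale g v + mext scale h v"
  by (simp add: mext_def mmult_add_right sum.distrib)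

end

lemma map_poly_mapping_lookup:
  "h 0 = 0 \<Longrightarrow> Poly_Mapping.lookup (Poly_Mapping.map h v) t = h (Poly_Mapping.lookup v t)"
  by (simp add: Poly_Mapping.map.rep_eq when_def)

lemma mext_map:
  assumes "vector_space scale" "h 0 = 0" "g 0 = (0 :: 'm::ab_group_add mpoly)"
  shows "mext scale g (Poly_Mapping.map h v) = mext scale (\<lambda>u. g (h u)) v"
proof -
  interpret vector_space scale by fact
  have "Poly_Mapping.keys (Poly_Mapping.map h v) \<subseteq> Poly_Mapping.keys v"
    using assms(2) by (auto simp: in_keys_iff map_poly_mapping_lookup)
  then show ?thesis
    by (subst mext_superset[where A = "Poly_Mapping.keys v"])
      (simp_all add: assms mext_def map_poly_mapping_lookup)
qed

context vector_space
begin

context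
  fixes D :: "'b \<Rightarrow> 'b"
  assumes D_add: "D (a + b) = D a + D b"
    and D_scale: "D (scale c a) = scale c (D a)"
begin

lemma D_zero: "D 0 = 0"
  using D_add[of 0 0] by simp

lemma map_D_add: "Poly_Mapping.map D (v + w) = Poly_Mapping.map D v + Poly_Mapping.map D w"
  by (rule poly_mapping_eqI) (simp add: map_poly_mapping_lookup D_zero D_add lookup_add)

lemma map_D_single: "Poly_Mapping.map D (Poly_Mapping.single t m) = Poly_Mapping.single t (D m)"
  by (rule poly_mapping_eqI) (simp add: map_poly_mapping_lookup D_zero lookup_single when_def)

lemma map_D_zero: "Poly_Mapping.map D 0 = 0"
  by (rule poly_mapping_eqI) (simp add: map_poly_mapping_lookup D_zero)

lemma map_D_mmult: "Poly_Mapping.map D (mmult scale p v) = mmult scale p (Poly_Mapping.map D v)"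
proof (induction p rule: poly_mapping_add_induct)
  case (single s c)
  show ?case
    by (induction v rule: poly_mapping_add_induct)
      (simp_all add: map_D_zero map_D_add map_D_single mmult_add_right mmult_single D_scale)
qed (simp_all add: map_D_zero map_D_add mmult_add_left)

lemma map_D_mconst: "Poly_Mapping.map D (mconst m) = mconst (D m)"
  by (simp add: mconst_def map_D_single)

lemma at_var_dplus:
  "at_var scale x (dplus D p) = Poly_Mapping.map D (at_var scale x p) + mmult scale x (at_var scale x p)"
proof -
  have "at_var scale x (map_poly D p) = Poly_Mapping.map D (at_var scale x p)"
    by (induction p)
      (simp_all add: map_poly_pCons D_zero map_D_zero at_var_pCons map_D_add map_D_mconst map_D_mmult)
  then show ?thesis
    by (simp add: dplus_def at_var_add at_var_pCons)
qed

lemma map_poly_D_add: "map_poly D (p + p') = map_poly D p + map_poly D p'"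
  by (rule poly_eqI) (simp add: coeff_map_poly D_zero D_add)

lemma dplus_add: "dplus D (p + p') = dplus D p + dplus D p'"
  by (simp add: dplus_def map_poly_D_add)

lemma flip_lambda_superset:
  assumes "degree p \<le> N"
  shows "flip_lambda D p = (\<Sum>n\<le>N. ((\<lambda>u. - dplus D u) ^^ n) [:coeff p n:])"
proof -
  have "((\<lambda>u. - dplus D u) ^^ n) 0 = 0" for n
    by (induction n) (simp_all add: dplus_def)
  then show ?thesis
    unfolding flip_lambda_def
    by (intro sum.mono_neutral_left) (use assms in \<open>auto simp: coeff_eq_0\<close>)
qed

lemma flip_lambda_pCons: "flip_lambda D (pCons m p) = [:m:] - dplus D (flip_lambda D p)"
proof -
  have sum: "dplus D (\<Sum>i\<in>I. f i) = (\<Sum>i\<in>I. dplus D (f i))" for f :: "nat \<Rightarrow> 'b poly" and I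
    by (induction I rule: infinite_finite_induct) (simp_all add: dplus_add dplus_def[of D 0])
  have "flip_lambda D (pCons m p) = (\<Sum>n\<le>Suc (degree p). ((\<lambda>u. - dplus D u) ^^ n) [:coeff (pCons m p) n:])"
    by (rule flip_lambda_superset) (rule degree_pCons_le)
  also have "\<dots> = [:m:] + (\<Sum>n\<le>degree p. - dplus D (((\<lambda>u. - dplus D u) ^^ n) [:coeff p n:]))"
    by (subst sum.atMost_Suc_shift) simp
  finally show ?thesis
    by (simp add: flip_lambda_def sum sum_negf)
qed

lemma flip_lambda_zero: "flip_lambda D 0 = 0"
  by (simp add: flip_lambda_def)

lemma flip_lambda_add: "flip_lambda D (p + q) = flip_lambda D p + flip_lambda D q"
proof (induction p arbitrary: q)
  case (pCons m p)
  then show ?case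
    by (cases q) (simp add: flip_lambda_pCons dplus_add)
qed (simp add: flip_lambda_zero)

lemma flip_lambda_minus: "flip_lambda D (- p) = - flip_lambda D p"
  using flip_lambda_add[of "- p" p] by (simp add: eq_neg_iff_add_eq_0 flip_lambda_zero)

lemma flip_lambda_scale: "flip_lambda D (map_poly (scale c) p) = map_poly (scale c) (flip_lambda D p)"
proof -
  have "dplus D (map_poly (scale c) p) = map_poly (scale c) (dplus D p)" for p
    by (rule poly_eqI)
      (simp add: dplus_def coeff_map_poly coeff_pCons D_zero D_scale scale_right_distrib split: nat.split)
  moreover have "map_poly (scale c) (p - q) = map_poly (scale c) p - map_poly (scale c) q" for p q
    by (rule poly_eqI) (simp add: coeff_map_poly scale_right_diff_distrib)
  ultimately show ?thesis
    by (induction p) (simp_all add: map_poly_pCons flip_lambda_pCons flip_lambda_zero)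
qed

lemma flip_lambda_map_D: "flip_lambda D (map_poly D p) = map_poly D (flip_lambda D p)"
proof -
  have "dplus D (map_poly D p) = map_poly D (dplus D p)" for p
    by (rule poly_eqI)
      (simp add: dplus_def coeff_map_poly coeff_pCons D_zero D_add split: nat.split)
  moreover have "map_poly D (p - q) = map_poly D p - map_poly D q" for p q
    using map_poly_D_add[of "p - q" q] by (simp add: algebra_simps)
  ultimately show ?thesis
    by (induction p) (simp_all add: map_poly_pCons flip_lambda_pCons flip_lambda_zero D_zero)
qed

lemma flip_lambda_dplus: "flip_lambda D (dplus D p) = - pCons 0 (flip_lambda D p)"
  by (simp add: dplus_def flip_lambda_add flip_lambda_map_D flip_lambda_pCons)

end

end


lemma w1_eqI: "fst a = fst b \<Longrightarrow> snd a = snd b \<Longrightarrow> a = (b :: 'f::field_char_0 w1)"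
  by (simp add: prod_eq_iff)

interpretation w1: vector_space "w1_scale :: 'f::field_char_0 \<Rightarrow> 'f w1 \<Rightarrow> 'f w1"
  by unfold_locales (simp_all add: w1_scale_def smult_add_right smult_add_left)

lemma w1_D_add: "w1_D (a + b) = w1_D a + w1_D b"
  by (simp add: w1_D_def)

lemma w1_D_scale: "w1_D (w1_scale k a) = w1_scale k (w1_D a)"
  by (simp add: w1_D_def w1_scale_def)

lemma w1_induct [case_names L H D add scale]:
  fixes a :: "'f::field_char_0 w1"
  assumes "P w1_L" "P w1_H" "\<And>a. P a \<Longrightarrow> P (w1_D a)"
    and "\<And>a b. P a \<Longrightarrow> P b \<Longrightarrow> P (a + b)" "\<And>k a. P a \<Longrightarrow> P (w1_scale k a)"
  shows "P a"
proof -
  have 0: "P (0, 0)"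
    using assms(5)[OF assms(1), of 0] by (simp add: w1_scale_def)
  have 1: "P (p, 0)" for p
  proof (induction p)
    case (pCons c p)
    have "(pCons c p, 0) = w1_scale c w1_L + w1_D (p, 0)"
      by (simp add: w1_scale_def w1_L_def w1_D_def)
    with pCons assms show ?case by metis
  qed (fact 0)
  have 2: "P (0, p)" for p
  proof (induction p)
    case (pCons c p)
    have "(0, pCons c p) = w1_scale c w1_H + w1_D (0, p)"
      by (simp add: w1_scale_def w1_H_def w1_D_def)
    with pCons assms show ?case by metis
  qed (fact 0)
  from assms(4)[OF 1 2, of "fst a" "snd a"] show ?thesis by simp
qed

lemma subst_poly_0 [simp]: "subst_poly 0 x = 0"
  by (simp add: subst_poly_def)

lemma subst_poly_pCons: "subst_poly (pCons c p) x = [:[:c:]:] + x * subst_poly p x"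
  by (simp add: subst_poly_def map_poly_pCons)

lemma subst_poly_1 [simp]: "subst_poly 1 x = 1"
  by (simp add: one_pCons subst_poly_pCons)

lemma subst_poly_add: "subst_poly (p + q) x = subst_poly p x + subst_poly q x"
proof (induction p arbitrary: q)
  case (pCons c p)
  then show ?case
    by (cases q) (simp add: subst_poly_pCons algebra_simps)
qed simp

lemma subst_poly_smult: "subst_poly (smult c p) x = [:[:c:]:] * subst_poly p x"
  by (induction p) (simp_all add: subst_poly_pCons algebra_simps)

lemma coeff_w1_pair: "coeff (w1_pair u v) n = (coeff u n, coeff v n)"
  by (simp add: w1_pair_def coeff_map_poly flip: zero_prod_def)

lemma w1_pair_add: "w1_pair u v + w1_pair u' v' = w1_pair (u + u') (v + v')"
  by (rule poly_eqI) (simp add: coeff_w1_pair)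

lemma w1_pair_minus: "- w1_pair u v = w1_pair (- u) (- v)"
  by (rule poly_eqI) (simp add: coeff_w1_pair)

lemma w1_scale_zero: "w1_scale k 0 = 0" and w1_D_zero: "w1_D 0 = 0"
  by (simp_all add: w1_scale_def w1_D_def zero_prod_def)

lemma map_poly_w1_scale: "map_poly (w1_scale k) (w1_pair u v) = w1_pair ([:[:k:]:] * u) ([:[:k:]:] * v)"
  by (rule poly_eqI) (simp add: coeff_w1_pair coeff_map_poly w1_scale_zero, simp add: w1_scale_def)

lemma map_poly_w1_D: "map_poly w1_D (w1_pair u v) = w1_pair (del_poly * u) (del_poly * v)"
  by (rule poly_eqI) (simp add: coeff_w1_pair coeff_map_poly w1_D_zero, simp add: w1_D_def)

lemma pCons_w1_pair: "pCons 0 (w1_pair u v) = w1_pair (lambda_poly * u) (lambda_poly * v)"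
  by (rule poly_eqI) (simp add: coeff_w1_pair coeff_pCons zero_prod_def split: nat.split)

lemma dplus_w1_pair:
  "dplus w1_D (w1_pair u v) = w1_pair ((del_poly + lambda_poly) * u) ((del_poly + lambda_poly) * v)"
  by (simp only: dplus_def map_poly_w1_D pCons_w1_pair w1_pair_add distrib_right)

lemma w1_br_add_left: "w1_br (a + a') b = w1_br a b + w1_br a' b"
  unfolding w1_br_def Let_def w1_pair_add fst_add snd_add subst_poly_add
  by (simp only: algebra_simps)

lemma w1_br_add_right: "w1_br a (b + b') = w1_br a b + w1_br a b'"
  unfolding w1_br_def Let_def w1_pair_add fst_add snd_add subst_poly_add
  by (simp only: algebra_simps)

lemma w1_br_scale_left: "w1_br (w1_scale k a) b = map_poly (w1_scale k) (w1_br a b)"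
  unfolding w1_br_def Let_def map_poly_w1_scale w1_scale_def[of k a] fst_conv snd_conv subst_poly_smult
  by (simp only: algebra_simps)

lemma w1_br_scale_right: "w1_br a (w1_scale k b) = map_poly (w1_scale k) (w1_br a b)"
  unfolding w1_br_def Let_def map_poly_w1_scale w1_scale_def[of k b] fst_conv snd_conv subst_poly_smult
  by (simp only: algebra_simps)

lemma subst_poly_pCons_0: "subst_poly (pCons 0 p) x = x * subst_poly p x"
  by (simp add: subst_poly_pCons)

lemma w1_br_D_left: "w1_br (w1_D a) b = - pCons 0 (w1_br a b)"
proof -
  have "w1_pair ((- l * p) * q * e) ((- l * p) * q' * d - (- l * p') * q * d) =
      w1_pair (- (l * (p * q * e))) (- (l * (p * q' * d - p' * q * d)))"
    for l p p' q q' d e :: "'a poly poly"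
    by (simp add: algebra_simps)
  then show ?thesis
    unfolding w1_br_def Let_def pCons_w1_pair w1_pair_minus w1_D_def fst_conv snd_conv
      subst_poly_pCons_0 by blast
qed

lemma w1_br_D_right: "w1_br a (w1_D b) = dplus w1_D (w1_br a b)"
  unfolding w1_br_def Let_def dplus_w1_pair w1_D_def[of b] fst_conv snd_conv subst_poly_pCons_0
  by (simp only: algebra_simps)

lemma w1_scale_2: "w1_scale 2 a = a + a"
  using w1.scale_left_distrib[of 1 1 a] by simp

lemma w1_br_L_L: "w1_br w1_L w1_L = [:w1_D w1_L, w1_scale 2 w1_L:]"
proof -
  have "w1_br w1_L w1_L = w1_pair [:[:0, 1:], 2:] 0"
    by (simp add: w1_br_def w1_L_def numeral_poly)
  also have "\<dots> = [:w1_D w1_L, w1_scale 2 w1_L:]"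
    by (simp add: poly_eq_iff coeff_w1_pair w1_L_def w1_D_def w1_scale_def coeff_pCons numeral_poly
      one_pCons split: nat.split flip: zero_prod_def)
  finally show ?thesis .
qed

lemma w1_br_L_H: "w1_br w1_L w1_H = [:w1_D w1_H:]"
proof -
  have "w1_br w1_L w1_H = w1_pair 0 del_poly"
    by (simp add: w1_br_def w1_L_def w1_H_def)
  also have "\<dots> = [:w1_D w1_H:]"
    by (simp add: poly_eq_iff coeff_w1_pair w1_H_def w1_D_def coeff_pCons one_pCons
      split: nat.split flip: zero_prod_def)
  finally show ?thesis .
qed

lemma w1_br_H_L: "w1_br w1_H w1_L = [:- w1_D w1_H:]"
proof -
  have "w1_br w1_H w1_L = w1_pair 0 (- del_poly)"
    by (simp add: w1_br_def w1_L_def w1_H_def)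
  also have "\<dots> = [:- w1_D w1_H:]"
    by (simp add: poly_eq_iff coeff_w1_pair w1_H_def w1_D_def coeff_pCons one_pCons
      split: nat.split flip: zero_prod_def)
  finally show ?thesis .
qed

lemma w1_br_H_H: "w1_br w1_H w1_H = 0"
  by (simp add: poly_eq_iff w1_br_def w1_H_def coeff_w1_pair zero_prod_def)

lemma w1_br_skew: "w1_br a b = - flip_lambda w1_D (w1_br b a)"
proof -
  note flip = w1.flip_lambda_add w1.flip_lambda_scale w1.flip_lambda_dplus w1.flip_lambda_pCons
    w1.flip_lambda_zero w1.flip_lambda_minus
  note flip' = flip[of w1_D, OF w1_D_add w1_D_scale]
  have pc: "flip_lambda w1_D (pCons 0 p) = - dplus w1_D (flip_lambda w1_D p)" for p :: "'a w1 poly"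
    by (simp add: flip')
  have mn: "map_poly (w1_scale k) (- p) = - map_poly (w1_scale k) p" for k and p :: "'a w1 poly"
    by (rule poly_eqI) (simp add: coeff_map_poly w1_scale_zero)
  have dn: "dplus w1_D (- p) = - dplus w1_D p" for p :: "'a w1 poly"
    using w1.dplus_add[of w1_D p "- p", OF w1_D_add w1_D_scale]
    by (simp add: eq_neg_iff_add_eq_0 add.commute dplus_def[of _ 0])
  show ?thesis
  proof (induction a rule: w1_induct)
    case L
    show ?case
      by (induction b rule: w1_induct)
        (simp_all add: w1_br_add_left w1_br_add_right w1_br_scale_left w1_br_scale_right w1_br_D_left
          w1_br_D_right flip' pc mn dn w1_br_L_L w1_br_L_H w1_br_H_L dplus_def
          map_poly_pCons w1_D_zero w1_scale_2 w1_D_add)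
  next
    case H
    show ?case
      by (induction b rule: w1_induct)
        (simp_all add: w1_br_add_left w1_br_add_right w1_br_scale_left w1_br_scale_right w1_br_D_left
          w1_br_D_right flip' pc mn dn w1_br_H_H w1_br_L_H w1_br_H_L dplus_def map_poly_pCons w1_D_zero)
  qed (simp_all add: w1_br_add_left w1_br_add_right w1_br_scale_left w1_br_scale_right w1_br_D_left
          w1_br_D_right flip' mn)
qed


lemma w1_br_jacobi:
  fixes a b c :: "'f::field_char_0 w1" and x y :: "'f mpoly"
  shows "mext w1_scale (\<lambda>u. at_var w1_scale x (w1_br a u)) (at_var w1_scale y (w1_br b c)) =
    mext w1_scale (\<lambda>u. at_var w1_scale (x + y) (w1_br u c)) (at_var w1_scale x (w1_br a b)) +
    mext w1_scale (\<lambda>u. at_var w1_scale y (w1_br b u)) (at_var w1_scale x (w1_br a c))"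
proof -
  define m where "m = (mmult w1_scale :: 'f mpoly \<Rightarrow> 'f w1 mpoly \<Rightarrow> 'f w1 mpoly)"
  define ext where "ext = (mext w1_scale :: ('f w1 \<Rightarrow> 'f w1 mpoly) \<Rightarrow> 'f w1 mpoly \<Rightarrow> 'f w1 mpoly)"
  define DD where "DD = (Poly_Mapping.map w1_D :: 'f w1 mpoly \<Rightarrow> 'f w1 mpoly)"
  define B where "B = (\<lambda>(x :: 'f mpoly) (a :: 'f w1) b. at_var w1_scale x (w1_br a b))"
  note D = w1_D_add w1_D_scale

  have m_add_left: "m (p + p') v = m p v + m p' v"
    and m_add_right: "m p (v + v') = m p v + m p v'"
    and m_minus_right: "m p (- v) = - m p v"
    and m_minus_left: "m (- p) v = - m p v"
    and m_zero: "m p 0 = 0"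
    and m_assoc: "m p (m q v) = m (p * q) v" for p p' q v v'
    by (simp_all add: m_def w1.mmult_add_left w1.mmult_add_right w1.mmult_minus_right w1.mmult_minus_left
        flip: w1.mmult_assoc)
  have m_commute: "m p (m q v) = m q (m p v)" for p q v
    unfolding m_def by (rule w1.mmult_commute)

  have DD_add: "DD (v + w) = DD v + DD w" and DD_m: "DD (m p v) = m p (DD v)"
    and DD_mconst: "DD (mconst u) = mconst (w1_D u)" for v w p u
    unfolding DD_def m_def
    by (rule w1.map_D_add[OF D] w1.map_D_mmult[OF D] w1.map_D_mconst[OF D])+

  have B_add_left: "B x (a + a') b = B x a b + B x a' b"
    and B_add_right: "B x a (b + b') = B x a b + B x a b'"
    and B_scale_left: "B x (w1_scale k a) b = m (mconst k) (B x a b)"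
    and B_scale_right: "B x a (w1_scale k b) = m (mconst k) (B x a b)"
    and B_D_left: "B x (w1_D a) b = - m x (B x a b)"
    and B_D_right: "B x a (w1_D b) = DD (B x a b) + m x (B x a b)" for x a a' b b' k
    by (simp_all add: B_def m_def DD_def w1_br_add_left w1_br_add_right w1_br_scale_left
        w1_br_scale_right w1_br_D_left w1_br_D_right w1.at_var_add w1.at_var_scale
        w1.at_var_minus w1.at_var_pCons w1.at_var_dplus[OF D] w1.mmult_minus_right)

  have DD_zero: "DD 0 = 0"
    unfolding DD_def by (rule w1.map_D_zero[OF D])
  have DD_minus: "DD (- v) = - DD v" for v
    using DD_add[of v "- v"] DD_zero by (simp add: minus_unique)

  have B_zero_left: "B x 0 b = 0" and B_zero_right: "B x a 0 = 0" for x a b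
    using B_add_left[of x 0 0 b] B_add_right[of x a 0 0] by simp_all

  have ext_B: "ext (B x a) (v + w) = ext (B x a) v + ext (B x a) w"
      "ext (B x a) (- v) = - ext (B x a) v"
      "ext (B x a) (m p v) = m p (ext (B x a) v)"
      "ext (B x a) (mconst u) = B x a u" "ext (B x a) 0 = 0" for x a v w p u
    unfolding ext_def m_def
    by (rule w1.mext_add w1.mext_minus w1.mext_mmult w1.mext_mconst w1.mext_zero,
        simp_all add: B_add_right B_scale_right B_zero_right m_def)+
  have ext_B': "ext (\<lambda>u. B x u c) (v + w) = ext (\<lambda>u. B x u c) v + ext (\<lambda>u. B x u c) w"
      "ext (\<lambda>u. B x u c) (- v) = - ext (\<lambda>u. B x u c) v"
      "ext (\<lambda>u. B x u c) (m p v) = m p (ext (\<lambda>u. B x u c) v)"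
      "ext (\<lambda>u. B x u c) (mconst u) = B x u c" "ext (\<lambda>u. B x u c) 0 = 0" for x c v w p u
    unfolding ext_def m_def
    by (rule w1.mext_add w1.mext_minus w1.mext_mmult w1.mext_mconst w1.mext_zero,
        simp_all add: B_add_left B_scale_left B_zero_left m_def)+

  have ext_comp: "ext (\<lambda>u. R (g u)) v = R (ext g v)"
    if "\<And>v w. R (v + w) = R v + R w" "\<And>p v. R (m p v) = m p (R v)" for R g v
    using that unfolding ext_def m_def by (rule w1.mext_comp)
  have ext_fun_add: "ext (\<lambda>u. g u + h u) v = ext g v + ext h v" for g h v
    unfolding ext_def by (rule w1.mext_add_fun)
  have ext_fun: "ext (\<lambda>u. m p (g u)) v = m p (ext g v)" "ext (\<lambda>u. - g u) v = - ext g v"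
    "ext (\<lambda>u. DD (g u)) v = DD (ext g v)" for p g v
    by (rule ext_comp, simp_all add: m_add_right m_commute m_minus_right DD_add DD_m)+
  have ext_DD: "ext g (DD v) = ext (\<lambda>u. g (w1_D u)) v" if "g 0 = 0" for g v
    unfolding ext_def DD_def
    by (rule mext_map) (use that in \<open>auto simp: w1_D_zero intro: w1.vector_space_axioms\<close>)
  have ext_B_DD: "ext (B x a) (DD v) = DD (ext (B x a) v) + m x (ext (B x a) v)" for x a v
    by (simp add: ext_DD B_zero_right B_D_right ext_fun_add ext_fun)
  have ext_B'_DD: "ext (\<lambda>u. B x u c) (DD v) = - m x (ext (\<lambda>u. B x u c) v)" for x c v
    by (simp add: ext_DD B_zero_left B_D_left ext_fun)

  have B_gen: "B x w1_L w1_L = mconst (w1_D w1_L) + m x (mconst w1_L) + m x (mconst w1_L)"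
    "B x w1_L w1_H = mconst (w1_D w1_H)" "B x w1_H w1_L = - mconst (w1_D w1_H)"
    "B x w1_H w1_H = 0" for x
  proof -
    have "w1_scale 2 w1_L = w1_L + (w1_L :: 'f w1)"
      by (simp add: w1_scale_def w1_L_def one_pCons)
    then show "B x w1_L w1_L = mconst (w1_D w1_L) + m x (mconst w1_L) + m x (mconst w1_L)"
      by (simp add: B_def m_def w1_br_L_L w1.at_var_pCons w1.mmult_add_right w1.mconst_add)
  qed (simp_all add: B_def w1_br_L_H w1_br_H_L w1_br_H_H w1.at_var_pCons w1.mconst_minus)

  note ses = B_add_left B_add_right B_scale_left B_scale_right B_D_left B_D_right ext_B ext_B'
    ext_fun_add ext_fun ext_B_DD ext_B'_DD m_add_left m_add_right m_minus_right DD_add DD_m DD_minus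

  note gen = B_gen B_zero_left B_zero_right ses m_minus_left m_zero m_assoc DD_mconst DD_zero

  have "ext (B x a) (B y b c) = ext (\<lambda>u. B (x + y) u c) (B x a b) + ext (B y b) (B x a c)"
  proof (induction a rule: w1_induct)
    case L
    show ?case
    proof (induction b rule: w1_induct)
      case L
      show ?case
      proof (induction c rule: w1_induct)
        case L
        show ?case by (simp add: gen algebra_simps)
      next
        case H
        show ?case by (simp add: gen algebra_simps)
      qed (simp_all add: ses algebra_simps)
    next
      case H
      show ?case
      proof (induction c rule: w1_induct)
        case L
        show ?case by (simp add: gen algebra_simps)
      next
        case H
        show ?case by (simp add: gen algebra_simps)
      qed (simp_all add: ses algebra_simps)
    qed (simp_all add: ses algebra_simps)
  next
    case H
    show ?case
    proof (induction b rule: w1_induct)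
      case L
      show ?case
      proof (induction c rule: w1_induct)
        case L
        show ?case by (simp add: gen algebra_simps)
      next
        case H
        show ?case by (simp add: gen algebra_simps)
      qed (simp_all add: ses algebra_simps)
    next
      case H
      show ?case
      proof (induction c rule: w1_induct)
        case L
        show ?case by (simp add: gen algebra_simps)
      next
        case H
        show ?case by (simp add: gen algebra_simps)
      qed (simp_all add: ses algebra_simps)
    qed (simp_all add: ses algebra_simps)
  qed (simp_all add: ses algebra_simps)
  then show ?thesis
    by (simp add: ext_def B_def)
qed

global_interpretation W1: lie_conformal_algebra w1_scale w1_D w1_br
  by unfold_locales
    (rule w1_D_add w1_D_scale w1_br_add_left w1_br_add_right w1_br_scale_left w1_br_scale_right
      w1_br_D_left w1_br_D_right w1_br_skew w1_br_jacobi)+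

end

theory Submission
  imports Defs "HOL-Library.Function_Algebras"
begin

text \<open>The proof has three ingredients: a Cartan calculus for the basic complex, two homotopies
  given by contractions with \<open>L\<close>, and a computation with eight monomials.

  A cochain has polynomial values in \<open>\<lambda>\<^sub>1, \<dots>, \<lambda>\<^sub>q\<close>. The field is infinite, so such a polynomial is
  determined by its values at tuples of scalars, and a cochain is the same as an alternating
  function of lists of pairs \<open>(a, \<lambda>)\<close> with \<open>\<lambda>\<close> a scalar (\<open>cochain_represents\<close>,
  \<open>represents_cochain\<close>). A pair behaves like an element of a Lie algebra with the bracket
  \<open>[(a, \<lambda>), (b, \<mu>)] = (a\<^sub>\<lambda> b, \<lambda> + \<mu>)\<close>, the axioms holding after an alternating function is
  applied. The differential becomes that of Chevalley and Eilenberg, and as such it satisfies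
  \<open>\<iota>\<^sub>x \<delta> + \<delta> \<iota>\<^sub>x = \<theta>\<^sub>x\<close> (\<open>delta_Cons\<close>). This identity is a recursion over the argument list; with
  it, \<open>\<delta>\<^sup>2 = 0\<close>, \<open>[\<theta>\<^sub>x, \<theta>\<^sub>y] = \<theta>\<close> at the bracket, and \<open>\<theta>\<^sub>x \<delta> = \<delta> \<theta>\<^sub>x\<close> are short inductions. For
  \<open>x = (a, \<lambda>)\<close> both sides are polynomials in \<open>\<lambda>\<close>, so the identity holds coefficientwise, and every
  coefficient of \<open>\<theta>\<close> is homotopic to zero.

  Since \<open>[L\<^sub>\<lambda> a] = \<partial> a + O(\<lambda>)\<close>, the constant coefficient of \<open>\<theta>\<close> for \<open>(L, \<lambda>)\<close> is the operator \<open>\<partial>\<close>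
  of the basic complex (\<open>cochain_D_lie\<close>). So \<open>\<partial>\<close> is zero on basic cohomology. It is injective on
  cochains because the adjoint module is free over the polynomials in \<open>\<partial>\<close>, and the long exact
  sequence of \<open>0 \<rightarrow> C \<rightarrow> C \<rightarrow> C / \<partial> C \<rightarrow> 0\<close> shows that the reduced cohomology in degree \<open>q\<close> has the
  dimension of the basic cohomology in degrees \<open>q\<close> and \<open>q + 1\<close> together
  (\<open>reduced_cohomology_has_dim\<close>). It remains to compute the latter.

  A cochain is determined by its values on the generators \<open>L\<close> and \<open>H\<close>, hence by scalars indexed by
  a list of pairs (generator, exponent of \<open>\<lambda>\<^sub>i\<close>) and a basis element \<open>\<partial>\<^sup>j L\<close> or \<open>\<partial>\<^sup>j H\<close> of the
  target. The linear coefficient of \<open>\<theta>\<close> for \<open>(L, \<lambda>)\<close> multiplies each scalar by its weight, the sum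
  of \<open>n - 1\<close> for each pair \<open>(L, n)\<close>, \<open>n + 1\<close> for each pair \<open>(H, n)\<close>, and \<open>j + 2\<close> for \<open>\<partial>\<^sup>j L\<close>, \<open>j\<close>
  for \<open>\<partial>\<^sup>j H\<close> (\<open>wcoef_lie\<close>). As this operator is homotopic to zero, cohomology is computed by the
  subcomplex of weight zero (\<open>weight_zero_projection\<close>). By skew-symmetry the pairs are distinct,
  so the only negative contribution is one \<open>- 1\<close> from \<open>(L, 0)\<close>. This leaves the target \<open>H\<close> or
  \<open>\<partial> H\<close> and eight monomials in degrees 0 to 3 (\<open>weights_of_sets\<close>, \<open>weight_zero_eq_0\<close>).

  Let \<open>L\<^sub>n\<close>, \<open>H\<^sub>n\<close> be the one-forms that read off the coefficient of \<open>\<lambda>\<^sup>n\<close> at a generator. The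
  weight-zero complex is spanned by \<open>H\<close>; \<open>L\<^sub>0 \<partial>H\<close>, \<open>L\<^sub>1 H\<close>; \<open>L\<^sub>1 L\<^sub>0 \<partial>H\<close>, \<open>L\<^sub>2 L\<^sub>0 H\<close>,
  \<open>L\<^sub>0 H\<^sub>0 H\<close>; \<open>L\<^sub>2 L\<^sub>1 L\<^sub>0 H\<close>, \<open>L\<^sub>1 L\<^sub>0 H\<^sub>0 H\<close>, where products are wedge products. The
  differential maps \<open>H\<close> to \<open>L\<^sub>0 \<partial>H\<close> and \<open>L\<^sub>1 H\<close> to \<open>- (L\<^sub>1 L\<^sub>0 \<partial>H + L\<^sub>2 L\<^sub>0 H)\<close>, and all other
  monomials to zero (\<open>diff_mono_H\<close>, \<open>diff_mono_L1\<close>, \<open>diff_mono_L2L0\<close>, \<open>diff_mono_L0H0\<close>). Hence the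
  basic cohomology has dimension 2 in degrees 2 and 3 and vanishes otherwise.\<close>

section \<open>Dimensions of subquotients\<close>

locale ambient_space = vector_space scale
  for scale :: "'a::field \<Rightarrow> 'b::ab_group_add \<Rightarrow> 'b"
begin

definition comb :: "'a list \<Rightarrow> 'b list \<Rightarrow> 'b"
  where "comb cs bs = sum_list (map2 scale cs bs)"

lemma comb_simps [simp]:
  "comb [] bs = 0" "comb cs [] = 0" "comb (c # cs) (b # bs) = scale c b + comb cs bs"
  by (simp_all add: comb_def)

lemma comb_append:
  "length cs = length bs \<Longrightarrow> comb (cs @ cs') (bs @ bs') = comb cs bs + comb cs' bs'"
  by (induction cs bs rule: list_induct2) (simp_all add: add.assoc)

lemma comb_zero: "length cs = length bs \<Longrightarrow> set cs \<subseteq> {0} \<Longrightarrow> comb cs bs = 0"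
  by (induction cs bs rule: list_induct2) simp_all

lemma comb_in: "subspace Z \<Longrightarrow> set bs \<subseteq> Z \<Longrightarrow> comb cs bs \<in> Z"
proof (induction cs arbitrary: bs)
  case (Cons c cs)
  then show ?case
    by (cases bs) (auto simp: subspace_0 subspace_add subspace_scale)
qed (simp add: subspace_0)

lemma comb_diff:
  assumes "length cs = length bs" "length cs' = length bs"
  shows "comb cs bs - comb cs' bs = comb (map2 (-) cs cs') bs"
proof -
  have "length cs = length cs'" "length cs' = length bs"
    using assms by simp_all
  then show ?thesis
    by (induction cs cs' bs rule: list_induct3) (simp_all add: scale_left_diff_distrib)
qed

text \<open>The list \<open>bs\<close> represents a basis of \<open>Z / B\<close>. Working with representatives and coefficient
  lists matches the frame of linear combinations in which dimensions are stated, and spares the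
  formation of the quotient.\<close>

definition basis_mod :: "'b set \<Rightarrow> 'b set \<Rightarrow> 'b list \<Rightarrow> bool"
  where "basis_mod Z B bs \<longleftrightarrow> set bs \<subseteq> Z \<and>
    (\<forall>z\<in>Z. \<exists>cs. length cs = length bs \<and> z - comb cs bs \<in> B) \<and>
    (\<forall>cs. length cs = length bs \<longrightarrow> comb cs bs \<in> B \<longrightarrow> set cs \<subseteq> {0})"

text \<open>The space \<open>S\<close>, whose elements may be sets of sets, is the image of the subspace \<open>Z\<close> under a
  linear map with kernel \<open>B\<close>. Forming a further quotient of \<open>S\<close> only enlarges \<open>B\<close>, so that
  iterated quotients become subquotients of one ambient space.\<close>

definition presents :: "('a, 'w) vspace \<Rightarrow> 'b set \<Rightarrow> 'b set \<Rightarrow> ('b \<Rightarrow> 'w) \<Rightarrow> bool"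
  where "presents S Z B p \<longleftrightarrow> vcarrier S = p ` Z \<and> vzero S = p 0 \<and>
    (\<forall>x\<in>Z. \<forall>y\<in>Z. vadd S (p x) (p y) = p (x + y)) \<and>
    (\<forall>c. \<forall>x\<in>Z. vsmult S c (p x) = p (scale c x)) \<and>
    (\<forall>x\<in>Z. \<forall>y\<in>Z. p x = p y \<longleftrightarrow> x - y \<in> B)"

lemma presents_lincomb:
  assumes "presents S Z B p" "subspace Z" "set bs \<subseteq> Z"
  shows "lincomb S (zip cs (map p bs)) = p (comb cs bs)"
  using assms(3)
proof (induction cs arbitrary: bs)
  case Nil
  then show ?case using assms by (simp add: presents_def)
next
  case (Cons c cs)
  show ?case
  proof (cases bs)
    case Nil
    then show ?thesis using assms by (simp add: presents_def)
  next
    case (Cons b bs')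
    then show ?thesis
      using Cons.IH[of bs'] Cons.prems assms(1,2) comb_in[of Z bs' cs] subspace_scale[of Z b c]
      by (simp add: presents_def)
  qed
qed

lemma presents_has_dim:
  assumes S: "presents S Z B p" and Z: "subspace Z" and bs: "basis_mod Z B bs"
  shows "has_dim S (length bs)"
  unfolding has_dim_def is_basis_def
proof (intro exI[of _ "map p bs"] conjI ballI)
  have sub: "set bs \<subseteq> Z"
    using bs by (simp add: basis_mod_def)
  then show "set (map p bs) \<subseteq> vcarrier S"
    using S by (auto simp: presents_def)
  fix x assume "x \<in> vcarrier S"
  then obtain z where z: "z \<in> Z" "x = p z"
    using S by (auto simp: presents_def)
  then obtain cs where cs: "length cs = length bs" "z - comb cs bs \<in> B"
    using bs by (auto simp: basis_mod_def)
  have eq: "x = lincomb S (zip cs' (map p bs)) \<longleftrightarrow> z - comb cs' bs \<in> B" for cs'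
    using S z comb_in[OF Z sub, of cs'] by (simp add: presents_lincomb[OF S Z sub] presents_def)
  show "\<exists>!cs. length cs = length (map p bs) \<and> x = lincomb S (zip cs (map p bs))"
  proof (intro ex1I[of _ cs])
    show "length cs = length (map p bs) \<and> x = lincomb S (zip cs (map p bs))"
      using cs by (simp add: eq)
    fix ds assume "length ds = length (map p bs) \<and> x = lincomb S (zip ds (map p bs))"
    then have ds: "length ds = length bs" "p z = p (comb ds bs)" "p z = p (comb cs bs)"
      using cs z eq[of ds] eq[of cs] by (simp_all add: presents_lincomb[OF S Z sub])
    then have "comb ds bs - comb cs bs \<in> B"
      using S comb_in[OF Z sub] by (metis presents_def)
    then have "comb (map2 (-) ds cs) bs \<in> B"
      using ds cs by (simp add: comb_diff)
    moreover have "length (map2 (-) ds cs) = length bs"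
      using ds cs by simp
    ultimately have "set (map2 (-) ds cs) \<subseteq> {0}"
      using bs unfolding basis_mod_def by blast
    then have "\<forall>i<length bs. ds ! i - cs ! i = 0"
      using ds(1) cs(1) by (force simp: set_conv_nth)
    then show "ds = cs"
      using ds cs by (simp add: list_eq_iff_nth_eq)
  qed
qed simp

lemma presents_restrict:
  assumes "presents S Z B p" "Z' \<subseteq> Z" "X = p ` Z'"
  shows "presents (S\<lparr>vcarrier := X\<rparr>) Z' B p"
  using assms by (auto simp: presents_def subset_iff)

lemma presents_quotient:
  assumes S: "presents S Z B p" and Z: "subspace Z" and Y: "subspace Y" "Y \<subseteq> Z" "B \<subseteq> Y"
  shows "presents (quotient_space S (p ` Y)) Z Y (\<lambda>x. coset S (p ` Y) (p x))"
proof -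
  let ?q = "\<lambda>x. coset S (p ` Y) (p x)"
  have add: "vadd S (p x) (p y) = p (x + y)" if "x \<in> Z" "y \<in> Z" for x y
    using S that by (simp add: presents_def)
  have smult: "vsmult S c (p x) = p (scale c x)" if "x \<in> Z" for x c
    using S that by (simp add: presents_def)
  have eq: "p x = p y \<longleftrightarrow> x - y \<in> B" if "x \<in> Z" "y \<in> Z" for x y
    using S that by (simp add: presents_def)
  have cos: "?q x = {p (x + y) | y. y \<in> Y}" if "x \<in> Z" for x
    using Y(2) that by (force simp: coset_def add)
  have zero: "p ` Y = ?q 0"
    using subspace_0[OF Z] by (auto simp: cos)
  have iff: "?q x = ?q y \<longleftrightarrow> x - y \<in> Y" if "x \<in> Z" "y \<in> Z" for x y
  proof
    assume "?q x = ?q y"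
    then have "p (x + 0) \<in> {p (y + w) | w. w \<in> Y}"
      using subspace_0[OF Y(1)] that by (auto simp: cos)
    then obtain w where w: "w \<in> Y" "p x = p (y + w)"
      by auto
    then have "x - (y + w) \<in> B"
      using that Y(2) Z by (subst eq[symmetric]) (auto intro: subspace_add)
    then have "x - (y + w) + w \<in> Y"
      using Y w by (intro subspace_add) auto
    then show "x - y \<in> Y" by simp
  next
    assume xy: "x - y \<in> Y"
    have "{p (x + w) | w. w \<in> Y} \<subseteq> {p (y + w) | w. w \<in> Y}" if "x - y \<in> Y" for x y
    proof clarify
      fix w assume "w \<in> Y"
      then have "x - y + w \<in> Y"
        using that Y(1) by (simp only: subspace_add)
      then show "\<exists>w'. p (x + w) = p (y + w') \<and> w' \<in> Y"
        by (intro exI[of _ "x - y + w"]) simp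
    qed
    from this[OF xy] this[of y x] subspace_neg[OF Y(1) xy] show "?q x = ?q y"
      using that by (simp add: cos)
  qed
  have sum: "{vadd S a b | a b. a \<in> ?q x \<and> b \<in> ?q y} = ?q (x + y)" if "x \<in> Z" "y \<in> Z" for x y
  proof -
    have "{vadd S a b | a b. a \<in> ?q x \<and> b \<in> ?q y} = {p (x + y + (u + w)) | u w. u \<in> Y \<and> w \<in> Y}"
    proof -
      have "vadd S (p (x + u)) (p (y + w)) = p (x + y + (u + w))" if "u \<in> Y" "w \<in> Y" for u w
        using that \<open>x \<in> Z\<close> \<open>y \<in> Z\<close> Y(2) Z by (subst add) (auto intro: subspace_add simp: algebra_simps)
      then show ?thesis
        using that by (simp add: cos) (metis (no_types, lifting))
    qed
    also have "\<dots> = ?q (x + y)"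
      using that Z Y(1) by (subst cos) (auto intro: subspace_add, metis add_0_right subspace_0)
    finally show ?thesis .
  qed
  have scal: "{vadd S (vsmult S c a) b | a b. a \<in> ?q x \<and> b \<in> p ` Y} = ?q (scale c x)" if "x \<in> Z" for x c
  proof -
    have "{vadd S (vsmult S c a) b | a b. a \<in> ?q x \<and> b \<in> p ` Y} =
        {p (scale c x + (scale c u + w)) | u w. u \<in> Y \<and> w \<in> Y}"
    proof -
      have "vadd S (vsmult S c (p (x + u))) (p w) = p (scale c x + (scale c u + w))"
        if "u \<in> Y" "w \<in> Y" for u w
        using that \<open>x \<in> Z\<close> Y(2) Z
        by (subst smult, auto intro: subspace_add) (subst add, auto intro: subspace_add subspace_scale
            simp: algebra_simps)
      then show ?thesis
        using that by (simp add: cos image_iff) (metis (no_types, lifting))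
    qed
    also have "\<dots> = ?q (scale c x)"
      using that Z Y(1)
      by (subst cos) (auto intro: subspace_add subspace_scale, metis add_0_left scale_zero_right subspace_0)
    finally show ?thesis .
  qed
  show ?thesis
    unfolding presents_def quotient_space_def
    using S sum scal iff zero by (auto simp: presents_def)
qed

end

section \<open>Complexes with a contraction\<close>

locale contracted_complex = ambient_space scale
  for scale :: "'f::field \<Rightarrow> 'v::ab_group_add \<Rightarrow> 'v" +
  fixes C :: "nat \<Rightarrow> 'v set" and d h :: "'v \<Rightarrow> 'v"
  assumes C_subspace: "subspace (C q)"
    and d_in: "f \<in> C q \<Longrightarrow> d f \<in> C (Suc q)"
    and d_add: "f \<in> C q \<Longrightarrow> g \<in> C q \<Longrightarrow> d (f + g) = d f + d g"
    and d_scale: "f \<in> C q \<Longrightarrow> d (scale c f) = scale c (d f)"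
    and d_d: "f \<in> C q \<Longrightarrow> d (d f) = 0"
    and h_in: "f \<in> C (Suc q) \<Longrightarrow> h f \<in> C q"
    and h_0: "f \<in> C 0 \<Longrightarrow> h f = 0"
    and h_add: "f \<in> C q \<Longrightarrow> g \<in> C q \<Longrightarrow> h (f + g) = h f + h g"
    and h_scale: "f \<in> C q \<Longrightarrow> h (scale c f) = scale c (h f)"
begin

definition lie :: "'v \<Rightarrow> 'v"
  where "lie f = d (h f) + h (d f)"

definition cocycles :: "nat \<Rightarrow> 'v set"
  where "cocycles q = {f \<in> C q. d f = 0}"

definition coboundaries :: "nat \<Rightarrow> 'v set"
  where "coboundaries q = (case q of 0 \<Rightarrow> {0} | Suc p \<Rightarrow> d ` C p)"

lemmas C_0 = subspace_0[OF C_subspace] and C_add = subspace_add[OF C_subspace]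
  and C_scale = subspace_scale[OF C_subspace] and C_diff = subspace_diff[OF C_subspace]

lemma d_0: "d 0 = 0"
  using d_scale[OF C_0[of 0], of 0] by simp

lemma h_zero: "h 0 = 0"
  using h_scale[OF C_0[of 0], of 0] by simp

lemma d_diff: "f \<in> C q \<Longrightarrow> g \<in> C q \<Longrightarrow> d (f - g) = d f - d g"
  using d_add[of "f - g" q g] C_diff[of f q g] by simp

lemma dh_in: "f \<in> C q \<Longrightarrow> d (h f) \<in> C q"
  by (cases q) (auto simp: h_0 d_0 C_0 d_in h_in)

lemma dh_add: "f \<in> C q \<Longrightarrow> g \<in> C q \<Longrightarrow> d (h (f + g)) = d (h f) + d (h g)"
  by (cases q) (auto simp: h_0 d_0 C_add h_add d_add[OF h_in h_in])

lemma dh_scale: "f \<in> C q \<Longrightarrow> d (h (scale c f)) = scale c (d (h f))"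
  by (cases q) (auto simp: h_0 d_0 C_scale h_scale d_scale[OF h_in])

lemma ddh: "f \<in> C q \<Longrightarrow> d (d (h f)) = 0"
  by (cases q) (auto simp: h_0 d_0 d_d[OF h_in])

lemma lie_in: "f \<in> C q \<Longrightarrow> lie f \<in> C q"
  by (simp add: lie_def C_add dh_in h_in d_in)

lemma lie_add: "f \<in> C q \<Longrightarrow> g \<in> C q \<Longrightarrow> lie (f + g) = lie f + lie g"
  by (simp add: lie_def dh_add d_add h_add[OF d_in d_in] algebra_simps)

lemma lie_scale: "f \<in> C q \<Longrightarrow> lie (scale c f) = scale c (lie f)"
  by (simp add: lie_def dh_scale d_scale h_scale[OF d_in] scale_right_distrib)

lemma lie_diff: "f \<in> C q \<Longrightarrow> g \<in> C q \<Longrightarrow> lie (f - g) = lie f - lie g"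
  using lie_add[of "f - g" q g] C_diff[of f q g] by simp

lemma lie_0: "lie 0 = 0"
  by (simp add: lie_def d_0 h_zero)

lemma d_lie: "f \<in> C q \<Longrightarrow> d (lie f) = lie (d f)"
  by (simp add: lie_def d_add[OF dh_in h_in[OF d_in]] ddh d_d d_in h_zero)

lemma cocycles_subspace: "subspace (cocycles q)"
  by (rule subspaceI) (auto simp: cocycles_def C_0 d_0 C_add C_scale d_add d_scale)

lemma coboundaries_subspace: "subspace (coboundaries q)"
proof (cases q)
  case 0
  then show ?thesis by (auto simp: coboundaries_def intro: subspaceI)
next
  case (Suc p)
  show ?thesis
  proof (rule subspaceI)
    show "0 \<in> coboundaries q"
      using C_0[of p] by (force simp: coboundaries_def Suc d_0)
    show "x + y \<in> coboundaries q" if "x \<in> coboundaries q" "y \<in> coboundaries q" for x y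
      using that by (auto simp: coboundaries_def Suc simp flip: d_add intro!: imageI C_add)
    show "scale c x \<in> coboundaries q" if "x \<in> coboundaries q" for x c
      using that by (auto simp: coboundaries_def Suc simp flip: d_scale intro!: imageI C_scale)
  qed
qed

lemma coboundaries_in: "coboundaries q \<subseteq> cocycles q"
  by (cases q) (auto simp: coboundaries_def cocycles_def C_0 d_0 d_in d_d)

lemma dh_coboundary: "f \<in> C q \<Longrightarrow> d (h f) \<in> coboundaries q"
  by (cases q) (auto simp: coboundaries_def h_0 d_0 h_in)

lemma comb_map:
  assumes "subspace Z" "set bs \<subseteq> Z"
    and add: "\<And>f g. f \<in> Z \<Longrightarrow> g \<in> Z \<Longrightarrow> T (f + g) = T f + T g"
    and scale: "\<And>c f. f \<in> Z \<Longrightarrow> T (scale c f) = scale c (T f)"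
  shows "T (comb cs bs) = comb cs (map T bs)"
  using assms(2)
proof (induction cs arbitrary: bs)
  case Nil
  have "T (scale 0 0) = scale 0 (T 0)"
    using subspace_0[OF assms(1)] by (rule scale)
  then show ?case by simp
next
  case (Cons c cs)
  have 0: "T 0 = 0"
    using scale[OF subspace_0[OF assms(1)], of 0] by simp
  show ?case
  proof (cases bs)
    case (Cons b bs')
    then show ?thesis
      using Cons.IH[of bs'] Cons.prems comb_in[OF assms(1), of bs' cs] subspace_scale[OF assms(1)]
      by (simp add: add scale)
  qed (simp add: 0)
qed

end

text \<open>If \<open>lie = d h + h d\<close> is injective, then \<open>0 \<rightarrow> C \<rightarrow> C \<rightarrow> C / lie C \<rightarrow> 0\<close> is an exact sequence of
  complexes whose first map is zero in cohomology. The long exact sequence therefore splits into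
  short ones, and \<open>h\<close> provides the splitting: it lifts a class of degree \<open>q + 1\<close> to a class of
  degree \<open>q\<close> of the quotient, because \<open>d (h b) = lie b\<close> for a cocycle \<open>b\<close>.\<close>

locale injective_contraction = contracted_complex +
  assumes lie_inj: "f \<in> C q \<Longrightarrow> lie f = 0 \<Longrightarrow> f = 0"
begin

definition red_cocycles :: "nat \<Rightarrow> 'b set"
  where "red_cocycles q = {f \<in> C q. d f \<in> lie ` C (Suc q)}"

definition red_coboundaries :: "nat \<Rightarrow> 'b set"
  where "red_coboundaries q = {b + lie g | b g. b \<in> coboundaries q \<and> g \<in> C q}"

text \<open>Only the degree-\<open>q + 1\<close> part needs an idea. If \<open>d z = lie y\<close>, then \<open>lie (d y) = 0\<close>, so \<open>y\<close>
  is a cocycle by injectivity; subtracting \<open>h y\<close> from \<open>z\<close> leaves a cocycle. Conversely, applying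
  \<open>d\<close> to a relation among the \<open>h b\<close> and cancelling \<open>lie\<close> gives a relation among the \<open>b\<close>.\<close>

lemma reduced_basis:
  assumes bs: "basis_mod (cocycles q) (coboundaries q) bs"
    and bs': "basis_mod (cocycles (Suc q)) (coboundaries (Suc q)) bs'"
  shows "basis_mod (red_cocycles q) (red_coboundaries q) (bs @ map h bs')"
proof -
  have sub: "set bs \<subseteq> C q" "set bs' \<subseteq> C (Suc q)" "set bs \<subseteq> cocycles q" "set bs' \<subseteq> cocycles (Suc q)"
    using bs bs' by (auto simp: basis_mod_def cocycles_def)
  have d_comb: "d (comb cs bs) = 0" for cs
    using comb_in[OF cocycles_subspace sub(3)] by (simp add: cocycles_def)
  have cb: "comb cs bs \<in> C q" "comb cs bs' \<in> C (Suc q)" "d (comb cs bs') = 0" for cs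
    using comb_in[OF cocycles_subspace sub(3)] comb_in[OF cocycles_subspace sub(4)]
    by (auto simp: cocycles_def)
  have h_comb: "comb cs (map h bs') = h (comb cs bs')" for cs
    by (rule comb_map[symmetric, OF C_subspace sub(2)]) (simp_all add: h_add h_scale)
  have hb: "h (comb cs bs') \<in> C q" for cs
    using cb by (simp add: h_in)
  have dh: "d (h (comb cs bs')) = lie (comb cs bs')" for cs
    using cb by (simp add: lie_def h_zero)
  show ?thesis
    unfolding basis_mod_def
  proof (intro conjI ballI allI impI)
    have "h x \<in> red_cocycles q" if "x \<in> set bs'" for x
    proof -
      have "x \<in> C (Suc q)" "d (h x) = lie x"
        using that sub by (auto simp: lie_def cocycles_def h_zero)
      then show ?thesis
        by (auto simp: red_cocycles_def h_in)
    qed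
    moreover have "x \<in> red_cocycles q" if "x \<in> set bs" for x
      using that sub C_0[of "Suc q"] lie_0 by (force simp: red_cocycles_def cocycles_def)
    ultimately show "set (bs @ map h bs') \<subseteq> red_cocycles q"
      by auto
  next
    fix z assume "z \<in> red_cocycles q"
    then obtain y where z: "z \<in> C q" and y: "y \<in> C (Suc q)" "d z = lie y"
      by (auto simp: red_cocycles_def)
    have "lie (d y) = 0"
      using y z d_d[of z q] d_lie[of y "Suc q"] by simp
    then have "d y = 0"
      using y by (metis d_in lie_inj)
    then obtain cs' where cs': "length cs' = length bs'" "y - comb cs' bs' \<in> coboundaries (Suc q)"
      using bs' y by (auto simp: basis_mod_def cocycles_def)
    then obtain w where w: "w \<in> C q" "y - comb cs' bs' = d w"
      by (auto simp: coboundaries_def)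
    then have y': "y = comb cs' bs' + d w"
      by (simp add: algebra_simps)
    \<comment> \<open>The correction \<open>lie w\<close> accounts for the difference \<open>d w\<close> between \<open>y\<close> and \<open>comb cs' bs'\<close>.\<close>
    define z' where "z' = z - h (comb cs' bs') - lie w"
    have "z' \<in> C q"
      using z w hb by (simp add: z'_def C_diff lie_in)
    moreover have "d z' = 0"
      using z w hb cb y(2) y' lie_add[of "comb cs' bs'" "Suc q" "d w"] d_in[OF w(1)]
      by (simp add: z'_def d_diff[OF C_diff] d_diff[of _ q] C_diff lie_in d_lie dh lie_add[OF _ d_in])
    ultimately obtain cs where cs: "length cs = length bs" "z' - comb cs bs \<in> coboundaries q"
      using bs by (auto simp: basis_mod_def cocycles_def)
    have "z - comb (cs @ cs') (bs @ map h bs') = (z' - comb cs bs) + lie w"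
      by (simp add: z'_def comb_append cs h_comb)
    then show "\<exists>cs. length cs = length (bs @ map h bs') \<and> z - comb cs (bs @ map h bs') \<in> red_coboundaries q"
      using cs cs' w unfolding red_coboundaries_def
      by (intro exI[of _ "cs @ cs'"]) auto
  next
    fix cs assume len: "length cs = length (bs @ map h bs')"
      and cs: "comb cs (bs @ map h bs') \<in> red_coboundaries q"
    define cs1 cs2 where "cs1 = take (length bs) cs" and "cs2 = drop (length bs) cs"
    have cs12: "cs = cs1 @ cs2" "length cs1 = length bs" "length cs2 = length bs'"
      using len by (simp_all add: cs1_def cs2_def)
    obtain b w where b: "b \<in> coboundaries q" and w: "w \<in> C q"
      and eq: "comb cs1 bs + h (comb cs2 bs') = b + lie w"
      using cs cs12 by (auto simp: red_coboundaries_def comb_append h_comb)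
    have b': "b \<in> C q" "d b = 0"
      using b coboundaries_in by (auto simp: cocycles_def)
    have "d (comb cs1 bs + h (comb cs2 bs')) = lie (comb cs2 bs')"
      using cb hb by (simp add: d_add[of _ q] d_comb dh)
    moreover have "d (b + lie w) = lie (d w)"
      using b' w by (simp add: d_add[of _ q] lie_in d_lie)
    ultimately have "lie (comb cs2 bs' - d w) = 0"
      using eq cb w by (simp add: lie_diff[of _ "Suc q"] d_in)
    then have dw: "comb cs2 bs' = d w"
      using lie_inj[of "comb cs2 bs' - d w" "Suc q"] cb w by (simp add: C_diff d_in)
    then have "comb cs2 bs' \<in> coboundaries (Suc q)"
      using w by (simp add: coboundaries_def)
    then have z2: "set cs2 \<subseteq> {0}"
      using bs' cs12 by (simp add: basis_mod_def)
    then have "comb cs2 bs' = 0"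
      using cs12(3) by (metis comb_zero)
    then have c0: "h (comb cs2 bs') = 0" "d w = 0"
      using dw by (simp_all add: h_zero)
    then have "comb cs1 bs = b + d (h w)"
      using eq by (simp add: lie_def h_zero)
    then have "comb cs1 bs \<in> coboundaries q"
      using b w by (simp add: subspace_add[OF coboundaries_subspace] dh_coboundary)
    then have "set cs1 \<subseteq> {0}"
      using bs cs12 by (simp add: basis_mod_def)
    with z2 show "set cs \<subseteq> {0}"
      by (simp add: cs12)
  qed
qed

lemma lie_image_subspace: "subspace (lie ` C q)"
proof (rule subspaceI)
  show "0 \<in> lie ` C q"
    using C_0[of q] lie_0 by force
qed (auto simp flip: lie_add lie_scale intro!: imageI C_add C_scale)

lemma red_cocycles_subspace: "subspace (red_cocycles q)"
proof (rule subspaceI)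
  show "0 \<in> red_cocycles q"
    using subspace_0[OF lie_image_subspace] by (simp add: red_cocycles_def C_0 d_0)
qed (auto simp: red_cocycles_def C_add C_scale d_add d_scale
    simp flip: lie_add lie_scale intro!: imageI)

lemma red_coboundaries_subspace: "subspace (red_coboundaries q)"
proof -
  have "red_coboundaries q = {b + g | b g. b \<in> coboundaries q \<and> g \<in> lie ` C q}"
    by (auto simp: red_coboundaries_def)
  then show ?thesis
    using subspace_sums[OF coboundaries_subspace lie_image_subspace] by simp
qed

context
  fixes K :: "nat \<Rightarrow> ('a, 'b) vspace"
  assumes K: "\<And>q. K q = \<lparr>vcarrier = C q, vzero = 0, vadd = (+), vsmult = scale\<rparr>"
begin

lemma presents_K: "presents (K q) (C q) {0} id"
  by (simp add: presents_def K)

lemma basic_cohomology_has_dim: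
  assumes "basis_mod (cocycles q) (coboundaries q) bs"
  shows "has_dim (cohomology K (\<lambda>q. d) q) (length bs)"
proof -
  have 1: "presents ((K q)\<lparr>vcarrier := cocycles q\<rparr>) (cocycles q) {0} id"
    by (rule presents_restrict[OF presents_K]) (auto simp: cocycles_def)
  have B: "{0} \<subseteq> coboundaries q"
    using subspace_0[OF coboundaries_subspace] by simp
  have "cohomology K (\<lambda>q. d) q = quotient_space ((K q)\<lparr>vcarrier := cocycles q\<rparr>) (id ` coboundaries q)"
    by (simp add: cohomology_def K cocycles_def coboundaries_def split: nat.split)
  then show ?thesis
    using presents_has_dim[OF presents_quotient[OF 1 cocycles_subspace coboundaries_subspace
      coboundaries_in B] cocycles_subspace assms] by simp
qed

lemma reduced_cohomology_has_dim:
  assumes bs: "basis_mod (cocycles q) (coboundaries q) bs"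
    "basis_mod (cocycles (Suc q)) (coboundaries (Suc q)) bs'"
    and R: "\<And>q. R q = quotient_space (K q) (lie ` C q)"
    and Rd: "\<And>q X. Rd q X = (\<Union>f\<in>X. coset (K (Suc q)) (lie ` C (Suc q)) (d f))"
  shows "has_dim (cohomology R Rd q) (length bs + length bs')"
proof -
  define p where "p q = coset (K q) (lie ` C q)" for q
  have p: "p q f = {f + lie g | g. g \<in> C q}" for q f
    by (auto simp: p_def coset_def K)
  have sub: "lie ` C q \<subseteq> C q" for q
    by (auto simp: lie_in)
  have pR: "presents (R q) (C q) (lie ` C q) (p q)" for q
    using presents_quotient[OF presents_K C_subspace lie_image_subspace sub, of q]
      subspace_0[OF lie_image_subspace, of q] by (simp add: R p_def)
  have vz: "vzero (R q) = p q 0" for q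
    using pR[of q] by (simp add: presents_def)
  have p_eq: "p q f = p q g \<longleftrightarrow> f - g \<in> lie ` C q" if "f \<in> C q" "g \<in> C q" for f g q
    using pR[of q] that by (simp add: presents_def)
  have Rd_p: "Rd q (p q f) = p (Suc q) (d f)" if "f \<in> C q" for f q
  proof -
    have "p (Suc q) (d g) = p (Suc q) (d f)" if g: "g \<in> p q f" for g
    proof -
      obtain u where "g = f + lie u" "u \<in> C q"
        using g by (auto simp: p)
      then show ?thesis
        using \<open>f \<in> C q\<close> by (simp add: p_eq d_in lie_in d_add[of _ q] d_lie C_add)
    qed
    note const = this
    have mem: "f \<in> p q f"
      using C_0[of q] lie_0 by (force simp: p)
    have "Rd q (p q f) = (\<Union>g\<in>p q f. p (Suc q) (d g))"
      unfolding Rd p_def ..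
    also have "\<dots> = (\<Union>g\<in>p q f. p (Suc q) (d f))"
      by (rule SUP_cong[OF refl]) (rule const)
    also have "\<dots> = p (Suc q) (d f)"
      using mem by blast
    finally show ?thesis .
  qed
  have Z: "{X \<in> vcarrier (R q). Rd q X = vzero (R (Suc q))} = p q ` red_cocycles q"
  proof -
    have "Rd q (p q f) = vzero (R (Suc q)) \<longleftrightarrow> d f \<in> lie ` C (Suc q)" if "f \<in> C q" for f
      using that by (simp add: Rd_p vz p_eq d_in C_0)
    then show ?thesis
      using pR[of q] by (auto simp: presents_def red_cocycles_def)
  qed
  have B: "(case q of 0 \<Rightarrow> {vzero (R 0)} | Suc r \<Rightarrow> Rd r ` vcarrier (R r)) = p q ` red_coboundaries q"
  proof -
    have "(case q of 0 \<Rightarrow> {vzero (R 0)} | Suc r \<Rightarrow> Rd r ` vcarrier (R r)) = p q ` coboundaries q"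
    proof (cases q)
      case (Suc r)
      have "Rd r ` vcarrier (R r) = (\<lambda>f. Rd r (p r f)) ` C r"
        using pR[of r] by (auto simp: presents_def)
      also have "\<dots> = p q ` coboundaries q"
        by (auto simp: Rd_p Suc coboundaries_def)
      finally show ?thesis by (simp add: Suc)
    qed (simp add: vz coboundaries_def)
    also have "\<dots> = p q ` red_coboundaries q"
    proof -
      have "p q (b + lie g) = p q b" if "b \<in> coboundaries q" "g \<in> C q" for b g
      proof -
        have "b \<in> C q"
          using that coboundaries_in by (auto simp: cocycles_def)
        then show ?thesis
          using that by (simp add: p_eq C_add lie_in)
      qed
      moreover have "b \<in> red_coboundaries q" if "b \<in> coboundaries q" for b
        using that C_0[of q] lie_0 by (force simp: red_coboundaries_def)
      ultimately show ?thesis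
        by (auto simp: red_coboundaries_def)
    qed
    finally show ?thesis .
  qed
  have sub1: "red_coboundaries q \<subseteq> red_cocycles q"
  proof
    fix x assume "x \<in> red_coboundaries q"
    then obtain b g where x: "x = b + lie g" "b \<in> coboundaries q" "g \<in> C q"
      by (auto simp: red_coboundaries_def)
    then have "b \<in> C q" "d b = 0"
      using coboundaries_in by (auto simp: cocycles_def)
    with x show "x \<in> red_cocycles q"
      by (auto simp: red_cocycles_def C_add lie_in d_add[of _ q] d_lie d_in)
  qed
  have sub2: "lie ` C q \<subseteq> red_coboundaries q"
    using subspace_0[OF coboundaries_subspace] by (force simp: red_coboundaries_def)
  have "presents ((R q)\<lparr>vcarrier := p q ` red_cocycles q\<rparr>) (red_cocycles q) (lie ` C q) (p q)"
    by (rule presents_restrict[OF pR]) (auto simp: red_cocycles_def)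
  from presents_quotient[OF this red_cocycles_subspace red_coboundaries_subspace sub1 sub2]
  have "has_dim (cohomology R Rd q) (length (bs @ map h bs'))"
    unfolding cohomology_def Z B
    by (rule presents_has_dim[OF _ red_cocycles_subspace reduced_basis[OF bs]])
  then show ?thesis
    by simp
qed

end

end

section \<open>Evaluation of polynomials with vector coefficients\<close>

locale char0_space = vector_space scale
  for scale :: "'f::field_char_0 \<Rightarrow> 'b::ab_group_add \<Rightarrow> 'b"

text \<open>A vector-valued polynomial, in several variables or in one, is evaluated at scalars. The
  scalar multiplication is an argument, because the same polynomials occur over the ring, the
  algebra and the module.\<close>

definition mono_val :: "(nat \<Rightarrow> 'f::comm_ring_1) \<Rightarrow> (nat \<Rightarrow>\<^sub>0 nat) \<Rightarrow> 'f"
  where "mono_val e t = (\<Prod>i\<in>Poly_Mapping.keys t. e i ^ Poly_Mapping.lookup t i)"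

definition ev :: "('f \<Rightarrow> 'm \<Rightarrow> 'm) \<Rightarrow> (nat \<Rightarrow> 'f::field) \<Rightarrow> 'm::ab_group_add mpoly \<Rightarrow> 'm"
  where "ev scale e v = (\<Sum>t\<in>Poly_Mapping.keys v. scale (mono_val e t) (Poly_Mapping.lookup v t))"

definition peval :: "('f \<Rightarrow> 'm \<Rightarrow> 'm) \<Rightarrow> 'f::field \<Rightarrow> 'm::ab_group_add poly \<Rightarrow> 'm"
  where "peval scale x p = (\<Sum>n\<le>degree p. scale (x ^ n) (coeff p n))"

lemma mono_val_superset:
  "finite A \<Longrightarrow> Poly_Mapping.keys t \<subseteq> A \<Longrightarrow> mono_val e t = (\<Prod>i\<in>A. e i ^ Poly_Mapping.lookup t i)"
  unfolding mono_val_def by (rule prod.mono_neutral_left) (auto simp: in_keys_iff)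

lemma mono_val_0 [simp]: "mono_val e 0 = 1"
  by (simp add: mono_val_def)

lemma mono_val_single [simp]: "mono_val e (Poly_Mapping.single i n) = e i ^ n"
  by (subst mono_val_superset[where A = "{i}"]) (auto split: if_splits)

lemma mono_val_add: "mono_val e (s + t) = mono_val e s * mono_val e t"
proof -
  let ?A = "Poly_Mapping.keys s \<union> Poly_Mapping.keys t"
  have "Poly_Mapping.keys (s + t) \<subseteq> ?A"
    by (rule Poly_Mapping.keys_add)
  then show ?thesis
    by (simp add: mono_val_superset[where A = ?A] lookup_add power_add prod.distrib)
qed

text \<open>Exponents with the variables shifted by one, and \<open>n\<close> as exponent of the new variable 0.
  Splitting off the variable 0 reduces statements on several variables to one variable, and is how
  a cochain will be contracted with its first argument.\<close>

lift_definition exp_cons :: "nat \<Rightarrow> (nat \<Rightarrow>\<^sub>0 nat) \<Rightarrow> (nat \<Rightarrow>\<^sub>0 nat)"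
  is "\<lambda>n s i. case i of 0 \<Rightarrow> n | Suc j \<Rightarrow> s j"
proof -
  fix n :: nat and s :: "nat \<Rightarrow> nat"
  assume "finite {i. s i \<noteq> 0}"
  then have "finite (insert 0 (Suc ` {i. s i \<noteq> 0}))"
    by simp
  then show "finite {i. (case i of 0 \<Rightarrow> n | Suc j \<Rightarrow> s j) \<noteq> 0}"
  proof (rule rev_finite_subset, intro subsetI)
    fix i assume "i \<in> {i. (case i of 0 \<Rightarrow> n | Suc j \<Rightarrow> s j) \<noteq> 0}"
    then show "i \<in> insert 0 (Suc ` {i. s i \<noteq> 0})"
      by (cases i) auto
  qed
qed

lemma lookup_exp_cons [simp]:
  "Poly_Mapping.lookup (exp_cons n s) 0 = n"
  "Poly_Mapping.lookup (exp_cons n s) (Suc j) = Poly_Mapping.lookup s j"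
  by (transfer; simp)+

lemma exp_cons_eq_iff: "exp_cons n s = exp_cons n' s' \<longleftrightarrow> n = n' \<and> s = s'"
  by (metis lookup_exp_cons poly_mapping_eqI)

lemma inj_exp_cons: "inj (exp_cons n)"
  by (rule injI) (simp add: exp_cons_eq_iff)

lemma exp_cons_cases: obtains n s where "t = exp_cons n s"
proof -
  have "finite (Suc -` Poly_Mapping.keys t)"
    by (rule finite_vimageI) simp_all
  then have fin: "finite {i. Poly_Mapping.lookup t (Suc i) \<noteq> 0}"
    by (rule rev_finite_subset) (auto simp: in_keys_iff)
  define s where "s = Abs_poly_mapping (\<lambda>i. Poly_Mapping.lookup t (Suc i))"
  have "Poly_Mapping.lookup t i = Poly_Mapping.lookup (exp_cons (Poly_Mapping.lookup t 0) s) i" for i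
    by (cases i) (simp_all add: s_def Abs_poly_mapping_inverse fin[simplified])
  then have "t = exp_cons (Poly_Mapping.lookup t 0) s"
    by (rule poly_mapping_eqI)
  with that show thesis .
qed

lemma keys_exp_cons: "Poly_Mapping.keys (exp_cons n s) = (if n = 0 then {} else {0}) \<union> Suc ` Poly_Mapping.keys s"
proof (rule set_eqI)
  fix i show "i \<in> Poly_Mapping.keys (exp_cons n s) \<longleftrightarrow> i \<in> (if n = 0 then {} else {0}) \<union> Suc ` Poly_Mapping.keys s"
    by (cases i) (auto simp: in_keys_iff)
qed

lemma mono_val_exp_cons: "mono_val (case_nat x e) (exp_cons n s) = x ^ n * mono_val e s"
proof -
  have "mono_val (case_nat x e) (exp_cons n s) =
      (\<Prod>i\<in>insert 0 (Suc ` Poly_Mapping.keys s). case_nat x e i ^ Poly_Mapping.lookup (exp_cons n s) i)"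
    by (rule mono_val_superset) (auto simp: keys_exp_cons)
  also have "\<dots> = x ^ n * mono_val e s"
    by (subst prod.insert) (auto simp: mono_val_def prod.reindex)
  finally show ?thesis .
qed

definition coef0 :: "nat \<Rightarrow> 'm::zero mpoly \<Rightarrow> 'm mpoly"
  where "coef0 n v = Poly_Mapping.map_key (exp_cons n) v"

lemma lookup_coef0: "Poly_Mapping.lookup (coef0 n v) s = Poly_Mapping.lookup v (exp_cons n s)"
  by (simp add: coef0_def map_key.rep_eq inj_exp_cons)

lemma coef0_zero [simp]: "coef0 n 0 = 0"
  by (rule poly_mapping_eqI) (simp add: lookup_coef0)

lemma coef0_add: "coef0 n (v + w) = coef0 n v + coef0 n (w :: 'm::ab_group_add mpoly)"
  by (rule poly_mapping_eqI) (simp add: lookup_coef0 lookup_add)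

lemma coef0_single:
  "coef0 k (Poly_Mapping.single (exp_cons n s) m) = (if k = n then Poly_Mapping.single s m else 0)"
  by (rule poly_mapping_eqI) (simp add: lookup_coef0 lookup_single exp_cons_eq_iff when_def)

context char0_space
begin

abbreviation "evs \<equiv> ev scale"
abbreviation "pevs \<equiv> peval scale"

lemma ev_superset:
  "finite A \<Longrightarrow> Poly_Mapping.keys v \<subseteq> A \<Longrightarrow>
    evs e v = (\<Sum>t\<in>A. scale (mono_val e t) (Poly_Mapping.lookup v t))"
  unfolding ev_def by (rule sum.mono_neutral_left) (auto simp: in_keys_iff)

lemma ev_zero [simp]: "evs e 0 = 0"
  by (simp add: ev_def)

lemma ev_single [simp]: "evs e (Poly_Mapping.single t m) = scale (mono_val e t) m"
  by (subst ev_superset[where A = "{t}"]) (auto split: if_splits)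

lemma ev_add [simp]: "evs e (v + w) = evs e v + evs e w"
proof -
  let ?A = "Poly_Mapping.keys v \<union> Poly_Mapping.keys w"
  have "Poly_Mapping.keys (v + w) \<subseteq> ?A"
    by (rule Poly_Mapping.keys_add)
  then show ?thesis
    by (simp add: ev_superset[where A = ?A] lookup_add scale_right_distrib sum.distrib)
qed

lemma ev_minus [simp]: "evs e (- v) = - evs e v"
  using ev_add[of e "- v" v] by (simp add: eq_neg_iff_add_eq_0)

lemma ev_diff [simp]: "evs e (v - w) = evs e v - evs e w"
  using ev_add[of e "v - w" w] by (simp add: algebra_simps)

lemma ev_sum [simp]: "evs e (\<Sum>i\<in>I. f i) = (\<Sum>i\<in>I. evs e (f i))"
  by (induction I rule: infinite_finite_induct) simp_all

lemma ev_mconst [simp]: "evs e (mconst m) = m"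
  by (simp add: mconst_def)

lemma peval_superset:
  "degree p \<le> N \<Longrightarrow> pevs x p = (\<Sum>n\<le>N. scale (x ^ n) (coeff p n))"
  unfolding peval_def by (rule sum.mono_neutral_left) (auto simp: coeff_eq_0)

lemma peval_zero [simp]: "pevs x 0 = 0"
  by (simp add: peval_def)

lemma peval_pCons [simp]: "pevs x (pCons m p) = m + scale x (pevs x p)"
proof -
  have "pevs x (pCons m p) = (\<Sum>n\<le>Suc (degree p). scale (x ^ n) (coeff (pCons m p) n))"
    by (rule peval_superset) (rule degree_pCons_le)
  also have "\<dots> = m + (\<Sum>n\<le>degree p. scale (x ^ Suc n) (coeff p n))"
    by (subst sum.atMost_Suc_shift) simp
  finally show ?thesis
    by (simp add: peval_def scale_sum_right)
qed

lemma peval_add [simp]: "pevs x (p + q) = pevs x p + pevs x q"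
proof (induction p arbitrary: q)
  case (pCons m p)
  then show ?case by (cases q) (simp add: scale_right_distrib)
qed simp

lemma peval_minus [simp]: "pevs x (- p) = - pevs x p"
  using peval_add[of x "- p" p] by (simp add: eq_neg_iff_add_eq_0)

lemma peval_diff [simp]: "pevs x (p - q) = pevs x p - pevs x q"
  using peval_add[of x "p - q" q] by (simp add: algebra_simps)

lemma peval_map_poly:
  assumes "vector_space scaleU"
    and add: "\<And>u w. T (u + w) = T u + T w" and scale: "\<And>c u. T (scaleU c u) = scale c (T u)"
  shows "pevs x (map_poly T p) = T (peval scaleU x p)"
proof -
  interpret U: vector_space scaleU by fact
  have 0: "T 0 = 0"
    using add[of 0 0] by simp
  have "T (\<Sum>i\<in>I. f i) = (\<Sum>i\<in>I. T (f i))" for f :: "nat \<Rightarrow> _" and I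
    by (induction I rule: infinite_finite_induct) (simp_all add: 0 add)
  then have "T (peval scaleU x p) = (\<Sum>n\<le>degree p. scale (x ^ n) (coeff (map_poly T p) n))"
    by (simp add: peval_def scale 0 coeff_map_poly)
  then show ?thesis
    using peval_superset[of "map_poly T p" "degree p" x] degree_le[of "degree p" "map_poly T p"]
    by (simp add: 0 coeff_map_poly coeff_eq_0)
qed

text \<open>With \<open>m\<^sub>n\<close> the coefficients of \<open>p\<close>, the combination \<open>p(2x) - 2\<^sup>N p(x)\<close> has coefficients
  \<open>(2\<^sup>n - 2\<^sup>N) m\<^sub>n\<close>, so it eliminates the top coefficient and no other.\<close>

lemma vanishing_coefficients:
  assumes "\<And>x. (\<Sum>n<N. scale (x ^ n) (m n)) = 0" "n < N"
  shows "m n = 0"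
  using assms
proof (induction N arbitrary: m n)
  case (Suc N)
  have "(\<Sum>n<N. scale (x ^ n) (scale (2 ^ n - 2 ^ N) (m n))) = 0" for x
  proof -
    have "(\<Sum>n<N. scale (x ^ n) (scale (2 ^ n - 2 ^ N) (m n))) =
        (\<Sum>n<Suc N. scale (x ^ n) (scale (2 ^ n - 2 ^ N) (m n)))"
      by simp
    also have "\<dots> = (\<Sum>n<Suc N. scale ((2 * x) ^ n) (m n)) - scale (2 ^ N) (\<Sum>n<Suc N. scale (x ^ n) (m n))"
      by (simp only: scale_sum_right scale_scale flip: sum_subtractf scale_left_diff_distrib)
        (simp only: power_mult_distrib algebra_simps)
    also have "\<dots> = 0"
      by (simp only: Suc.prems(1)) simp
    finally show ?thesis .
  qed
  then have "scale (2 ^ n - 2 ^ N) (m n) = 0" if "n < N" for n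
    using Suc.IH[of "\<lambda>n. scale (2 ^ n - 2 ^ N) (m n)"] that by blast
  moreover have "(2 :: 'f) ^ n \<noteq> 2 ^ N" if "n < N" for n
  proof
    assume "(2 :: 'f) ^ n = 2 ^ N"
    then have "(of_nat (2 ^ n) :: 'f) = of_nat (2 ^ N)"
      by simp
    then have "(2::nat) ^ n = 2 ^ N"
      by (simp only: of_nat_eq_iff)
    with that show False by simp
  qed
  ultimately have low: "m n = 0" if "n < N" for n
    using that by (simp add: scale_eq_0_iff)
  have "m N = 0"
    using Suc.prems(1)[of 1] low by simp
  with low Suc.prems(2) show ?case
    by (auto simp: less_Suc_eq)
qed simp

lemma peval_eq_0: "(\<And>x. pevs x p = 0) \<Longrightarrow> p = 0"
proof (rule poly_eqI)
  fix n assume *: "\<And>x. pevs x p = 0"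
  have "(\<Sum>k<Suc (max n (degree p)). scale (x ^ k) (coeff p k)) = 0" for x
  proof -
    have "pevs x p = (\<Sum>k\<le>max n (degree p). scale (x ^ k) (coeff p k))"
      by (rule peval_superset) simp
    then show ?thesis
      by (simp only: * lessThan_Suc_atMost)
  qed
  then have "coeff p n = 0"
    by (rule vanishing_coefficients) simp
  then show "coeff p n = coeff 0 n"
    by simp
qed

lemma peval_inject: "(\<And>x. pevs x p = pevs x p') \<Longrightarrow> p = p'"
  using peval_eq_0[of "p - p'"] by simp

text \<open>For fixed values of the other variables a polynomial in several variables is a polynomial in
  the variable 0.\<close>

lemma ev_case_nat:
  obtains P where "\<And>x. evs (case_nat x e) v = pevs x P" "\<And>n. coeff P n = evs e (coef0 n v)"
proof -
  have "\<exists>P. (\<forall>x. evs (case_nat x e) v = pevs x P) \<and> (\<forall>n. coeff P n = evs e (coef0 n v))"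
  proof (induction v rule: poly_mapping_add_induct)
    case zero
    show ?case by (intro exI[of _ 0]) simp
  next
    case (single t m)
    obtain n s where t: "t = exp_cons n s"
      by (rule exp_cons_cases)
    have "pevs x (monom u n) = scale (x ^ n) u" for x u
      by (subst peval_superset[of _ n]) (auto simp: degree_monom_le sum.delta' if_distrib cong: if_cong)
    then show ?case
      by (intro exI[of _ "monom (scale (mono_val e s) m) n"])
        (auto simp: t mono_val_exp_cons coef0_single)
  next
    case (add v w)
    then obtain P P' where "\<forall>x. evs (case_nat x e) v = pevs x P" "\<forall>n. coeff P n = evs e (coef0 n v)"
      "\<forall>x. evs (case_nat x e) w = pevs x P'" "\<forall>n. coeff P' n = evs e (coef0 n w)"
      by blast
    then show ?case
      by (intro exI[of _ "P + P'"]) (simp add: coef0_add)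
  qed
  with that show thesis by blast
qed

lemma ev_cong:
  assumes "\<And>t. t \<in> Poly_Mapping.keys v \<Longrightarrow> Poly_Mapping.keys t \<subseteq> {..<q}" "\<And>i. i < q \<Longrightarrow> e i = e' i"
  shows "evs e v = evs e' v"
  unfolding ev_def mono_val_def
  using assms by (intro sum.cong refl arg_cong2[where f = scale] prod.cong) (auto simp: subset_iff)

text \<open>By induction on the number of variables. If \<open>v\<close> is unchanged by the variables from \<open>q\<close> on, then
  its coefficients with respect to the variable 0 are unchanged by those from \<open>q - 1\<close> on; for \<open>q = 0\<close>
  they are constant, and only the coefficient of degree 0 survives.\<close>

lemma keys_of_dependence:
  assumes "\<And>e e'. (\<And>i. i < q \<Longrightarrow> e i = e' i) \<Longrightarrow> evs e v = evs e' v"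
    and "\<And>t. t \<in> Poly_Mapping.keys v \<Longrightarrow> Poly_Mapping.keys t \<subseteq> {..<N}"
    and "t \<in> Poly_Mapping.keys v"
  shows "Poly_Mapping.keys t \<subseteq> {..<q}"
  using assms
proof (induction N arbitrary: v q t)
  case 0
  then have "Poly_Mapping.keys t \<subseteq> {..<0}"
    by blast
  then show ?case by auto
next
  case (Suc N)
  obtain n s where t: "t = exp_cons n s"
    by (rule exp_cons_cases)
  have s: "s \<in> Poly_Mapping.keys (coef0 n v)"
    using Suc.prems(3) by (simp add: t in_keys_iff lookup_coef0)
  have kN: "Poly_Mapping.keys s \<subseteq> {..<N}" if "s \<in> Poly_Mapping.keys (coef0 n v)" for s n
  proof
    fix j assume "j \<in> Poly_Mapping.keys s"
    then have "Suc j \<in> Poly_Mapping.keys (exp_cons n s)"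
      by (simp add: keys_exp_cons)
    moreover have "exp_cons n s \<in> Poly_Mapping.keys v"
      using that by (simp add: in_keys_iff lookup_coef0)
    ultimately show "j \<in> {..<N}"
      using Suc.prems(2) by fastforce
  qed
  have eq: "evs e (coef0 n v) = evs e' (coef0 n v)"
    if "\<And>x. evs (case_nat x e) v = evs (case_nat x e') v" for e e' n
  proof -
    obtain P where P: "\<And>x. evs (case_nat x e) v = pevs x P" "\<And>n. coeff P n = evs e (coef0 n v)"
      using ev_case_nat[of e v] by blast
    obtain P' where P': "\<And>x. evs (case_nat x e') v = pevs x P'" "\<And>n. coeff P' n = evs e' (coef0 n v)"
      using ev_case_nat[of e' v] by blast
    have "P = P'"
      using that by (intro peval_inject) (simp add: P(1) P'(1))
    then show ?thesis
      using P(2)[of n] P'(2)[of n] by simp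
  qed
  show ?case
  proof (cases q)
    case (Suc r)
    have "Poly_Mapping.keys s \<subseteq> {..<r}"
    proof (rule Suc.IH[where v = "coef0 n v"])
      show "evs e (coef0 n v) = evs e' (coef0 n v)" if "\<And>i. i < r \<Longrightarrow> e i = e' i" for e e'
        by (rule eq, rule Suc.prems(1)) (use that Suc in \<open>auto split: nat.split\<close>)
    qed (fact kN, fact s)
    then show ?thesis
      using Suc by (auto simp: t keys_exp_cons split: if_splits)
  next
    case 0
    obtain P where P: "\<And>x. evs (case_nat x (\<lambda>_. 0)) v = pevs x P" "\<And>n. coeff P n = evs (\<lambda>_. 0) (coef0 n v)"
      using ev_case_nat[of "\<lambda>_. 0" v] by blast
    have "pevs x P = pevs x [:evs (\<lambda>_. 0) v:]" for x
      using Suc.prems(1)[of "case_nat x (\<lambda>_. 0)" "\<lambda>_. 0"] 0 by (simp flip: P(1))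
    then have Pc: "P = [:evs (\<lambda>_. 0) v:]"
      by (rule peval_inject)
    have dep: "evs e (coef0 k v) = evs e' (coef0 k v)" for e e' k
      by (rule eq, rule Suc.prems(1)) (simp add: 0)
    have z: "u = 0" if "u \<in> Poly_Mapping.keys (coef0 n v)" for u
    proof -
      have "Poly_Mapping.keys u \<subseteq> {..<0}"
        by (rule Suc.IH[where v = "coef0 n v"]) (rule dep, erule kN, fact that)
      then show ?thesis
        by (simp add: keys_eq_empty)
    qed
    then have s0: "s = 0"
      using s by blast
    have "n = 0"
    proof (rule ccontr)
      assume "n \<noteq> 0"
      have single: "coef0 n v = Poly_Mapping.single 0 (Poly_Mapping.lookup (coef0 n v) 0)"
      proof (rule poly_mapping_eqI)
        fix u show "Poly_Mapping.lookup (coef0 n v) u =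
            Poly_Mapping.lookup (Poly_Mapping.single 0 (Poly_Mapping.lookup (coef0 n v) 0)) u"
          using z[of u] by (cases "u = 0") (auto simp: lookup_single in_keys_iff)
      qed
      have "evs (\<lambda>_. 0) (coef0 n v) = 0"
        using \<open>n \<noteq> 0\<close> by (simp add: Pc coeff_pCons flip: P(2) split: nat.split)
      then have "Poly_Mapping.lookup (coef0 n v) 0 = 0"
        by (subst (asm) single) simp
      with s s0 show False
        by (simp add: in_keys_iff)
    qed
    with s0 show ?thesis
      by (simp add: t keys_exp_cons)
  qed
qed

lemma keys_bound:
  obtains N where "\<And>t. t \<in> Poly_Mapping.keys (v :: 'b mpoly) \<Longrightarrow> Poly_Mapping.keys t \<subseteq> {..<N}"
proof -
  have "finite (\<Union>t\<in>Poly_Mapping.keys v. Poly_Mapping.keys t)"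
    by simp
  then obtain N where "\<forall>i\<in>(\<Union>t\<in>Poly_Mapping.keys v. Poly_Mapping.keys t). i < N"
    using finite_nat_set_iff_bounded by blast
  with that show thesis by (auto simp: subset_iff)
qed

text \<open>This translates the requirement that the values of a \<open>q\<close>-cochain are polynomials in \<open>q\<close>
  variables into a statement on evaluations.\<close>

lemma keys_subset_iff:
  "(\<forall>t\<in>Poly_Mapping.keys v. Poly_Mapping.keys t \<subseteq> {..<q}) \<longleftrightarrow>
    (\<forall>e e'. (\<forall>i<q. e i = e' i) \<longrightarrow> evs e v = evs e' v)"
proof
  assume "\<forall>t\<in>Poly_Mapping.keys v. Poly_Mapping.keys t \<subseteq> {..<q}"
  then show "\<forall>e e'. (\<forall>i<q. e i = e' i) \<longrightarrow> evs e v = evs e' v"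
    using ev_cong[of v q] by blast
next
  assume *: "\<forall>e e'. (\<forall>i<q. e i = e' i) \<longrightarrow> evs e v = evs e' v"
  obtain N where "\<And>t. t \<in> Poly_Mapping.keys v \<Longrightarrow> Poly_Mapping.keys t \<subseteq> {..<N}"
    using keys_bound[of v] by blast
  with * show "\<forall>t\<in>Poly_Mapping.keys v. Poly_Mapping.keys t \<subseteq> {..<q}"
    using keys_of_dependence[of q v N] by blast
qed

text \<open>A polynomial that vanishes everywhere depends on no variable, hence is constant.\<close>

lemma ev_eq_0:
  assumes "\<And>e. evs e v = 0"
  shows "v = 0"
proof (rule ccontr)
  assume "v \<noteq> 0"
  have "\<forall>t\<in>Poly_Mapping.keys v. Poly_Mapping.keys t \<subseteq> {..<0}"
    by (subst keys_subset_iff) (simp add: assms)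
  then have t0: "t = 0" if "t \<in> Poly_Mapping.keys v" for t
    using that by simp
  have v: "v = Poly_Mapping.single 0 (Poly_Mapping.lookup v 0)"
  proof (rule poly_mapping_eqI)
    fix t show "Poly_Mapping.lookup v t = Poly_Mapping.lookup (Poly_Mapping.single 0 (Poly_Mapping.lookup v 0)) t"
      using t0[of t] by (cases "t = 0") (auto simp: lookup_single in_keys_iff)
  qed
  have "evs (\<lambda>_. 0) (Poly_Mapping.single 0 (Poly_Mapping.lookup v 0)) = 0"
    using assms[of "\<lambda>_. 0"] v by simp
  then have "Poly_Mapping.lookup v 0 = 0"
    by simp
  with v have "v = 0"
    by simp
  with \<open>v \<noteq> 0\<close> show False ..
qed

lemma ev_inject: "(\<And>e. evs e v = evs e w) \<Longrightarrow> v = w"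
  using ev_eq_0[of "v - w"] by simp

end

interpretation scalar: char0_space "(*) :: 'f::field_char_0 \<Rightarrow> 'f \<Rightarrow> 'f"
  by unfold_locales (simp_all add: algebra_simps)

abbreviation "evF \<equiv> ev (*)"

lemma evF_mult [simp]: "evF e (p * q) = evF e p * evF e (q :: 'f::field_char_0 mpoly)"
proof (induction p rule: poly_mapping_add_induct)
  case (single s c)
  show ?case
  proof (induction q rule: poly_mapping_add_induct)
    case (single t c')
    show ?case by (simp add: mult_single mono_val_add)
  qed (simp_all add: distrib_left)
qed (simp_all add: distrib_right)

lemma evF_one [simp]: "evF e (1 :: 'f::field_char_0 mpoly) = 1"
  by (simp flip: single_one)

lemma evF_power [simp]: "evF e (p ^ n) = evF e (p :: 'f::field_char_0 mpoly) ^ n"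
  by (induction n) simp_all

lemma evF_prod: "evF e (\<Prod>i\<in>I. p i :: 'f::field_char_0 mpoly) = (\<Prod>i\<in>I. evF e (p i))"
  by (induction I rule: infinite_finite_induct) simp_all

lemma evF_mvar [simp]: "evF e (mvar i :: 'f::field_char_0 mpoly) = e i"
  by (simp add: mvar_def)

lemma evF_of_int [simp]: "evF e (of_int k :: 'f::field_char_0 mpoly) = of_int k"
proof -
  have "evF e (of_nat n :: 'f mpoly) = of_nat n" for n
    by (induction n) simp_all
  then show ?thesis
    by (cases k) simp_all
qed

context char0_space
begin

lemma ev_mmult [simp]: "evs e (mmult scale p v) = scale (evF e p) (evs e v)"
proof (induction p rule: poly_mapping_add_induct)
  case (single s c)
  show ?case
  proof (induction v rule: poly_mapping_add_induct)
    case (single t m)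
    have "mono_val e (s + t) * c = mono_val e s * c * mono_val e t"
      by (simp only: mono_val_add mult_ac)
    then show ?case
      by (simp only: mmult_single ev_single scalar.ev_single scale_scale)
  qed (simp_all add: mmult_add_right scale_right_distrib)
qed (simp_all add: mmult_add_left scale_left_distrib)

text \<open>The linear extension of a map to polynomials with vector coefficients commutes with
  evaluation, so that nested \<open>\<lambda>\<close>-brackets turn into compositions of ordinary maps.\<close>

lemma ev_mext:
  assumes "char0_space scaleU"
    and add: "\<And>u w. g (u + w) = g u + g w" and scale: "\<And>c u. g (scaleU c u) = mmult scale (mconst c) (g u)"
  shows "evs e (mext scale g v) = evs e (g (ev scaleU e v))"
proof -
  interpret U: char0_space scaleU by fact
  have 0: "g 0 = 0"
    using add[of 0 0] by simp
  show ?thesis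
    by (induction v rule: poly_mapping_add_induct)
      (simp_all add: 0 mext_add[where g = g, OF add] mext_single[where g = g, OF 0] add scale)
qed

lemma ev_at_var [simp]: "evs e (at_var scale x p) = pevs (evF e x) p"
  by (induction p) (simp_all add: at_var_pCons)

lemma ev_msubst [simp]: "evs e (msubst scale zs v) = evs (\<lambda>i. evF e (zs ! i)) v"
  by (simp add: msubst_def evF_prod ev_def[of scale _ v] mono_val_def)

lemma ev_map:
  assumes "\<And>u w. T (u + w) = T u + T w" and "\<And>c u. T (scale c u) = scale c (T u)"
  shows "evs e (Poly_Mapping.map T v) = T (evs e v)"
proof -
  have T: "T (a + b) = T a + T b" "T (scale c a) = scale c (T a)" for a b c
    by (fact assms)+
  show ?thesis
  proof (induction v rule: poly_mapping_add_induct)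
    case zero
    show ?case
      unfolding map_D_zero[of T, OF T] ev_zero D_zero[of T, OF T] ..
  next
    case (single t c)
    show ?case
      unfolding map_D_single[of T, OF T] ev_single T ..
  next
    case (add v w)
    then show ?case
      unfolding map_D_add[of T, OF T] ev_add T by (rule arg_cong2)
  qed
qed

end

section \<open>The Cartan calculus\<close>

text \<open>The sublist at the positions satisfying \<open>P\<close>; hats in the formula for the differential are
  written this way.\<close>

definition sel :: "(nat \<Rightarrow> bool) \<Rightarrow> 'x list \<Rightarrow> 'x list"
  where "sel P xs = map ((!) xs) (filter P [0..<length xs])"

lemma sel_Nil [simp]: "sel P [] = []"
  by (simp add: sel_def)

lemma sel_Cons: "sel P (x # xs) = (if P 0 then [x] else []) @ sel (\<lambda>i. P (Suc i)) xs"
proof -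
  have "[0..<length (x # xs)] = 0 # map Suc [0..<length xs]"
    by (simp del: upt_Suc add: upt_conv_Cons map_Suc_upt)
  then show ?thesis
    by (simp add: sel_def filter_map comp_def)
qed

lemma sel_True [simp]: "sel (\<lambda>i. True) xs = xs"
  by (simp add: sel_def map_nth)

locale char0_lca_module = lca_module scaleA DA br scaleM DM act
  for scaleA :: "'f::field_char_0 \<Rightarrow> 'a::ab_group_add \<Rightarrow> 'a"
    and DA :: "'a \<Rightarrow> 'a"
    and br :: "'a \<Rightarrow> 'a \<Rightarrow> 'a poly"
    and scaleM :: "'f \<Rightarrow> 'm::ab_group_add \<Rightarrow> 'm"
    and DM :: "'m \<Rightarrow> 'm"
    and act :: "'a \<Rightarrow> 'm \<Rightarrow> 'm poly"
begin

sublocale EA: char0_space scaleA ..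
sublocale EM: char0_space scaleM ..

text \<open>For a scalar \<open>l\<close>, the bracket \<open>a\<^sub>l b\<close> is an element of the algebra. The pair \<open>(a, l)\<close> is
  treated as an element \<open>x\<close> of a Lie algebra: \<open>bk\<close> is the bracket of two such elements, \<open>opr\<close> the
  action of one on the module.\<close>

definition cf :: "'a \<Rightarrow> 'f \<Rightarrow> 'a \<Rightarrow> 'a"
  where "cf a l b = EA.pevs l (br a b)"

definition bk :: "'a \<times> 'f \<Rightarrow> 'a \<times> 'f \<Rightarrow> 'a \<times> 'f"
  where "bk x y = (cf (fst x) (snd x) (fst y), snd x + snd y)"

definition opr :: "'a \<times> 'f \<Rightarrow> 'm \<Rightarrow> 'm"
  where "opr x m = EM.pevs (snd x) (act (fst x) m)"

lemma peval_scaleA: "EA.pevs x (map_poly (scaleA c) p) = scaleA c (EA.pevs x p)"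
  by (rule EA.peval_map_poly[OF A.vector_space_axioms])
    (simp_all add: A.scale_right_distrib A.scale_left_commute)

lemma peval_scaleM: "EM.pevs x (map_poly (scaleM c) p) = scaleM c (EM.pevs x p)"
  by (rule EM.peval_map_poly[OF M.vector_space_axioms])
    (simp_all add: M.scale_right_distrib M.scale_left_commute)

lemma peval_dplusA: "EA.pevs x (dplus DA p) = DA (EA.pevs x p) + scaleA x (EA.pevs x p)"
  by (simp add: dplus_def EA.peval_map_poly[OF A.vector_space_axioms, of DA, OF A.D_add A.D_scale])

lemma peval_dplusM: "EM.pevs x (dplus DM p) = DM (EM.pevs x p) + scaleM x (EM.pevs x p)"
  by (simp add: dplus_def EM.peval_map_poly[OF M.vector_space_axioms, of DM, OF DM_add DM_scale])

lemma cf_add_left: "cf (a + b) l c = cf a l c + cf b l c"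
  and cf_add_right: "cf c l (a + b) = cf c l a + cf c l b"
  and cf_scale_left: "cf (scaleA k a) l c = scaleA k (cf a l c)"
  and cf_scale_right: "cf c l (scaleA k a) = scaleA k (cf c l a)"
  and cf_D_left: "cf (DA a) l c = scaleA (- l) (cf a l c)"
  and cf_D_right: "cf c l (DA a) = DA (cf c l a) + scaleA l (cf c l a)"
  by (simp_all add: cf_def A.br_add_left A.br_add_right A.br_scale_left A.br_scale_right
      A.br_D_left A.br_D_right peval_scaleA peval_dplusA)

lemma opr_add: "opr x (m + n) = opr x m + opr x n"
  and opr_scale: "opr x (scaleM k m) = scaleM k (opr x m)"
  and opr_add_left: "opr (a + b, l) m = opr (a, l) m + opr (b, l) m"
  and opr_scale_left: "opr (scaleA k a, l) m = scaleM k (opr (a, l) m)"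
  and opr_D_left: "opr (DA a, l) m = scaleM (- l) (opr (a, l) m)"
  by (simp_all add: opr_def act_add_left act_add_right act_scale_left act_scale_right
      act_D_left act_D_right peval_scaleM peval_dplusM)

lemma opr_0 [simp]: "opr x 0 = 0"
  using opr_add[of x 0 0] by simp

lemma opr_minus: "opr x (- m) = - opr x m"
  using opr_add[of x m "- m"] by (simp add: minus_unique)

lemma opr_diff: "opr x (m - n) = opr x m - opr x n"
  using opr_add[of x m "- n"] by (simp add: opr_minus)

lemma ev_mext_act:
  "EM.evs e (mext scaleM (\<lambda>u. at_var scaleM x (act a u)) v) = opr (a, evF e x) (EM.evs e v)"
  by (subst EM.ev_mext[OF EM.char0_space_axioms])
    (simp_all add: act_add_right M.at_var_add act_scale_right M.at_var_scale opr_def)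

lemma ev_mext_act_left:
  "EM.evs e (mext scaleM (\<lambda>u. at_var scaleM x (act u m)) v) = opr (EA.evs e v, evF e x) m"
  by (subst EM.ev_mext[OF EA.char0_space_axioms])
    (simp_all add: act_add_left M.at_var_add act_scale_left M.at_var_scale opr_def)

lemma ev_mext_br:
  "EA.evs e (mext scaleA (\<lambda>u. at_var scaleA x (br a u)) v) = cf a (evF e x) (EA.evs e v)"
  by (subst EA.ev_mext[OF EA.char0_space_axioms])
    (simp_all add: A.br_add_right A.at_var_add A.br_scale_right A.at_var_scale cf_def)

lemma ev_mext_br_left:
  "EA.evs e (mext scaleA (\<lambda>u. at_var scaleA x (br u c)) v) = cf (EA.evs e v) (evF e x) c"
  by (subst EA.ev_mext[OF EA.char0_space_axioms])
    (simp_all add: A.br_add_left A.at_var_add A.br_scale_left A.at_var_scale cf_def)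

lemma cf_jacobi: "cf a l (cf b m c) = cf (cf a l b) (l + m) c + cf b m (cf a l c)"
  using arg_cong[OF A.br_jacobi[of a b c], of "EA.evs (case_nat l (\<lambda>_. m))"]
  by (simp add: ev_mext_br ev_mext_br_left) (simp add: cf_def)

lemma opr_bk: "opr x (opr y m) - opr y (opr x m) = opr (bk x y) m"
  using arg_cong[OF act_bracket[of "fst x" "fst y" m], of "EM.evs (case_nat (snd x) (\<lambda>_. snd y))"]
  by (simp add: ev_mext_act ev_mext_act_left) (simp add: opr_def bk_def cf_def)

text \<open>Alternating functions of all degrees at once, so that a list argument can be shortened in an
  induction. The relation for \<open>\<partial>\<close> is the sesquilinearity of cochains. Exchanging neighbours
  suffices for skew-symmetry.\<close>

definition alt :: "(('a \<times> 'f) list \<Rightarrow> 'm) \<Rightarrow> bool"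
  where "alt \<phi> \<longleftrightarrow>
    (\<forall>us vs a b l. \<phi> (us @ (a + b, l) # vs) = \<phi> (us @ (a, l) # vs) + \<phi> (us @ (b, l) # vs)) \<and>
    (\<forall>us vs c a l. \<phi> (us @ (scaleA c a, l) # vs) = scaleM c (\<phi> (us @ (a, l) # vs))) \<and>
    (\<forall>us vs a l. \<phi> (us @ (DA a, l) # vs) = scaleM (- l) (\<phi> (us @ (a, l) # vs))) \<and>
    (\<forall>us vs x y. \<phi> (us @ x # y # vs) = - \<phi> (us @ y # x # vs))"

lemma altD:
  assumes "alt \<phi>"
  shows alt_add: "\<phi> (us @ (a + b, l) # vs) = \<phi> (us @ (a, l) # vs) + \<phi> (us @ (b, l) # vs)"
    and alt_scale: "\<phi> (us @ (scaleA c a, l) # vs) = scaleM c (\<phi> (us @ (a, l) # vs))"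
    and alt_D: "\<phi> (us @ (DA a, l) # vs) = scaleM (- l) (\<phi> (us @ (a, l) # vs))"
    and alt_swap: "\<phi> (us @ x # y # vs) = - \<phi> (us @ y # x # vs)"
  using assms unfolding alt_def by blast+

lemma altD_hd:
  assumes "alt \<phi>"
  shows alt_add_hd: "\<phi> ((a + b, l) # vs) = \<phi> ((a, l) # vs) + \<phi> ((b, l) # vs)"
    and alt_scale_hd: "\<phi> ((scaleA c a, l) # vs) = scaleM c (\<phi> ((a, l) # vs))"
    and alt_D_hd: "\<phi> ((DA a, l) # vs) = scaleM (- l) (\<phi> ((a, l) # vs))"
    and alt_swap_hd: "\<phi> (x # y # vs) = - \<phi> (y # x # vs)"
  by (fact altD[OF assms, of "[]", unfolded append_Nil])+

text \<open>The contraction, the Lie derivative and the differential of Chevalley and Eilenberg.\<close>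

definition iota :: "'a \<times> 'f \<Rightarrow> (('a \<times> 'f) list \<Rightarrow> 'm) \<Rightarrow> ('a \<times> 'f) list \<Rightarrow> 'm"
  where "iota x \<phi> = (\<lambda>xs. \<phi> (x # xs))"

definition theta :: "'a \<times> 'f \<Rightarrow> (('a \<times> 'f) list \<Rightarrow> 'm) \<Rightarrow> ('a \<times> 'f) list \<Rightarrow> 'm"
  where "theta x \<phi> xs = opr x (\<phi> xs) - (\<Sum>i<length xs. \<phi> (xs[i := bk x (xs ! i)]))"

definition delta :: "(('a \<times> 'f) list \<Rightarrow> 'm) \<Rightarrow> ('a \<times> 'f) list \<Rightarrow> 'm"
  where "delta \<phi> xs =
    (\<Sum>k<length xs. scaleM ((- 1) ^ k) (opr (xs ! k) (\<phi> (sel (\<lambda>i. i \<noteq> k) xs)))) +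
    (\<Sum>l<length xs. \<Sum>k<l. scaleM ((- 1) ^ (k + l))
      (\<phi> (bk (xs ! k) (xs ! l) # sel (\<lambda>i. i \<noteq> k \<and> i \<noteq> l) xs)))"

definition smul :: "'f \<Rightarrow> (('a \<times> 'f) list \<Rightarrow> 'm) \<Rightarrow> ('a \<times> 'f) list \<Rightarrow> 'm"
  where "smul c \<phi> = (\<lambda>xs. scaleM c (\<phi> xs))"

lemma smul_apply [simp]: "smul c \<phi> xs = scaleM c (\<phi> xs)"
  by (simp add: smul_def)

lemma iota_apply: "iota x \<phi> xs = \<phi> (x # xs)"
  by (simp add: iota_def)

lemma alt_iota: "alt \<phi> \<Longrightarrow> alt (iota x \<phi>)"
  unfolding alt_def iota_def by (metis append_Cons)

lemma altI:
  assumes "\<And>us vs a b l. \<phi> (us @ (a + b, l) # vs) = \<phi> (us @ (a, l) # vs) + \<phi> (us @ (b, l) # vs)"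
    and "\<And>us vs c a l. \<phi> (us @ (scaleA c a, l) # vs) = scaleM c (\<phi> (us @ (a, l) # vs))"
    and "\<And>us vs a l. \<phi> (us @ (DA a, l) # vs) = scaleM (- l) (\<phi> (us @ (a, l) # vs))"
    and "\<And>us vs x y. \<phi> (us @ x # y # vs) = - \<phi> (us @ y # x # vs)"
  shows "alt \<phi>"
  using assms unfolding alt_def by blast

lemma alt_plus:
  assumes "alt \<phi>" "alt \<psi>"
  shows "alt (\<phi> + \<psi>)"
proof (rule altI)
  fix us vs x y
  show "(\<phi> + \<psi>) (us @ x # y # vs) = - (\<phi> + \<psi>) (us @ y # x # vs)"
    by (simp add: alt_swap[OF assms(1), of us x y vs] alt_swap[OF assms(2), of us x y vs])
qed (simp_all only: plus_fun_apply altD(1-3)[OF assms(1)] altD(1-3)[OF assms(2)]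
      M.scale_right_distrib add_ac)

lemma alt_smul:
  assumes "alt \<phi>"
  shows "alt (smul c \<phi>)"
proof (rule altI)
  fix us vs x y
  show "smul c \<phi> (us @ x # y # vs) = - smul c \<phi> (us @ y # x # vs)"
    by (simp add: alt_swap[OF assms, of us x y vs])
qed (simp_all only: smul_apply altD(1-3)[OF assms] M.scale_right_distrib M.scale_left_commute)

lemma alt_uminus: "alt \<phi> \<Longrightarrow> alt (- \<phi>)"
proof -
  have "- \<phi> = smul (- 1) \<phi>"
    by (simp add: fun_eq_iff)
  then show "alt \<phi> \<Longrightarrow> alt (- \<phi>)"
    using alt_smul by simp
qed

lemma alt_diff: "alt \<phi> \<Longrightarrow> alt \<psi> \<Longrightarrow> alt (\<phi> - \<psi>)"
  using alt_plus[of \<phi> "- \<psi>"] alt_uminus[of \<psi>] by simp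

lemma iota_hd:
  assumes "alt \<phi>"
  shows "iota (a + b, l) \<phi> = iota (a, l) \<phi> + iota (b, l) \<phi>"
    and "iota (scaleA c a, l) \<phi> = smul c (iota (a, l) \<phi>)"
    and "iota (DA a, l) \<phi> = smul (- l) (iota (a, l) \<phi>)"
    and "iota y (iota x \<phi>) = - iota x (iota y \<phi>)"
proof -
  show "iota (a + b, l) \<phi> = iota (a, l) \<phi> + iota (b, l) \<phi>"
    "iota (scaleA c a, l) \<phi> = smul c (iota (a, l) \<phi>)"
    "iota (DA a, l) \<phi> = smul (- l) (iota (a, l) \<phi>)"
    by (simp_all only: fun_eq_iff iota_apply plus_fun_apply smul_apply altD_hd(1-3)[OF assms] simp_thms)
  show "iota y (iota x \<phi>) = - iota x (iota y \<phi>)"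
  proof
    fix zs show "iota y (iota x \<phi>) zs = (- iota x (iota y \<phi>)) zs"
      by (simp add: iota_apply alt_swap_hd[OF assms, of x y zs])
  qed
qed

lemma theta_plus: "theta x (\<phi> + \<psi>) = theta x \<phi> + theta x \<psi>"
  by (simp add: theta_def fun_eq_iff opr_add sum.distrib)

lemma theta_uminus: "theta x (- \<phi>) = - theta x \<phi>"
  by (simp add: theta_def fun_eq_iff opr_minus sum_negf)

lemma theta_diff: "theta x (\<phi> - \<psi>) = theta x \<phi> - theta x \<psi>"
  by (simp add: theta_def fun_eq_iff opr_diff sum_subtractf)

lemma theta_smul: "theta x (smul c \<phi>) = smul c (theta x \<phi>)"
  by (simp add: theta_def fun_eq_iff opr_scale M.scale_sum_right M.scale_right_diff_distrib)

lemma delta_plus: "delta (\<phi> + \<psi>) = delta \<phi> + delta \<psi>"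
  by (simp add: delta_def fun_eq_iff opr_add sum.distrib M.scale_right_distrib)

lemma delta_uminus: "delta (- \<phi>) = - delta \<phi>"
  by (simp add: delta_def fun_eq_iff opr_minus sum_negf)

lemma delta_diff: "delta (\<phi> - \<psi>) = delta \<phi> - delta \<psi>"
  using delta_plus[of \<phi> "- \<psi>"] by (simp add: delta_uminus)

lemma delta_smul: "delta (smul c \<phi>) = smul c (delta \<phi>)"
proof
  fix xs
  have *: "scaleM a (scaleM c m) = scaleM c (scaleM a m)" for a m
    by (rule M.scale_left_commute)
  show "delta (smul c \<phi>) xs = smul c (delta \<phi>) xs"
    unfolding delta_def smul_apply opr_scale * M.scale_right_distrib M.scale_sum_right ..
qed

lemma theta_Nil: "theta x \<phi> [] = opr x (\<phi> [])"
  by (simp add: theta_def)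

text \<open>Cartan's second formula \<open>\<iota>\<^sub>y \<theta>\<^sub>x = \<theta>\<^sub>x \<iota>\<^sub>y - \<iota>\<close> at the bracket. With \<open>delta_Cons\<close> it reduces
  each further identity to one on a shorter list.\<close>

lemma theta_Cons: "theta x \<phi> (y # ys) = theta x (iota y \<phi>) ys - \<phi> (bk x y # ys)"
  by (simp add: theta_def sum.lessThan_Suc_shift iota_apply del: sum.lessThan_Suc)

lemma delta_Nil [simp]: "delta \<phi> [] = 0"
  by (simp add: delta_def)

lemma alt_move:
  assumes "alt \<phi>" "l < length xs"
  shows "\<phi> (y # sel (\<lambda>i. i \<noteq> l) xs) = scaleM ((- 1) ^ l) (\<phi> (xs[l := y]))"
  using assms
proof (induction l arbitrary: xs \<phi>)
  case 0
  then show ?case by (cases xs) (simp_all add: sel_Cons)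
next
  case (Suc l)
  then obtain z zs where xs: "xs = z # zs" "l < length zs"
    by (cases xs) auto
  then have "\<phi> (y # sel (\<lambda>i. i \<noteq> Suc l) xs) = - iota z \<phi> (y # sel (\<lambda>i. i \<noteq> l) zs)"
    using alt_swap_hd[OF Suc.prems(1), of y z] by (simp add: sel_Cons iota_apply)
  also have "\<dots> = scaleM ((- 1) ^ Suc l) (\<phi> (xs[Suc l := y]))"
    using Suc.IH[OF alt_iota[OF Suc.prems(1), of z] xs(2)] by (simp add: xs(1) iota_apply)
  finally show ?case .
qed

text \<open>Cartan's formula. The summands of the differential in which \<open>x\<close> does not occur in an
  operator or a bracket form \<open>\<delta> (\<iota>\<^sub>x \<phi>)\<close>, with a sign that comes from the shift of positions and
  from moving \<open>x\<close> past the inserted bracket. The others are the action of \<open>x\<close> on the value and the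
  brackets of \<open>x\<close> with the remaining arguments, moved back to their positions.\<close>

lemma delta_Cons:
  assumes "alt \<phi>"
  shows "delta \<phi> (x # xs) = theta x \<phi> xs - delta (iota x \<phi>) xs"
proof -
  have 1: "(\<Sum>k<length (x # xs). scaleM ((- 1) ^ k) (opr ((x # xs) ! k) (\<phi> (sel (\<lambda>i. i \<noteq> k) (x # xs))))) =
      opr x (\<phi> xs) - (\<Sum>k<length xs. scaleM ((- 1) ^ k) (opr (xs ! k) (iota x \<phi> (sel (\<lambda>i. i \<noteq> k) xs))))"
    by (simp add: sum.lessThan_Suc_shift sel_Cons sum_negf iota_apply del: sum.lessThan_Suc)
  have 2: "(\<Sum>k<Suc l. scaleM ((- 1) ^ (k + Suc l)) (\<phi> (bk ((x # xs) ! k) ((x # xs) ! Suc l) #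
        sel (\<lambda>i. i \<noteq> k \<and> i \<noteq> Suc l) (x # xs)))) =
      - \<phi> (xs[l := bk x (xs ! l)]) - (\<Sum>k<l. scaleM ((- 1) ^ (k + l))
        (iota x \<phi> (bk (xs ! k) (xs ! l) # sel (\<lambda>i. i \<noteq> k \<and> i \<noteq> l) xs)))" if "l < length xs" for l
  proof -
    have "\<phi> (y # x # zs) = - \<phi> (x # y # zs)" for y zs
      by (rule alt_swap_hd[OF assms])
    moreover have "scaleM ((- 1) ^ Suc l) (\<phi> (bk x (xs ! l) # sel (\<lambda>i. i \<noteq> l) xs)) =
        - \<phi> (xs[l := bk x (xs ! l)])"
      by (simp add: alt_move[OF assms that] flip: power_add)
    ultimately show ?thesis
      by (simp add: sum.lessThan_Suc_shift sel_Cons sum_negf iota_apply del: sum.lessThan_Suc)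
  qed
  have 3: "(\<Sum>l<length (x # xs). \<Sum>k<l. scaleM ((- 1) ^ (k + l)) (\<phi> (bk ((x # xs) ! k) ((x # xs) ! l) #
        sel (\<lambda>i. i \<noteq> k \<and> i \<noteq> l) (x # xs)))) =
      (\<Sum>l<length xs. \<Sum>k<Suc l. scaleM ((- 1) ^ (k + Suc l)) (\<phi> (bk ((x # xs) ! k) ((x # xs) ! Suc l) #
        sel (\<lambda>i. i \<noteq> k \<and> i \<noteq> Suc l) (x # xs))))"
    by (simp only: list.size add_Suc_right add_0_right sum.lessThan_Suc_shift[of _ "length xs"]) simp
  have 4: "(\<Sum>l<length xs. \<Sum>k<Suc l. scaleM ((- 1) ^ (k + Suc l)) (\<phi> (bk ((x # xs) ! k) ((x # xs) ! Suc l) #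
        sel (\<lambda>i. i \<noteq> k \<and> i \<noteq> Suc l) (x # xs)))) =
      (\<Sum>l<length xs. - \<phi> (xs[l := bk x (xs ! l)]) - (\<Sum>k<l. scaleM ((- 1) ^ (k + l))
        (iota x \<phi> (bk (xs ! k) (xs ! l) # sel (\<lambda>i. i \<noteq> k \<and> i \<noteq> l) xs))))"
    by (rule sum.cong[OF refl], rule 2) simp
  show ?thesis
    unfolding delta_def[of \<phi>] 1 3 4
    by (simp add: delta_def theta_def sum_subtractf sum_negf)
qed

lemma iota_delta: "alt \<phi> \<Longrightarrow> iota x (delta \<phi>) = theta x \<phi> - delta (iota x \<phi>)"
  by (simp add: fun_eq_iff delta_Cons iota_apply)

lemma iota_theta: "iota y (theta x \<phi>) = theta x (iota y \<phi>) - iota (bk x y) \<phi>"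
  by (simp add: fun_eq_iff theta_Cons iota_apply)

lemma theta_hd:
  assumes "alt \<phi>"
  shows theta_add_hd: "theta (a + b, l) \<phi> = theta (a, l) \<phi> + theta (b, l) \<phi>"
    and theta_scale_hd: "theta (scaleA c a, l) \<phi> = smul c (theta (a, l) \<phi>)"
    and theta_D_hd: "theta (DA a, l) \<phi> = smul (- l) (theta (a, l) \<phi>)"
proof -
  have "theta (a + b, l) \<phi> xs = (theta (a, l) \<phi> + theta (b, l) \<phi>) xs" for xs
    using assms
  proof (induction xs arbitrary: \<phi>)
    case (Cons y ys)
    show ?case
      by (simp add: Cons.IH[OF alt_iota[OF Cons.prems]] theta_Cons bk_def cf_add_left alt_iota alt_add_hd[OF Cons.prems])
  qed (simp add: theta_Nil opr_add_left)
  then show "theta (a + b, l) \<phi> = theta (a, l) \<phi> + theta (b, l) \<phi>" ..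
  have "theta (scaleA c a, l) \<phi> xs = smul c (theta (a, l) \<phi>) xs" for xs c
    using assms
  proof (induction xs arbitrary: \<phi>)
    case (Cons y ys)
    show ?case
      by (simp add: Cons.IH[OF alt_iota[OF Cons.prems]] theta_Cons bk_def cf_scale_left alt_iota alt_scale_hd[OF Cons.prems]
          M.scale_right_diff_distrib)
  qed (simp add: theta_Nil opr_scale_left)
  then show "theta (scaleA c a, l) \<phi> = smul c (theta (a, l) \<phi>)" for c ..
  have "theta (DA a, l) \<phi> xs = smul (- l) (theta (a, l) \<phi>) xs" for xs
    using assms
  proof (induction xs arbitrary: \<phi>)
    case (Cons y ys)
    show ?case
      by (simp only: Cons.IH[OF alt_iota[OF Cons.prems]] theta_Cons bk_def fst_conv snd_conv cf_D_left
          alt_scale_hd[OF Cons.prems] smul_apply M.scale_right_diff_distrib)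
  qed (simp add: theta_Nil opr_D_left)
  then show "theta (DA a, l) \<phi> = smul (- l) (theta (a, l) \<phi>)" ..
qed

text \<open>Under \<open>\<phi>\<close> the operator \<open>\<partial>\<close> on an argument with parameter \<open>l + m\<close> is multiplication by
  \<open>- (l + m)\<close>, so that the substitution of \<open>- l - \<partial>\<close> in the skew-symmetry of the \<open>\<lambda>\<close>-bracket
  evaluates at \<open>m\<close>.\<close>

lemma bk_flip:
  assumes "alt \<phi>"
  shows "\<phi> (bk x y # zs) = - \<phi> (bk y x # zs)"
proof -
  obtain a l b m where xy: "x = (a, l)" "y = (b, m)"
    by (cases x, cases y)
  define T where "T u = \<phi> ((u, l + m) # zs)" for u
  have T_add: "T (u + w) = T u + T w" and T_scale: "T (scaleA c u) = scaleM c (T u)"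
    and T_D: "T (DA u) = scaleM (- (l + m)) (T u)" for u w c
    by (simp_all only: T_def altD_hd[OF assms])
  have T_0: "T 0 = 0"
    using T_add[of 0 0] by simp
  have T_minus: "T (- u) = - T u" for u
    using T_add[of u "- u"] T_0 by (simp add: minus_unique)
  have T_diff: "T (u - w) = T u - T w" for u w
    using T_add[of u "- w"] by (simp add: T_minus)
  have "T (EA.pevs l (flip_lambda DA p)) = T (EA.pevs m p)" for p
  proof (induction p)
    case (pCons u p)
    have "T (EA.pevs l (dplus DA q)) = scaleM (- m) (T (EA.pevs l q))" for q
      by (simp only: peval_dplusA T_add T_D T_scale flip: M.scale_left_distrib) simp
    then show ?case
      using pCons by (simp add: A.flip_lambda_pCons[of DA, OF A.D_add A.D_scale] T_add T_diff T_scale)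
  qed (simp add: A.flip_lambda_zero[of DA, OF A.D_add A.D_scale])
  then have "T (EA.pevs l (br a b)) = - T (EA.pevs m (br b a))"
    by (subst A.br_skew) (simp add: T_minus)
  then show ?thesis
    by (simp add: xy bk_def cf_def T_def add.commute)
qed

lemma bk_D_right:
  assumes "alt \<phi>"
  shows "\<phi> (bk x (DA a, l) # zs) = scaleM (- l) (\<phi> (bk x (a, l) # zs))"
proof -
  have "\<phi> (bk x (DA a, l) # zs) = scaleM (- (snd x + l)) (\<phi> (bk x (a, l) # zs)) +
      scaleM (snd x) (\<phi> (bk x (a, l) # zs))"
    by (simp only: bk_def fst_conv snd_conv cf_D_right altD_hd[OF assms])
  then show ?thesis
    by (simp only: flip: M.scale_left_distrib) simp
qed

lemma alt_theta:
  assumes "alt \<phi>"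
  shows "alt (theta x \<phi>)"
proof -
  have 1: "theta x \<phi> (us @ (a + b, l) # vs) = theta x \<phi> (us @ (a, l) # vs) + theta x \<phi> (us @ (b, l) # vs)"
    for us vs a b l
    using assms
  proof (induction us arbitrary: \<phi>)
    case Nil
    then show ?case
      by (simp add: theta_Cons iota_hd theta_plus bk_def cf_add_right alt_add_hd[OF Nil])
  next
    case (Cons u us)
    show ?case
      using alt_add[OF Cons.prems, of "bk x u # us"]
      by (simp add: Cons.IH[OF alt_iota[OF Cons.prems]] theta_Cons alt_iota)
  qed
  have 2: "theta x \<phi> (us @ (scaleA c a, l) # vs) = scaleM c (theta x \<phi> (us @ (a, l) # vs))"
    for us vs a c l
    using assms
  proof (induction us arbitrary: \<phi>)
    case Nil
    then show ?case
      by (simp add: theta_Cons iota_hd theta_smul bk_def cf_scale_right alt_scale_hd[OF Nil] M.scale_right_diff_distrib)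
  next
    case (Cons u us)
    show ?case
      using alt_scale[OF Cons.prems, of "bk x u # us"]
      by (simp add: Cons.IH[OF alt_iota[OF Cons.prems]] theta_Cons alt_iota M.scale_right_diff_distrib)
  qed
  have 3: "theta x \<phi> (us @ (DA a, l) # vs) = scaleM (- l) (theta x \<phi> (us @ (a, l) # vs))"
    for us vs a l
    using assms
  proof (induction us arbitrary: \<phi>)
    case Nil
    then show ?case
      by (simp add: theta_Cons iota_hd theta_smul bk_D_right[OF Nil] M.scale_right_diff_distrib)
  next
    case (Cons u us)
    show ?case
      using alt_D[OF Cons.prems, of "bk x u # us"]
      by (simp add: Cons.IH[OF alt_iota[OF Cons.prems]] theta_Cons alt_iota M.scale_right_diff_distrib)
  qed
  have 4: "theta x \<phi> (us @ y # z # vs) = - theta x \<phi> (us @ z # y # vs)" for us vs y z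
    using assms
  proof (induction us arbitrary: \<phi>)
    case Nil
    have "theta x (iota z (iota y \<phi>)) vs = - theta x (iota y (iota z \<phi>)) vs"
      by (subst iota_hd(4)[OF Nil]) (simp add: theta_uminus)
    then show ?case
      using alt_swap_hd[OF Nil, of "bk x y" z vs] alt_swap_hd[OF Nil, of "bk x z" y vs]
      by (simp add: theta_Cons iota_apply)
  next
    case (Cons u us)
    show ?case
      using alt_swap[OF Cons.prems, of "bk x u # us" y z vs]
      by (simp add: Cons.IH[OF alt_iota[OF Cons.prems, of u]] theta_Cons alt_iota)
  qed
  show ?thesis
    unfolding alt_def using 1 2 3 4 by blast
qed

text \<open>Linearity and skew-symmetry at later positions follow from Cartan's formula by induction. At
  the first two, \<open>\<iota>\<^sub>z \<iota>\<^sub>y \<delta> = \<theta>\<^sub>y \<iota>\<^sub>z - \<theta>\<^sub>z \<iota>\<^sub>y - \<iota> + \<delta> \<iota>\<^sub>z \<iota>\<^sub>y\<close>, with the unmarked contraction at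
  the bracket of \<open>y\<close> and \<open>z\<close>, is visibly skew-symmetric in \<open>y\<close> and \<open>z\<close>.\<close>

lemma alt_delta:
  assumes "alt \<phi>"
  shows "alt (delta \<phi>)"
proof -
  have 1: "delta \<phi> (us @ (a + b, l) # vs) = delta \<phi> (us @ (a, l) # vs) + delta \<phi> (us @ (b, l) # vs)"
    for us vs a b l
    using assms
  proof (induction us arbitrary: \<phi>)
    case Nil
    then show ?case
      by (simp add: delta_Cons iota_hd theta_add_hd delta_plus)
  next
    case (Cons u us)
    show ?case
      using alt_add[OF alt_theta[OF Cons.prems, of u]]
      by (simp add: Cons.IH[OF alt_iota[OF Cons.prems]] delta_Cons[OF Cons.prems])
  qed
  have 2: "delta \<phi> (us @ (scaleA c a, l) # vs) = scaleM c (delta \<phi> (us @ (a, l) # vs))"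
    for us vs a c l
    using assms
  proof (induction us arbitrary: \<phi>)
    case Nil
    then show ?case
      by (simp add: delta_Cons iota_hd theta_scale_hd delta_smul M.scale_right_diff_distrib)
  next
    case (Cons u us)
    show ?case
      using alt_scale[OF alt_theta[OF Cons.prems, of u]]
      by (simp add: Cons.IH[OF alt_iota[OF Cons.prems]] delta_Cons[OF Cons.prems] M.scale_right_diff_distrib)
  qed
  have 3: "delta \<phi> (us @ (DA a, l) # vs) = scaleM (- l) (delta \<phi> (us @ (a, l) # vs))"
    for us vs a l
    using assms
  proof (induction us arbitrary: \<phi>)
    case Nil
    then show ?case
      by (simp add: delta_Cons iota_hd theta_D_hd delta_smul M.scale_right_diff_distrib)
  next
    case (Cons u us)
    show ?case
      using alt_D[OF alt_theta[OF Cons.prems, of u]]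
      by (simp add: Cons.IH[OF alt_iota[OF Cons.prems]] delta_Cons[OF Cons.prems] M.scale_right_diff_distrib)
  qed
  have 4: "delta \<phi> (us @ y # z # vs) = - delta \<phi> (us @ z # y # vs)" for us vs y z
    using assms
  proof (induction us arbitrary: \<phi>)
    case Nil
    have "delta (iota z (iota y \<phi>)) vs = - delta (iota y (iota z \<phi>)) vs"
      by (subst iota_hd(4)[OF Nil]) (simp add: delta_uminus)
    then show ?case
      using bk_flip[OF Nil, of y z vs] Nil
      by (simp add: delta_Cons theta_Cons alt_iota)
  next
    case (Cons u us)
    show ?case
      using alt_swap[OF alt_theta[OF Cons.prems, of u], of us y z vs]
      by (simp add: Cons.IH[OF alt_iota[OF Cons.prems, of u]] delta_Cons[OF Cons.prems])
  qed
  show ?thesis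
    unfolding alt_def using 1 2 3 4 by blast
qed

lemma bk_jacobi:
  assumes "alt \<phi>"
  shows "\<phi> (bk x (bk y z) # zs) = \<phi> (bk (bk x y) z # zs) + \<phi> (bk y (bk x z) # zs)"
  by (simp add: bk_def cf_jacobi[of "fst x"] alt_add_hd[OF assms] add_ac)

lemma theta_commutator:
  assumes "alt \<phi>"
  shows "theta x (theta y \<phi>) xs - theta y (theta x \<phi>) xs = theta (bk x y) \<phi> xs"
  using assms
proof (induction xs arbitrary: \<phi>)
  case Nil
  then show ?case by (simp add: theta_Nil opr_bk)
next
  case (Cons z zs)
  have "theta x (theta y (iota z \<phi>)) zs - theta y (theta x (iota z \<phi>)) zs = theta (bk x y) (iota z \<phi>) zs"
    by (rule Cons.IH[OF alt_iota[OF Cons.prems]])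
  then show ?case
    using bk_jacobi[OF Cons.prems, of x y z zs]
    by (simp add: theta_Cons iota_theta iota_apply theta_diff algebra_simps)
qed

lemma theta_delta:
  assumes "alt \<phi>"
  shows "theta x (delta \<phi>) xs = delta (theta x \<phi>) xs"
  using assms
proof (induction xs arbitrary: \<phi>)
  case Nil
  then show ?case by (simp add: theta_Nil)
next
  case (Cons y ys)
  have "theta x (delta (iota y \<phi>)) ys = delta (theta x (iota y \<phi>)) ys"
    by (rule Cons.IH[OF alt_iota[OF Cons.prems]])
  then show ?case
    using theta_commutator[OF Cons.prems, of x y ys] Cons.prems
    by (simp add: theta_Cons delta_Cons iota_delta iota_theta theta_diff delta_diff alt_theta algebra_simps)
qed

text \<open>By Cartan's formula \<open>\<iota>\<^sub>x \<delta>\<^sup>2 = \<theta>\<^sub>x \<delta> - \<delta> \<theta>\<^sub>x + \<delta>\<^sup>2 \<iota>\<^sub>x\<close>, and \<open>\<theta>\<^sub>x\<close> commutes with \<open>\<delta>\<close>.\<close>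

theorem delta_delta:
  assumes "alt \<phi>"
  shows "delta (delta \<phi>) xs = 0"
  using assms
proof (induction xs arbitrary: \<phi>)
  case (Cons x xs)
  have "delta (delta (iota x \<phi>)) xs = 0"
    by (rule Cons.IH[OF alt_iota[OF Cons.prems]])
  then show ?case
    using theta_delta[OF Cons.prems, of x xs]
    by (simp add: delta_Cons Cons.prems alt_delta iota_delta delta_diff)
qed simp

text \<open>Cochains are required to be skew-symmetric under all permutations of their arguments.\<close>

lemma alt_permute:
  assumes "alt \<phi>" "\<pi> permutes {..<length xs}"
  shows "\<phi> (permute_list \<pi> xs) = scaleM (of_int (sign \<pi>)) (\<phi> xs)"
proof -
  have move: "\<phi> (us @ x # vs @ ws) = scaleM ((- 1) ^ length vs) (\<phi> (us @ vs @ x # ws))" for us x vs ws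
  proof (induction vs arbitrary: us)
    case (Cons v vs)
    show ?case
      using alt_swap[OF assms(1), of us x v "vs @ ws"] Cons[of "us @ [v]"] by simp
  qed simp
  have swap: "\<phi> (us @ x # vs @ y # ws) = - \<phi> (us @ y # vs @ x # ws)" for us vs ws x y
  proof -
    have "\<phi> (us @ x # vs @ y # ws) = scaleM ((- 1) ^ length vs) (\<phi> (us @ vs @ x # y # ws))"
      by (rule move)
    also have "\<phi> (us @ vs @ x # y # ws) = - \<phi> (us @ vs @ y # x # ws)"
      using alt_swap[OF assms(1), of "us @ vs" x y ws] by simp
    also have "scaleM ((- 1) ^ length vs) (- \<phi> (us @ vs @ y # x # ws)) = - \<phi> (us @ y # vs @ x # ws)"
      by (simp add: move)
    finally show ?thesis .
  qed
  have upd: "\<phi> (ys[i := ys ! j, j := ys ! i]) = - \<phi> ys" if "i < j" "j < length ys" for ys i j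
  proof -
    define us vs ws where "us = take i ys" and "vs = drop (Suc i) (take j ys)" and "ws = drop (Suc j) ys"
    have 1: "ys = take j ys @ ys ! j # ws"
      unfolding ws_def by (rule id_take_nth_drop) fact
    have 2: "take j ys = us @ ys ! i # vs"
      using id_take_nth_drop[of i "take j ys"] that by (simp add: us_def vs_def min_def)
    have ys: "ys = us @ ys ! i # vs @ ys ! j # ws"
      using 1 unfolding 2 by simp
    have len: "length us = i" "length us + length vs + 1 = j"
      using that by (simp_all add: us_def vs_def)
    have "ys[i := ys ! j, j := ys ! i] = us @ ys ! j # vs @ ys ! i # ws"
    proof -
      define a b where "a = ys ! i" and "b = ys ! j"
      have "(us @ a # vs @ b # ws)[i := b, j := a] = us @ b # vs @ a # ws"
        using len by (simp add: list_update_append flip: len)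
      then show ?thesis
        using ys unfolding a_def b_def by metis
    qed
    then show ?thesis
      using swap[of us "ys ! i" vs "ys ! j" ws] ys by simp
  qed
  have transp: "\<phi> (permute_list (transpose i j) ys) = - \<phi> ys" if "i \<noteq> j" "i < length ys" "j < length ys" for ys i j
  proof -
    have *: "\<phi> (permute_list (transpose i j) ys) = - \<phi> ys" if "i < j" "j < length ys" for i j
    proof -
      have "permute_list (transpose i j) ys = ys[i := ys ! j, j := ys ! i]"
        using that by (intro nth_equalityI) (auto simp: permute_list_def nth_list_update transpose_def)
      with upd[OF that] show ?thesis by simp
    qed
    show ?thesis
      using that *[of i j] *[of j i] by (cases "i < j") (auto simp: transpose_commute)
  qed
  have "\<forall>xs. length xs = n \<longrightarrow> \<phi> (permute_list \<pi> xs) = scaleM (of_int (sign \<pi>)) (\<phi> xs)"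
    if "\<pi> permutes {..<n}" for n
    using finite_lessThan[of n] that
  proof (induction rule: permutes_rev_induct)
    case id
    then show ?case by simp
  next
    case (swap a b p)
    show ?case
    proof (intro allI impI)
      fix xs :: "('a \<times> 'f) list" assume len: "length xs = n"
      have *: "p permutes {..<length xs}" "transpose a b permutes {..<length xs}"
        using swap len by (auto intro: permutes_swap_id)
      have "sign (p \<circ> transpose a b) = sign p * sign (transpose a b)"
        using *(1) by (intro sign_compose permutation_swap_id) (auto simp: permutation_permutes)
      then show "\<phi> (permute_list (p \<circ> transpose a b) xs) = scaleM (of_int (sign (p \<circ> transpose a b))) (\<phi> xs)"
        using swap len *
        by (cases "a = b") (simp_all add: permute_list_compose transp sign_swap_id)
    qed
  qed
  with assms(2) show ?thesis by blast
qed

end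

section \<open>Cochains as alternating functions\<close>

context char0_lca_module
begin

text \<open>The parameter of the \<open>i\<close>-th argument is the value of \<open>\<lambda>\<^sub>i\<close>.\<close>

definition zipe :: "'a list \<Rightarrow> (nat \<Rightarrow> 'f) \<Rightarrow> ('a \<times> 'f) list"
  where "zipe as e = zip as (map e [0..<length as])"

lemma length_zipe [simp]: "length (zipe as e) = length as"
  by (simp add: zipe_def)

lemma nth_zipe [simp]: "i < length as \<Longrightarrow> zipe as e ! i = (as ! i, e i)"
  by (simp add: zipe_def)

lemma map_fst_zipe [simp]: "map fst (zipe as e) = as"
  by (simp add: zipe_def)

lemma zipe_Nil [simp]: "zipe [] e = []"
  by (simp add: zipe_def)

lemma zipe_Cons: "zipe (a # as) e = (a, e 0) # zipe as (\<lambda>i. e (Suc i))"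
  by (rule nth_equalityI) (auto simp: nth_Cons split: nat.split)

lemma zipe_eq: "xs = zipe (map fst xs) (\<lambda>i. snd (xs ! i))"
  by (rule nth_equalityI) auto

lemma zipe_cong: "(\<And>i. i < length as \<Longrightarrow> e i = e' i) \<Longrightarrow> zipe as e = zipe as e'"
  by (rule nth_equalityI) auto

lemma zipe_update:
  "i < length as \<Longrightarrow> zipe (as[i := a]) e = take i (zipe as e) @ (a, e i) # drop (Suc i) (zipe as e)"
  by (subst upd_conv_take_nth_drop[symmetric]) (auto intro!: nth_equalityI simp: nth_list_update)

definition repr :: "('a list \<Rightarrow> 'm mpoly) \<Rightarrow> (('a \<times> 'f) list \<Rightarrow> 'm) \<Rightarrow> bool"
  where "repr f \<phi> \<longleftrightarrow> (\<forall>as e. EM.evs e (f as) = \<phi> (zipe as e))"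

lemma repr_eq: "repr f \<phi> \<Longrightarrow> \<phi> xs = EM.evs (\<lambda>i. snd (xs ! i)) (f (map fst xs))"
  by (metis repr_def zipe_eq)

lemma repr_inject: "repr f \<phi> \<Longrightarrow> repr g \<phi> \<Longrightarrow> f = g"
  by (rule ext, rule EM.ev_inject) (simp add: repr_def)

text \<open>The condition on lengths is needed because alternating functions carry no degree, whereas a
  \<open>q\<close>-cochain vanishes off the lists of length \<open>q\<close>.\<close>

definition represents :: "nat \<Rightarrow> ('a list \<Rightarrow> 'm mpoly) \<Rightarrow> (('a \<times> 'f) list \<Rightarrow> 'm) \<Rightarrow> bool"
  where "represents q f \<phi> \<longleftrightarrow> repr f \<phi> \<and> alt \<phi> \<and> (\<forall>xs. length xs \<noteq> q \<longrightarrow> \<phi> xs = 0)"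

lemma representsD:
  assumes "represents q f \<phi>"
  shows "EM.evs e (f as) = \<phi> (zipe as e)" "alt \<phi>" "length xs \<noteq> q \<Longrightarrow> \<phi> xs = 0"
  using assms by (auto simp: represents_def repr_def)

lemma represents_inject: "represents q f \<phi> \<Longrightarrow> represents r g \<phi> \<Longrightarrow> f = g"
  using repr_inject by (auto simp: represents_def)

text \<open>Each defining condition of a cochain is an equation between polynomials, or a bound on the
  variables that occur, and may be checked on evaluations.\<close>

lemma represents_cochain:
  assumes "represents q f \<phi>"
  shows "f \<in> cochains q"
proof -
  note rep = representsD(1)[OF assms] and alt = representsD(2)[OF assms]
  have 1: "f as = 0" if "length as \<noteq> q" for as
    by (rule EM.ev_eq_0) (simp add: rep representsD(3)[OF assms] that)
  have 2: "\<forall>t\<in>Poly_Mapping.keys (f as). Poly_Mapping.keys t \<subseteq> {..<q}" for as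
  proof (cases "length as = q")
    case True
    show ?thesis
      unfolding EM.keys_subset_iff using True by (auto simp: rep intro!: arg_cong[where f = \<phi>] zipe_cong)
  qed (simp add: 1)
  have 3: "f (as[i := a + b]) = f (as[i := a]) + f (as[i := b])" if "length as = q" "i < q" for as i a b
    by (rule EM.ev_inject) (use that in \<open>simp add: rep zipe_update alt_add[OF alt]\<close>)
  have 4: "f (as[i := scaleA c a]) = mmult scaleM (mconst c) (f (as[i := a]))"
    if "length as = q" "i < q" for as i a c
    by (rule EM.ev_inject) (use that in \<open>simp add: rep zipe_update alt_scale[OF alt]\<close>)
  have 5: "f (as[i := DA (as ! i)]) = - mmult scaleM (mvar i) (f as)" if "length as = q" "i < q" for as i
  proof (rule EM.ev_inject)
    fix e
    have "EM.evs e (f (as[i := as ! i])) = \<phi> (take i (zipe as e) @ (as ! i, e i) # drop (Suc i) (zipe as e))"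
      using that by (simp only: rep zipe_update)
    then show "EM.evs e (f (as[i := DA (as ! i)])) = EM.evs e (- mmult scaleM (mvar i) (f as))"
      using that by (simp add: rep[of e "as[i := DA (as ! i)]"] zipe_update alt_D[OF alt])
  qed
  have 6: "msubst scaleM (map (\<lambda>i. mvar (\<pi> i)) [0..<q]) (f (map (\<lambda>i. as ! \<pi> i) [0..<q])) =
      mmult scaleM (of_int (sign \<pi>)) (f as)" if "length as = q" "\<pi> permutes {..<q}" for as \<pi>
  proof (rule EM.ev_inject)
    fix e
    have "\<pi> i < q" if "i < q" for i
      using permutes_in_image[OF \<open>\<pi> permutes {..<q}\<close>, of i] that by simp
    then have "zipe (map (\<lambda>i. as ! \<pi> i) [0..<q]) (\<lambda>i. evF e (map (\<lambda>i. mvar (\<pi> i)) [0..<q] ! i)) =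
        permute_list \<pi> (zipe as e)"
      using that(1) by (intro nth_equalityI) (simp_all add: permute_list_def)
    then show "EM.evs e (msubst scaleM (map (\<lambda>i. mvar (\<pi> i)) [0..<q]) (f (map (\<lambda>i. as ! \<pi> i) [0..<q]))) =
        EM.evs e (mmult scaleM (of_int (sign \<pi>)) (f as))"
      using that alt_permute[OF alt, of \<pi> "zipe as e"] by (simp add: rep)
  qed
  show ?thesis
    unfolding cochains_def using 1 2 3 4 5 6 by blast
qed

lemma cochain_represents:
  assumes "f \<in> cochains q"
  obtains \<phi> where "represents q f \<phi>"
proof -
  note C = assms[unfolded cochains_def mem_Collect_eq]
  have 1: "f as = 0" if "length as \<noteq> q" for as
    using C[THEN conjunct1] that by blast
  have 2: "Poly_Mapping.keys t \<subseteq> {..<q}" if "t \<in> Poly_Mapping.keys (f as)" for as t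
    using C[THEN conjunct2, THEN conjunct1] that by blast
  have 3: "f (as[i := a + b]) = f (as[i := a]) + f (as[i := b])" if "length as = q" "i < q" for as i a b
    using C[THEN conjunct2, THEN conjunct2, THEN conjunct1] that by blast
  have 4: "f (as[i := scaleA c a]) = mmult scaleM (mconst c) (f (as[i := a]))"
    if "length as = q" "i < q" for as i a c
    using C[THEN conjunct2, THEN conjunct2, THEN conjunct2, THEN conjunct1] that by blast
  have 5: "f (as[i := DA (as ! i)]) = - mmult scaleM (mvar i) (f as)" if "length as = q" "i < q" for as i
    using C[THEN conjunct2, THEN conjunct2, THEN conjunct2, THEN conjunct2, THEN conjunct1] that by blast
  have 6: "msubst scaleM (map (\<lambda>i. mvar (\<pi> i)) [0..<q]) (f (map (\<lambda>i. as ! \<pi> i) [0..<q])) =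
      mmult scaleM (of_int (sign \<pi>)) (f as)" if "length as = q" "\<pi> permutes {..<q}" for as \<pi>
    using C[THEN conjunct2, THEN conjunct2, THEN conjunct2, THEN conjunct2, THEN conjunct2] that by blast
  define \<phi> where "\<phi> xs = EM.evs (\<lambda>i. snd (xs ! i)) (f (map fst xs))" for xs
  have cong: "EM.evs e (f as) = EM.evs e' (f as)" if "\<And>i. i < length as \<Longrightarrow> e i = e' i" for e e' as
  proof (cases "length as = q")
    case True
    then show ?thesis
      using 2 that by (intro EM.ev_cong[of "f as" q]) auto
  qed (simp add: 1)
  have "repr f \<phi>"
    unfolding repr_def \<phi>_def by (auto intro!: cong)
  moreover have "\<phi> xs = 0" if "length xs \<noteq> q" for xs
    using that by (simp add: \<phi>_def 1)
  moreover have "alt \<phi>"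
  proof (rule altI)
    fix us vs :: "('a \<times> 'f) list" and a b :: 'a and c l :: 'f
    define as where "as = map fst us @ a # map fst vs"
    have upd: "as[length us := c] = map fst us @ c # map fst vs" for c
      by (simp add: as_def list_update_append)
    have upd': "as[length us := a] = as"
      by (simp add: as_def list_update_append)
    have nth: "as ! length us = a"
      by (simp add: as_def nth_append)
    define e where "e i = snd ((us @ (a, l) # vs) ! i)" for i
    have e: "snd ((us @ (c, l) # vs) ! i) = e i" for c i
      by (auto simp: e_def nth_append nth_Cons split: nat.split)
    have el: "e (length us) = l"
      by (simp add: e_def nth_append)
    have \<phi>: "\<phi> (us @ (c, l) # vs) = EM.evs e (f (as[length us := c]))" for c
      by (simp add: \<phi>_def e upd)
    have len: "length us < length as"
      by (simp add: as_def)
    show "\<phi> (us @ (a + b, l) # vs) = \<phi> (us @ (a, l) # vs) + \<phi> (us @ (b, l) # vs)"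
      using 3[of as "length us" a b] 1 len by (cases "length as = q") (simp_all add: \<phi>)
    show "\<phi> (us @ (scaleA c a, l) # vs) = scaleM c (\<phi> (us @ (a, l) # vs))"
      using 4[of as "length us" c a] 1 len by (cases "length as = q") (simp_all add: \<phi>)
    show "\<phi> (us @ (DA a, l) # vs) = scaleM (- l) (\<phi> (us @ (a, l) # vs))"
      using 5[of as "length us"] 1 len by (cases "length as = q") (simp_all add: \<phi> upd' nth el)
  next
    fix us vs :: "('a \<times> 'f) list" and x y :: "'a \<times> 'f"
    define xs where "xs = us @ x # y # vs"
    define ys where "ys = us @ y # x # vs"
    define \<pi> where "\<pi> = transpose (length us) (Suc (length us))"
    show "\<phi> (us @ x # y # vs) = - \<phi> (us @ y # x # vs)"
    proof (cases "length xs = q")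
      case False
      then show ?thesis by (simp add: \<phi>_def 1 xs_def)
    next
      case True
      have perm: "\<pi> permutes {..<q}"
        using True unfolding \<pi>_def by (intro permutes_swap_id) (auto simp: xs_def)
      have "ys ! i = xs ! \<pi> i" if "i < q" for i
        using that True unfolding xs_def ys_def \<pi>_def transpose_def
        by (auto simp: nth_append nth_Cons split: nat.split)
      note ys_nth = this
      have \<pi>_less: "\<pi> i < q" if "i < q" for i
        using permutes_in_image[OF perm, of i] that by simp
      have len: "length ys = q"
        using True by (simp add: xs_def ys_def)
      have args: "map (\<lambda>i. map fst xs ! \<pi> i) [0..<q] = map fst ys"
        using True len by (intro nth_equalityI) (auto simp: ys_nth \<pi>_less)
      have "EM.evs (\<lambda>i. snd (xs ! i)) (msubst scaleM (map (\<lambda>i. mvar (\<pi> i)) [0..<q])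
          (f (map (\<lambda>i. map fst xs ! \<pi> i) [0..<q]))) =
        EM.evs (\<lambda>i. snd (xs ! i)) (mmult scaleM (of_int (sign \<pi>)) (f (map fst xs)))"
        using 6[of "map fst xs" \<pi>] perm True by simp
      moreover have "EM.evs (\<lambda>i. evF (\<lambda>i. snd (xs ! i)) (map (\<lambda>i. mvar (\<pi> i)) [0..<q] ! i)) (f (map fst ys)) =
          EM.evs (\<lambda>i. snd (ys ! i)) (f (map fst ys))"
        by (rule cong) (simp add: len ys_nth)
      ultimately have "\<phi> ys = scaleM (of_int (sign \<pi>)) (\<phi> xs)"
        unfolding args by (simp add: \<phi>_def)
      then show ?thesis
        by (simp add: \<pi>_def sign_swap_id xs_def ys_def)
    qed
  qed
  ultimately show thesis
    using that by (auto simp: represents_def)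
qed

lemma represents_plus: "represents q f \<phi> \<Longrightarrow> represents q g \<psi> \<Longrightarrow> represents q (f + g) (\<phi> + \<psi>)"
  by (simp add: represents_def repr_def alt_plus)

definition smulc :: "'f \<Rightarrow> ('a list \<Rightarrow> 'm mpoly) \<Rightarrow> 'a list \<Rightarrow> 'm mpoly"
  where "smulc c f as = mmult scaleM (mconst c) (f as)"

lemma represents_smulc: "represents q f \<phi> \<Longrightarrow> represents q (smulc c f) (smul c \<phi>)"
  by (simp add: represents_def repr_def alt_smul smulc_def)

lemma represents_zero: "represents q 0 0"
  by (simp add: represents_def repr_def alt_def)

lemma delta_zero [simp]: "delta 0 = 0"
  using delta_plus[of 0 0] by simp

lemma theta_degree:
  "(\<And>xs. length xs \<noteq> q \<Longrightarrow> \<phi> xs = 0) \<Longrightarrow> length xs \<noteq> q \<Longrightarrow> theta x \<phi> xs = 0"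
  by (simp add: theta_def)

lemma delta_degree:
  assumes "alt \<phi>" "\<And>xs. length xs \<noteq> q \<Longrightarrow> \<phi> xs = 0" "length xs \<noteq> Suc q"
  shows "delta \<phi> xs = 0"
  using assms
proof (induction xs arbitrary: q \<phi>)
  case (Cons x xs)
  have th: "theta x \<phi> xs = 0"
    using Cons.prems(3) by (intro theta_degree[of q]) (simp_all add: Cons.prems(2))
  have "delta (iota x \<phi>) xs = 0"
  proof (cases q)
    case 0
    then have "iota x \<phi> = 0"
      by (simp add: fun_eq_iff iota_apply Cons.prems(2))
    then show ?thesis by simp
  next
    case (Suc r)
    show ?thesis
    proof (rule Cons.IH[where q = r])
      show "alt (iota x \<phi>)"
        by (rule alt_iota) fact
      show "length xs \<noteq> Suc r"
        using Cons.prems(3) Suc by simp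
      show "iota x \<phi> zs = 0" if "length zs \<noteq> r" for zs
        using that Cons.prems(2)[of "x # zs"] Suc by (simp add: iota_apply)
    qed
  qed
  with th show ?case
    by (simp add: delta_Cons Cons.prems(1))
qed simp

lemma sel_zipe: "zip (map ((!) as) (filter P [0..<length as])) (map e (filter P [0..<length as])) = sel P (zipe as e)"
proof -
  have "zip (map f I) (map g I) = map (\<lambda>i. (f i, g i)) I" for f :: "nat \<Rightarrow> 'a" and g :: "nat \<Rightarrow> 'f" and I
    by (induction I) simp_all
  then show ?thesis
    by (simp add: sel_def)
qed

lemma zipe_sel:
  assumes "I = filter P [0..<length as]" "\<And>i. i < length I \<Longrightarrow> e' i = e (I ! i)"
  shows "zipe (map ((!) as) I) e' = sel P (zipe as e)"
proof -
  have "map e' [0..<length I] = map e I"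
    using assms(2) by (intro nth_equalityI) auto
  then show ?thesis
    unfolding zipe_def[of "map _ _"] length_map using sel_zipe[of as P e] by (simp add: assms(1))
qed

text \<open>All operations that form the differential of a cochain commute with evaluation; the
  substitution of \<open>\<lambda>\<^sub>k + \<lambda>\<^sub>l\<close> becomes the parameter of the bracket.\<close>

lemma represents_differential:
  assumes "represents q f \<phi>"
  shows "represents (Suc q) (differential f) (delta \<phi>)"
proof -
  note rep = representsD(1)[OF assms] and alt = representsD(2)[OF assms]
  have "EM.evs e (differential f as) = delta \<phi> (zipe as e)" for as e
  proof -
    have 1: "EM.evs e (let I = filter (\<lambda>i. i \<noteq> k) [0..<length as] in
        mmult scaleM ((-1) ^ k)
         (mext scaleM (\<lambda>u. at_var scaleM (mvar k) (act (as ! k) u))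
           (msubst scaleM (map mvar I) (f (map ((!) as) I))))) =
      scaleM ((- 1) ^ k) (opr (zipe as e ! k) (\<phi> (sel (\<lambda>i. i \<noteq> k) (zipe as e))))" if "k < length as" for k
    proof -
      define I where "I = filter (\<lambda>i. i \<noteq> k) [0..<length as]"
      have "zipe (map ((!) as) I) (\<lambda>i. evF e (map mvar I ! i)) = sel (\<lambda>i. i \<noteq> k) (zipe as e)"
        by (rule zipe_sel[OF I_def]) simp
      then show ?thesis
        using that unfolding Let_def I_def[symmetric]
        by (simp add: ev_mext_act rep del: nth_map)
    qed
    have 2: "EM.evs e (let J = filter (\<lambda>i. i \<noteq> k \<and> i \<noteq> l) [0..<length as] in
       mmult scaleM ((-1) ^ (k + l))
         (mext scaleM
           (\<lambda>b. msubst scaleM ((mvar k + mvar l) # map mvar J) (f (b # map ((!) as) J)))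
           (at_var scaleA (mvar k) (br (as ! k) (as ! l))))) =
      scaleM ((- 1) ^ (k + l)) (\<phi> (bk (zipe as e ! k) (zipe as e ! l) #
        sel (\<lambda>i. i \<noteq> k \<and> i \<noteq> l) (zipe as e)))" if "l < length as" "k < l" for k l
    proof -
      define J where "J = filter (\<lambda>i. i \<noteq> k \<and> i \<noteq> l) [0..<length as]"
      define g where "g b = msubst scaleM ((mvar k + mvar l) # map mvar J) (f (b # map ((!) as) J))" for b
      have zJ: "zipe (map ((!) as) J) (\<lambda>i. evF e (map mvar J ! i)) = sel (\<lambda>i. i \<noteq> k \<and> i \<noteq> l) (zipe as e)" for e
        by (rule zipe_sel[OF J_def]) simp
      have g: "EM.evs e (g b) = \<phi> ((b, e k + e l) # sel (\<lambda>i. i \<noteq> k \<and> i \<noteq> l) (zipe as e))" for e b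
        using zJ[of e] by (simp add: g_def rep zipe_Cons del: nth_map)
      have "EM.evs e (mext scaleM g (at_var scaleA (mvar k) (br (as ! k) (as ! l)))) =
          EM.evs e (g (cf (as ! k) (e k) (as ! l)))"
      proof (subst EM.ev_mext[OF EA.char0_space_axioms])
        show "g (u + w) = g u + g w" for u w
          by (rule EM.ev_inject) (simp add: g alt_add_hd[OF alt])
        show "g (scaleA c u) = mmult scaleM (mconst c) (g u)" for c u
          by (rule EM.ev_inject) (simp add: g alt_scale_hd[OF alt])
      qed (simp add: cf_def)
      then show ?thesis
        using that unfolding Let_def J_def[symmetric] g_def[symmetric]
        by (simp add: g bk_def)
    qed
    show ?thesis
      unfolding differential_def delta_def EM.ev_add EM.ev_sum length_zipe
      by (intro arg_cong2[where f = "(+)"] sum.cong refl 1 2) auto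
  qed
  then show ?thesis
    using alt_delta[OF alt] delta_degree[OF alt representsD(3)[OF assms]]
    by (simp add: represents_def repr_def)
qed

text \<open>The function \<open>F\<close> is polynomial and \<open>c\<close> is its coefficient of degree \<open>n\<close>, which is well
  defined over an infinite field. The predicate passes identities that hold for all values of \<open>\<lambda>\<close>
  to coefficients.\<close>

definition has_coeff :: "nat \<Rightarrow> ('f \<Rightarrow> 'm) \<Rightarrow> 'm \<Rightarrow> bool"
  where "has_coeff n F c \<longleftrightarrow> (\<exists>P. (\<forall>x. F x = EM.pevs x P) \<and> coeff P n = c)"

lemma has_coeff_unique: "has_coeff n F c \<Longrightarrow> has_coeff n F c' \<Longrightarrow> c = c'"
  unfolding has_coeff_def by (metis EM.peval_inject)

lemma has_coeff_add: "has_coeff n F c \<Longrightarrow> has_coeff n G d \<Longrightarrow> has_coeff n (\<lambda>x. F x + G x) (c + d)"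
  unfolding has_coeff_def by (metis EM.peval_add coeff_add)

lemma has_coeff_0: "has_coeff n (\<lambda>x. 0) 0"
  unfolding has_coeff_def by (intro exI[of _ 0]) simp

lemma has_coeff_linear:
  assumes "has_coeff n F c" "\<And>u w. T (u + w) = T u + T w" "\<And>k u. T (scaleM k u) = scaleM k (T u)"
  shows "has_coeff n (\<lambda>x. T (F x)) (T c)"
proof -
  obtain P where P: "\<And>x. F x = EM.pevs x P" "coeff P n = c"
    using assms(1) by (auto simp: has_coeff_def)
  have "T 0 = 0"
    using assms(3)[of 0 0] by simp
  then show ?thesis
    unfolding has_coeff_def
    by (intro exI[of _ "map_poly T P"])
      (simp add: P(1) P(2)[symmetric] coeff_map_poly EM.peval_map_poly[OF M.vector_space_axioms, of T, OF assms(2,3)])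
qed

lemma has_coeff_scale: "has_coeff n F c \<Longrightarrow> has_coeff n (\<lambda>x. scaleM k (F x)) (scaleM k c)"
  by (rule has_coeff_linear) (simp_all add: M.scale_right_distrib M.scale_left_commute)

lemma has_coeff_minus: "has_coeff n F c \<Longrightarrow> has_coeff n (\<lambda>x. - F x) (- c)"
  using has_coeff_scale[of n F c "- 1"] by simp

lemma has_coeff_opr: "has_coeff n F c \<Longrightarrow> has_coeff n (\<lambda>x. opr y (F x)) (opr y c)"
  by (rule has_coeff_linear) (simp_all add: opr_add opr_scale)

lemma has_coeff_sum:
  "(\<And>i. i \<in> I \<Longrightarrow> has_coeff n (F i) (c i)) \<Longrightarrow> has_coeff n (\<lambda>x. \<Sum>i\<in>I. F i x) (\<Sum>i\<in>I. c i)"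
  by (induction I rule: infinite_finite_induct) (auto intro: has_coeff_0 has_coeff_add)

text \<open>The coefficient of \<open>\<lambda>\<^sub>0\<^sup>n\<close> in \<open>f\<^bsub>\<lambda>\<^sub>0,\<lambda>\<^sub>1,\<dots>\<^esub>(a, \<dots>)\<close>; up to the factor \<open>n!\<close> it is the
  contraction with the element \<open>a t\<^sup>n\<close> of the annihilation Lie algebra.\<close>

definition ctr :: "'a \<Rightarrow> nat \<Rightarrow> ('a list \<Rightarrow> 'm mpoly) \<Rightarrow> 'a list \<Rightarrow> 'm mpoly"
  where "ctr a n f as = coef0 n (f (a # as))"

lemma ctr_plus: "ctr a n (f + g) = ctr a n f + ctr a n g"
  by (simp add: fun_eq_iff ctr_def coef0_add)

lemma ctr_zero [simp]: "ctr a n 0 = 0"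
  by (simp add: fun_eq_iff ctr_def)

lemma ctr_represents:
  assumes "represents q f \<phi>"
  obtains \<psi> where "\<And>xs. has_coeff n (\<lambda>x. \<phi> ((a, x) # xs)) (\<psi> xs)" "q = 0 \<Longrightarrow> ctr a n f = 0 \<and> \<psi> = 0"
    "\<And>r. q = Suc r \<Longrightarrow> represents r (ctr a n f) \<psi>"
proof -
  note rep = representsD(1)[OF assms] and alt = representsD(2)[OF assms]
  define \<psi> where "\<psi> xs = EM.evs (\<lambda>i. snd (xs ! i)) (ctr a n f (map fst xs))" for xs
  have ev: "has_coeff n (\<lambda>x. \<phi> ((a, x) # zipe as e)) (EM.evs e (ctr a n f as))" for as e
  proof -
    obtain P where "\<And>x. EM.evs (case_nat x e) (f (a # as)) = EM.pevs x P"
      "\<And>n. coeff P n = EM.evs e (coef0 n (f (a # as)))"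
      using EM.ev_case_nat[of e "f (a # as)"] by blast
    then show ?thesis
      unfolding has_coeff_def by (intro exI[of _ P]) (simp add: ctr_def rep zipe_Cons)
  qed
  have c: "has_coeff n (\<lambda>x. \<phi> ((a, x) # xs)) (\<psi> xs)" for xs
    using ev[of "map fst xs" "\<lambda>i. snd (xs ! i)"] by (simp add: \<psi>_def flip: zipe_eq)
  have "repr (ctr a n f) \<psi>"
    unfolding repr_def using ev c has_coeff_unique by blast
  moreover have deg: "\<psi> xs = 0" if "Suc (length xs) \<noteq> q" for xs
    using c[of xs] has_coeff_0 that by (auto simp: representsD(3)[OF assms] intro: has_coeff_unique)
  moreover have "alt \<psi>"
  proof (rule altI)
    fix us vs a' b l
    have "has_coeff n (\<lambda>x. \<phi> ((a, x) # us @ (a' + b, l) # vs)) (\<psi> (us @ (a', l) # vs) + \<psi> (us @ (b, l) # vs))"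
      using has_coeff_add[OF c c, of "us @ (a', l) # vs" "us @ (b, l) # vs"]
        alt_add[OF alt, of "(a, _) # us" a' b l vs] by simp
    then show "\<psi> (us @ (a' + b, l) # vs) = \<psi> (us @ (a', l) # vs) + \<psi> (us @ (b, l) # vs)"
      using c has_coeff_unique by blast
  next
    fix us vs k a' l
    have "has_coeff n (\<lambda>x. \<phi> ((a, x) # us @ (scaleA k a', l) # vs)) (scaleM k (\<psi> (us @ (a', l) # vs)))"
      using has_coeff_scale[OF c, of k "us @ (a', l) # vs"]
        alt_scale[OF alt, of "(a, _) # us" k a' l vs] by simp
    then show "\<psi> (us @ (scaleA k a', l) # vs) = scaleM k (\<psi> (us @ (a', l) # vs))"
      using c has_coeff_unique by blast
  next
    fix us vs a' l
    have "has_coeff n (\<lambda>x. \<phi> ((a, x) # us @ (DA a', l) # vs)) (scaleM (- l) (\<psi> (us @ (a', l) # vs)))"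
      using has_coeff_scale[OF c, of "- l" "us @ (a', l) # vs"]
        alt_D[OF alt, of "(a, _) # us" a' l vs] by simp
    then show "\<psi> (us @ (DA a', l) # vs) = scaleM (- l) (\<psi> (us @ (a', l) # vs))"
      using c has_coeff_unique by blast
  next
    fix us vs y z
    have "\<phi> ((a, x) # us @ y # z # vs) = - \<phi> ((a, x) # us @ z # y # vs)" for x
      using alt_swap[OF alt, of "(a, x) # us" y z vs] by simp
    then have "has_coeff n (\<lambda>x. \<phi> ((a, x) # us @ y # z # vs)) (- \<psi> (us @ z # y # vs))"
      using has_coeff_minus[OF c, of "us @ z # y # vs"] by presburger
    then show "\<psi> (us @ y # z # vs) = - \<psi> (us @ z # y # vs)"
      using c has_coeff_unique by blast
  qed
  ultimately have r: "represents r (ctr a n f) \<psi>" if "q = Suc r" for r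
    using that by (simp add: represents_def)
  have z: "ctr a n f = 0 \<and> \<psi> = 0" if "q = 0"
  proof -
    have "\<psi> = 0"
      using deg that by (simp add: fun_eq_iff)
    moreover have "repr 0 0"
      using represents_zero by (simp add: represents_def)
    ultimately show ?thesis
      using \<open>repr (ctr a n f) \<psi>\<close> repr_inject by blast
  qed
  show thesis
    by (rule that[OF c z r])
qed

text \<open>Cartan's formula \<open>d \<iota> + \<iota> d = \<theta>\<close>, coefficient by coefficient.\<close>

lemma cartan_represents:
  assumes "represents q f \<phi>"
  obtains \<chi> where "represents q (differential (ctr a n f) + ctr a n (differential f)) \<chi>"
    "\<And>xs. has_coeff n (\<lambda>x. theta (a, x) \<phi> xs) (\<chi> xs)"
proof -
  note alt = representsD(2)[OF assms]
  obtain \<psi> where \<psi>: "\<And>xs. has_coeff n (\<lambda>x. \<phi> ((a, x) # xs)) (\<psi> xs)"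
    "q = 0 \<Longrightarrow> ctr a n f = 0 \<and> \<psi> = 0" "\<And>r. q = Suc r \<Longrightarrow> represents r (ctr a n f) \<psi>"
    using ctr_represents[OF assms, where a = a and n = n] by blast
  obtain \<psi>' where \<psi>': "\<And>xs. has_coeff n (\<lambda>x. delta \<phi> ((a, x) # xs)) (\<psi>' xs)"
    "represents q (ctr a n (differential f)) \<psi>'"
    using ctr_represents[OF represents_differential[OF assms], where a = a and n = n] by blast
  have "represents q (differential (ctr a n f)) (delta \<psi>)"
  proof (cases q)
    case 0
    have "differential 0 = 0"
      using represents_differential[OF represents_zero] represents_zero
      unfolding delta_zero by (rule represents_inject)
    then show ?thesis
      using \<psi>(2)[OF 0] 0 represents_zero by simp
  next
    case (Suc r)
    then show ?thesis
      using represents_differential[OF \<psi>(3)[OF Suc]] by simp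
  qed
  then have "represents q (differential (ctr a n f) + ctr a n (differential f)) (delta \<psi> + \<psi>')"
    using \<psi>'(2) by (rule represents_plus)
  moreover have "has_coeff n (\<lambda>x. theta (a, x) \<phi> xs) ((delta \<psi> + \<psi>') xs)" for xs
  proof -
    have "has_coeff n (\<lambda>x. delta (iota (a, x) \<phi>) xs) (delta \<psi> xs)"
      unfolding delta_def iota_apply
      by (intro has_coeff_add has_coeff_sum has_coeff_scale has_coeff_opr \<psi>(1))
    from has_coeff_add[OF this \<psi>'(1)[of xs]] show ?thesis
      by (simp add: delta_Cons[OF alt])
  qed
  ultimately show thesis
    by (rule that)
qed

sublocale Cochains: ambient_space smulc
  by unfold_locales
    (simp_all add: smulc_def fun_eq_iff M.mmult_add_right M.mmult_add_left mconst_def single_add mult_single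
      flip: M.mmult_assoc)

lemma differential_plus:
  "f \<in> cochains q \<Longrightarrow> g \<in> cochains q \<Longrightarrow> differential (f + g) = differential f + differential g"
proof -
  assume "f \<in> cochains q" "g \<in> cochains q"
  then obtain \<phi> \<psi> where *: "represents q f \<phi>" "represents q g \<psi>"
    using cochain_represents by metis
  show ?thesis
    using represents_inject[OF represents_differential[OF represents_plus[OF *]]
        represents_plus[OF represents_differential[OF *(1)] represents_differential[OF *(2)], folded delta_plus]] .
qed

lemma differential_smulc: "f \<in> cochains q \<Longrightarrow> differential (smulc c f) = smulc c (differential f)"
proof -
  assume "f \<in> cochains q"
  then obtain \<phi> where *: "represents q f \<phi>"
    using cochain_represents by metis
  show ?thesis
    using represents_inject[OF represents_differential[OF represents_smulc[OF *]]
        represents_smulc[OF represents_differential[OF *], folded delta_smul]] .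
qed

lemma lookup_mmult_mconst: "Poly_Mapping.lookup (mmult scaleM (mconst c) v) t = scaleM c (Poly_Mapping.lookup v t)"
  by (induction v rule: poly_mapping_add_induct)
    (simp_all add: mconst_def M.mmult_single M.mmult_add_right lookup_add lookup_single when_def
      M.scale_right_distrib)

lemma ctr_smulc: "f \<in> cochains q \<Longrightarrow> ctr a n (smulc c f) = smulc c (ctr a n f)"
  by (auto simp: fun_eq_iff ctr_def smulc_def lookup_coef0 lookup_mmult_mconst intro!: poly_mapping_eqI)

text \<open>Each element \<open>a\<close> and each exponent \<open>n\<close> give a homotopy; the cases \<open>a = L\<close> with \<open>n = 0\<close> and
  \<open>n = 1\<close> are the two that determine the cohomology.\<close>

theorem contracted_complex_cochains: "contracted_complex smulc cochains differential (ctr a n)"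
proof (unfold_locales, goal_cases)
  case (1 q)
  show ?case
  proof (rule Cochains.subspaceI)
    show "0 \<in> cochains q"
      using represents_cochain represents_zero by blast
    show "f + g \<in> cochains q" if "f \<in> cochains q" "g \<in> cochains q" for f g
      using that by (metis cochain_represents represents_cochain represents_plus)
    show "smulc c f \<in> cochains q" if "f \<in> cochains q" for c f
      using that by (metis cochain_represents represents_cochain represents_smulc)
  qed
next
  case (2 f q)
  then show ?case by (metis cochain_represents represents_cochain represents_differential)
next
  case (3 f q g)
  then show ?case by (rule differential_plus)
next
  case (4 f q c)
  then show ?case by (rule differential_smulc)
next
  case (5 f q)
  then obtain \<phi> where *: "represents q f \<phi>"
    using cochain_represents by metis
  have "delta (delta \<phi>) = 0"
    using delta_delta[OF representsD(2)[OF *]] by (simp add: fun_eq_iff)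
  then have "represents (Suc (Suc q)) (differential (differential f)) 0"
    using represents_differential[OF represents_differential[OF *]] by simp
  then show ?case
    using represents_zero by (rule represents_inject)
next
  case (6 f q)
  then obtain \<phi> where "represents (Suc q) f \<phi>"
    using cochain_represents by metis
  then show ?case
    using ctr_represents represents_cochain by metis
next
  case (7 f)
  then obtain \<phi> where "represents 0 f \<phi>"
    using cochain_represents by metis
  then show ?case
    using ctr_represents by metis
next
  case (8 f q g)
  show ?case by (rule ctr_plus)
next
  case (9 f q c)
  then show ?case by (rule ctr_smulc)
qed

text \<open>At \<open>\<lambda> = 0\<close> the bracket with \<open>a\<close> is \<open>\<partial>\<close>, and on the \<open>i\<close>-th argument \<open>\<partial>\<close> is multiplication by
  \<open>- \<lambda>\<^sub>i\<close>. So \<open>\<theta>\<close> is \<open>\<partial>\<close> on the module plus the sum of the \<open>\<lambda>\<^sub>i\<close>.\<close>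

lemma cochain_D_eq_cartan:
  assumes a: "\<And>b. coeff (br a b) 0 = DA b" "\<And>m. coeff (act a m) 0 = DM m"
    and f: "f \<in> cochains q"
  shows "cochain_D f = differential (ctr a 0 f) + ctr a 0 (differential f)"
proof -
  obtain \<phi> where rep: "represents q f \<phi>"
    using f cochain_represents by metis
  note alt = representsD(2)[OF rep]
  obtain \<chi> where \<chi>: "represents q (differential (ctr a 0 f) + ctr a 0 (differential f)) \<chi>"
    "\<And>xs. has_coeff 0 (\<lambda>x. theta (a, x) \<phi> xs) (\<chi> xs)"
    using cartan_represents[OF rep, of a 0] by blast
  have peval_0: "EM.pevs 0 P = coeff P 0" for P
    by (cases P) simp
  have peval_0': "EA.pevs 0 P = coeff P 0" for P
    by (cases P) simp
  have "\<chi> xs = theta (a, 0) \<phi> xs" for xs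
    using \<chi>(2)[of xs] by (auto simp: has_coeff_def peval_0)
  moreover have "theta (a, 0) \<phi> xs = DM (\<phi> xs) + scaleM (\<Sum>i<length xs. snd (xs ! i)) (\<phi> xs)" for xs
  proof -
    have "\<phi> (xs[i := bk (a, 0) (xs ! i)]) = scaleM (- snd (xs ! i)) (\<phi> xs)" if "i < length xs" for i
    proof -
      have "bk (a, 0) (xs ! i) = (DA (fst (xs ! i)), snd (xs ! i))"
        by (simp add: bk_def cf_def peval_0' a)
      then have "\<phi> (xs[i := bk (a, 0) (xs ! i)]) =
          scaleM (- snd (xs ! i)) (\<phi> (take i xs @ (fst (xs ! i), snd (xs ! i)) # drop (Suc i) xs))"
        by (simp only: upd_conv_take_nth_drop[OF that] alt_D[OF alt])
      then show ?thesis
        by (simp add: id_take_nth_drop[OF that, symmetric])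
    qed
    then have "(\<Sum>i<length xs. \<phi> (xs[i := bk (a, 0) (xs ! i)])) = (\<Sum>i<length xs. scaleM (- snd (xs ! i)) (\<phi> xs))"
      by (intro sum.cong) auto
    also have "\<dots> = - scaleM (\<Sum>i<length xs. snd (xs ! i)) (\<phi> xs)"
      by (simp add: sum_negf M.scale_sum_left)
    finally show ?thesis
      by (simp add: theta_def opr_def peval_0 a)
  qed
  ultimately have \<chi>_eq: "\<chi> xs = DM (\<phi> xs) + scaleM (\<Sum>i<length xs. snd (xs ! i)) (\<phi> xs)" for xs
    by simp
  show ?thesis
  proof (rule ext, rule EM.ev_inject)
    fix as e
    have "EM.evs e (cochain_D f as) = \<chi> (zipe as e)"
      using EM.ev_map[of DM, OF DM_add DM_scale]
      by (simp add: cochain_D_def \<chi>_eq representsD(1)[OF rep])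
    then show "EM.evs e (cochain_D f as) = EM.evs e ((differential (ctr a 0 f) + ctr a 0 (differential f)) as)"
      by (simp only: representsD(1)[OF \<chi>(1)])
  qed
qed

lemma basic_complex_eq:
  "basic_complex q = \<lparr>vcarrier = cochains q, vzero = 0, vadd = (+), vsmult = smulc\<rparr>"
  by (simp add: basic_complex_def zero_fun_def smulc_def[abs_def] fun_eq_iff)

end

section \<open>Weights\<close>

interpretation W: char0_lca_module w1_scale w1_D w1_br w1_scale w1_D w1_br
  by (rule char0_lca_module.intro) (rule W1.adjoint.lca_module_axioms)

type_synonym 'f form = "('f w1 \<times> 'f) list \<Rightarrow> 'f w1"

text \<open>Booleans name the two generators: \<open>True\<close> stands for \<open>L\<close>, \<open>False\<close> for \<open>H\<close>.\<close>

definition gen :: "bool \<Rightarrow> 'f::field_char_0 w1"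
  where "gen b = (if b then w1_L else w1_H)"

text \<open>Under an alternating function the bracket of \<open>(L, x)\<close> with a generator at \<open>y\<close> is this
  multiple of the same generator at \<open>x + y\<close>: \<open>\<partial>\<close> acts as \<open>- (x + y)\<close>, so \<open>\<partial> + 2 x\<close> becomes
  \<open>x - y\<close>.\<close>

definition lcoef :: "bool \<Rightarrow> 'f::field_char_0 \<Rightarrow> 'f \<Rightarrow> 'f"
  where "lcoef b x y = (if b then x - y else - (x + y))"

lemma alt_bk_L:
  assumes "W.alt \<phi>"
  shows "\<phi> (us @ W.bk (w1_L, x) (gen b, y) # vs) = w1_scale (lcoef b x y) (\<phi> (us @ (gen b, x + y) # vs))"
proof -
  have LL: "W.cf w1_L x w1_L = w1_D w1_L + w1_scale (2 * x) w1_L"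
    by (simp add: W.cf_def w1_br_L_L mult.commute)
  have LH: "W.cf w1_L x w1_H = w1_D w1_H"
    by (simp add: W.cf_def w1_br_L_H)
  have "- (x + y) + 2 * x = x - y"
    by simp
  then show ?thesis
    by (cases b)
      (simp_all only: gen_def lcoef_def W.bk_def fst_conv snd_conv LL LH if_True if_False
        W.altD(1-3)[OF assms] flip: w1.scale_left_distrib)
qed

lemma alt_bk_H:
  assumes "W.alt \<phi>"
  shows "\<phi> (us @ W.bk (w1_H, x) (w1_L, y) # vs) = w1_scale (x + y) (\<phi> (us @ (w1_H, x + y) # vs))"
    and "\<phi> (us @ W.bk (w1_H, x) (w1_H, y) # vs) = 0"
proof -
  have HL: "W.cf w1_H x w1_L = w1_scale (- 1) (w1_D w1_H)"
    by (simp add: W.cf_def w1_br_H_L)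
  have HH: "W.cf w1_H x w1_H = w1_scale 0 w1_H"
    by (simp add: W.cf_def w1_br_H_H)
  show "\<phi> (us @ W.bk (w1_H, x) (w1_L, y) # vs) = w1_scale (x + y) (\<phi> (us @ (w1_H, x + y) # vs))"
    unfolding W.bk_def fst_conv snd_conv HL W.altD(2,3)[OF assms] w1.scale_scale by simp
  show "\<phi> (us @ W.bk (w1_H, x) (w1_H, y) # vs) = 0"
    unfolding W.bk_def fst_conv snd_conv HH W.altD(2,3)[OF assms] by simp
qed

definition gens :: "(bool \<times> 'f::field_char_0) list \<Rightarrow> ('f w1 \<times> 'f) list"
  where "gens zs = map (\<lambda>(b, x). (gen b, x)) zs"

lemma gens_simps [simp]: "gens [] = []" "gens (z # zs) = (gen (fst z), snd z) # gens zs"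
  by (simp_all add: gens_def split_beta)

lemma gens_append [simp]: "gens (ys @ zs) = gens ys @ gens zs"
  by (simp add: gens_def)

lemma length_gens [simp]: "length (gens zs) = length zs"
  by (simp add: gens_def)

lemma alt_determined:
  assumes "W.alt \<phi>" "\<And>zs. length zs = length xs \<Longrightarrow> \<phi> (gens zs) = 0"
  shows "\<phi> xs = 0"
proof -
  have "\<phi> (gens zs @ ys) = 0" if "length zs + length ys = length xs" for zs ys
    using that
  proof (induction ys arbitrary: zs)
    case Nil
    then show ?case by (simp add: assms(2))
  next
    case (Cons y ys)
    have *: "\<phi> (gens zs @ (gen b, snd y) # ys) = 0" for b
      using Cons.IH[of "zs @ [(b, snd y)]"] Cons.prems by simp
    have "\<phi> (gens zs @ (a, snd y) # ys) = 0" for a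
    proof (induction a rule: w1_induct)
      case L
      show ?case using *[of True] by (simp add: gen_def)
    next
      case H
      show ?case using *[of False] by (simp add: gen_def)
    qed (simp_all only: W.altD(1-3)[OF assms(1)] w1.scale_zero_right add_0)
    from this[of "fst y"] show ?case by simp
  qed
  from this[of "[]" xs] show ?thesis by simp
qed

lemma coeff_subst_shift:
  "coeff (subst_poly p [:[:0, 1:], [:1:]:]) 0 = p"
  "coeff (subst_poly p [:[:0, 1:], [:1:]:]) (Suc 0) = pderiv p"
proof (induction p)
  case (pCons c p)
  { case 1 show ?case using pCons by (simp add: subst_poly_pCons) }
  { case 2 show ?case using pCons by (simp add: subst_poly_pCons pderiv_pCons) }
qed simp_all

text \<open>The operator \<open>s + \<partial> d/d\<partial>\<close> on both components, shifted by 2 on multiples of \<open>L\<close>. For \<open>s = 0\<close>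
  it is the linear coefficient of the bracket with \<open>L\<close>.\<close>

definition euler :: "'f::field_char_0 \<Rightarrow> 'f w1 \<Rightarrow> 'f w1"
  where "euler s m = (smult (s + 2) (fst m) + pCons 0 (pderiv (fst m)), smult s (snd m) + pCons 0 (pderiv (snd m)))"

lemma euler_add: "euler s (m + n) = euler s m + euler s n"
  by (simp add: euler_def pderiv_add smult_add_right)

lemma euler_0 [simp]: "euler s 0 = 0"
  using euler_add[of s 0 0] by simp

lemma coeff_euler:
  "coeff (fst (euler s m)) j = (s + of_nat j + 2) * coeff (fst m) j"
  "coeff (snd (euler s m)) j = (s + of_nat j) * coeff (snd m) j"
  by (simp_all add: euler_def coeff_pCons coeff_pderiv algebra_simps split: nat.split)

lemma euler_scale: "euler s (w1_scale c m) = w1_scale c (euler s m)"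
  by (rule w1_eqI; rule poly_eqI) (simp_all add: coeff_euler w1_scale_def)

lemma euler_split: "euler s m = euler 0 m + w1_scale s m"
  by (rule w1_eqI; rule poly_eqI) (simp_all add: coeff_euler w1_scale_def algebra_simps)

lemma w1_br_L_coeff_1: "coeff (w1_br w1_L m) (Suc 0) = euler 0 m"
  by (simp add: w1_br_def w1_L_def Let_def coeff_w1_pair euler_def coeff_mult coeff_subst_shift
      subst_poly_pCons one_pCons numeral_poly)

lemma w1_br_L_coeff_0: "coeff (w1_br w1_L m) 0 = w1_D m"
  by (simp add: w1_br_def w1_L_def Let_def coeff_w1_pair w1_D_def coeff_mult coeff_subst_shift
      subst_poly_pCons one_pCons numeral_poly)

lemma has_coeff_poly:
  fixes m :: "'f::field_char_0 w1"
  shows "W.has_coeff n (\<lambda>x. w1_scale (poly p x) m) (w1_scale (coeff p n) m)"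
proof -
  have 0: "w1_scale (0 :: 'f) m = 0"
    by simp
  have "w1_scale (poly p x) m = W.EA.pevs x (map_poly (\<lambda>c. w1_scale c m) p)" for x
  proof (induction p)
    case (pCons c p)
    show ?case
      by (simp add: map_poly_pCons w1.scale_left_distrib pCons.IH[symmetric])
  qed simp
  then show ?thesis
    unfolding W.has_coeff_def
    by (intro exI[of _ "map_poly (\<lambda>c. w1_scale c m) p"]) (simp add: coeff_map_poly)
qed

lemma coeff_linear_powers:
  fixes y :: "'f::field_char_0"
  shows "coeff ([:y, 1:] ^ n) 0 = y ^ n" "y * coeff ([:y, 1:] ^ n) (Suc 0) = of_nat n * y ^ n"
proof -
  show *: "coeff ([:y, 1:] ^ n) 0 = y ^ n" for n
    by (induction n) simp_all
  show "y * coeff ([:y, 1:] ^ n) (Suc 0) = of_nat n * y ^ n"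
  proof (induction n)
    case (Suc n)
    have "coeff ([:y, 1:] ^ Suc n) (Suc 0) = y * coeff ([:y, 1:] ^ n) (Suc 0) + y ^ n"
      by (simp add: *)
    also have "\<dots> = of_nat n * y ^ n + y ^ n"
      by (simp only: Suc)
    finally have "coeff ([:y, 1:] ^ Suc n) (Suc 0) = of_nat (Suc n) * y ^ n"
      by (simp add: distrib_right)
    then show ?case
      by (simp only: power_Suc mult.left_commute)
  qed simp
qed

text \<open>The weight of a generator, which is 1 minus its conformal weight: \<open>L\<close> has \<open>- 1\<close> and \<open>H\<close> has
  \<open>1\<close>.\<close>

definition sg :: "bool \<Rightarrow> int"
  where "sg b = (if b then - 1 else 1)"

lemma mono_val_update:
  "mono_val (e(i := z)) t = z ^ Poly_Mapping.lookup t i * (\<Prod>j\<in>Poly_Mapping.keys t - {i}. e j ^ Poly_Mapping.lookup t j)"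
proof -
  have "mono_val (e(i := z)) t = (\<Prod>j\<in>insert i (Poly_Mapping.keys t). (e(i := z)) j ^ Poly_Mapping.lookup t j)"
    by (rule mono_val_superset) auto
  also have "\<dots> = z ^ Poly_Mapping.lookup t i * (\<Prod>j\<in>Poly_Mapping.keys t - {i}. (e(i := z)) j ^ Poly_Mapping.lookup t j)"
    by (subst prod.insert_remove) auto
  also have "(\<Prod>j\<in>Poly_Mapping.keys t - {i}. (e(i := z)) j ^ Poly_Mapping.lookup t j) =
      (\<Prod>j\<in>Poly_Mapping.keys t - {i}. e j ^ Poly_Mapping.lookup t j)"
    by (rule prod.cong) auto
  finally show ?thesis .
qed

text \<open>In \<open>x\<close>, the linear coefficient of \<open>(x - y) (x + y)\<^sup>n\<close> is \<open>- (n - 1) y\<^sup>n\<close> and that of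
  \<open>- (x + y) (x + y)\<^sup>n\<close> is \<open>- (n + 1) y\<^sup>n\<close>. So bracketing one argument with \<open>L\<close> multiplies a
  monomial by an integer.\<close>

lemma has_coeff_shift:
  fixes v :: "'f::field_char_0 w1 mpoly"
  shows "W.has_coeff (Suc 0) (\<lambda>x. w1_scale (lcoef b x (e i)) (W.EA.evs (e(i := x + e i)) (Poly_Mapping.single t m)))
    (w1_scale (- of_int (int (Poly_Mapping.lookup t i) + sg b)) (W.EA.evs e (Poly_Mapping.single t m)))"
proof -
  define R where "R = (\<Prod>j\<in>Poly_Mapping.keys t - {i}. e j ^ Poly_Mapping.lookup t j)"
  define y where "y = e i"
  define n where "n = Poly_Mapping.lookup t i"
  define p where "p = (if b then [:- y, 1:] else - [:y, 1:]) * [:y, 1:] ^ n"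
  have "mono_val (e(i := e i)) t = y ^ n * R"
    unfolding mono_val_update R_def y_def n_def ..
  then have me: "mono_val e t = y ^ n * R"
    by simp
  have c: "coeff p (Suc 0) = - of_int (int n + sg b) * y ^ n"
    using coeff_linear_powers[of y n]
    by (cases b) (simp_all add: p_def sg_def algebra_simps)
  have "w1_scale (lcoef b x y) (W.EA.evs (e(i := x + y)) (Poly_Mapping.single t m)) =
      w1_scale (poly p x) (w1_scale R m)" for x
  proof -
    have px: "poly p x = lcoef b x y * (x + y) ^ n"
      by (cases b) (simp_all add: p_def lcoef_def algebra_simps)
    have "W.EA.evs (e(i := x + y)) (Poly_Mapping.single t m) = w1_scale ((x + y) ^ n * R) m"
      unfolding W.EA.ev_single mono_val_update R_def n_def ..
    then show ?thesis
      unfolding px by (simp only: w1.scale_scale mult.assoc)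
  qed
  moreover have "w1_scale (- of_int (int n + sg b)) (W.EA.evs e (Poly_Mapping.single t m)) =
      w1_scale (coeff p (Suc 0)) (w1_scale R m)"
    unfolding c W.EA.ev_single me by (simp only: w1.scale_scale mult.assoc)
  ultimately show ?thesis
    using has_coeff_poly[of "Suc 0" p "w1_scale R m"] unfolding y_def[symmetric] n_def[symmetric] by (simp only:)
qed

definition lweight :: "bool list \<Rightarrow> (nat \<Rightarrow>\<^sub>0 nat) \<Rightarrow> int"
  where "lweight bs t = (\<Sum>i<length bs. int (Poly_Mapping.lookup t i) + sg (bs ! i))"

definition weight_op :: "bool list \<Rightarrow> 'f::field_char_0 w1 mpoly \<Rightarrow> 'f w1 mpoly"
  where "weight_op bs v = Poly_Mapping.mapp (\<lambda>t. euler (of_int (lweight bs t))) v"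

lemma lookup_weight_op:
  "Poly_Mapping.lookup (weight_op bs v) t = euler (of_int (lweight bs t)) (Poly_Mapping.lookup v t)"
  by (simp add: weight_op_def lookup_mapp when_def in_keys_iff)

lemma weight_op_add: "weight_op bs (v + w) = weight_op bs v + weight_op bs w"
  by (rule poly_mapping_eqI) (simp add: lookup_weight_op lookup_add euler_add)

lemma weight_op_single:
  "weight_op bs (Poly_Mapping.single t m) = Poly_Mapping.single t (euler (of_int (lweight bs t)) m)"
  by (rule poly_mapping_eqI) (simp add: lookup_weight_op lookup_single when_def)

lemma has_coeff_weight:
  fixes v :: "'f::field_char_0 w1 mpoly"
  shows "W.has_coeff (Suc 0) (\<lambda>x. W.opr (w1_L, x) (W.EA.evs e v) -
      (\<Sum>i<length bs. w1_scale (lcoef (bs ! i) x (e i)) (W.EA.evs (e(i := x + e i)) v)))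
    (W.EA.evs e (weight_op bs v))"
proof (induction v rule: poly_mapping_add_induct)
  case zero
  have "weight_op bs (0 :: 'f w1 mpoly) = 0"
    by (rule poly_mapping_eqI) (simp add: lookup_weight_op)
  then show ?case
    using W.has_coeff_0 by simp
next
  case (single t m)
  let ?v = "Poly_Mapping.single t m"
  have 1: "W.has_coeff (Suc 0) (\<lambda>x. W.opr (w1_L, x) u) (euler 0 u)" for u
    unfolding W.has_coeff_def W.opr_def by (intro exI[of _ "w1_br w1_L u"]) (simp add: w1_br_L_coeff_1)
  have "W.has_coeff (Suc 0) (\<lambda>x. W.opr (w1_L, x) (W.EA.evs e ?v) +
      - (\<Sum>i<length bs. w1_scale (lcoef (bs ! i) x (e i)) (W.EA.evs (e(i := x + e i)) ?v)))
    (euler 0 (W.EA.evs e ?v) +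
      - (\<Sum>i<length bs. w1_scale (- of_int (int (Poly_Mapping.lookup t i) + sg (bs ! i))) (W.EA.evs e ?v)))"
    by (intro W.has_coeff_add W.has_coeff_minus W.has_coeff_sum has_coeff_shift 1)
  moreover have "euler 0 (W.EA.evs e ?v) +
      - (\<Sum>i<length bs. w1_scale (- of_int (int (Poly_Mapping.lookup t i) + sg (bs ! i))) (W.EA.evs e ?v)) =
      W.EA.evs e (weight_op bs ?v)"
  proof -
    have "- (\<Sum>i<length bs. w1_scale (- of_int (int (Poly_Mapping.lookup t i) + sg (bs ! i))) (W.EA.evs e ?v)) =
        w1_scale (of_int (lweight bs t)) (W.EA.evs e ?v)"
      by (simp only: lweight_def of_int_sum w1.scale_sum_left w1.scale_minus_left sum_negf minus_minus)
    moreover have "W.EA.evs e (weight_op bs ?v) = euler (of_int (lweight bs t)) (W.EA.evs e ?v)"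
      by (simp add: weight_op_single euler_scale)
    ultimately show ?thesis
      using euler_split[of "of_int (lweight bs t)" "W.EA.evs e ?v"] by simp
  qed
  ultimately show ?case
    by (simp only: diff_conv_add_uminus)
next
  case (add v w)
  from W.has_coeff_add[OF add] show ?case
    by (simp add: weight_op_add W.opr_add w1.scale_right_distrib sum.distrib algebra_simps)
qed

text \<open>The scalar coordinates of a cochain: generators \<open>bs\<close> as arguments, exponents \<open>t\<close> of the
  \<open>\<lambda>\<^sub>i\<close>, and the coefficient of \<open>\<partial>\<^sup>j L\<close> or \<open>\<partial>\<^sup>j H\<close> in the value.\<close>

definition wcoef :: "('f::field_char_0 w1 list \<Rightarrow> 'f w1 mpoly) \<Rightarrow> bool list \<Rightarrow> (nat \<Rightarrow>\<^sub>0 nat) \<Rightarrow> bool \<Rightarrow> nat \<Rightarrow> 'f"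
  where "wcoef f bs t b j = coeff ((if b then fst else snd) (Poly_Mapping.lookup (f (map gen bs)) t)) j"

definition wt :: "bool list \<Rightarrow> (nat \<Rightarrow>\<^sub>0 nat) \<Rightarrow> bool \<Rightarrow> nat \<Rightarrow> int"
  where "wt bs t b j = lweight bs t + int j + (if b then 2 else 0)"

lemma wcoef_diff: "wcoef (f - g) bs t b j = wcoef f bs t b j - wcoef g bs t b j"
  by (simp add: wcoef_def lookup_minus)

lemma wcoef_smulc: "wcoef (W.smulc c f) bs t b j = c * wcoef f bs t b j"
  by (simp add: wcoef_def W.smulc_def W.lookup_mmult_mconst w1_scale_def)

abbreviation Cochains :: "nat \<Rightarrow> ('f::field_char_0 w1 list \<Rightarrow> 'f w1 mpoly) set"
  where "Cochains \<equiv> W1.adjoint.cochains"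

abbreviation diff :: "('f::field_char_0 w1 list \<Rightarrow> 'f w1 mpoly) \<Rightarrow> 'f w1 list \<Rightarrow> 'f w1 mpoly"
  where "diff \<equiv> W1.adjoint.differential"

text \<open>Contraction with \<open>L\<close>, by the constant coefficient in \<open>H0\<close> and by the linear one in \<open>H1\<close>.\<close>

interpretation H0: contracted_complex W.smulc Cochains diff "W.ctr w1_L 0"
  by (rule W.contracted_complex_cochains)

interpretation H1: contracted_complex W.smulc Cochains diff "W.ctr w1_L (Suc 0)"
  by (rule W.contracted_complex_cochains)

lemma cochain_eq_0:
  assumes "f \<in> Cochains q" "\<And>bs. length bs = q \<Longrightarrow> f (map gen bs) = 0"
  shows "f = 0"
proof -
  obtain \<phi> where rep: "W.represents q f \<phi>"
    using assms(1) W.cochain_represents by metis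
  have "\<phi> xs = 0" for xs
  proof (cases "length xs = q")
    case True
    show ?thesis
    proof (rule alt_determined[OF W.representsD(2)[OF rep]])
      fix zs :: "(bool \<times> 'a) list" assume "length zs = length xs"
      moreover have "\<phi> (gens zs) = W.EA.evs (\<lambda>i. snd (gens zs ! i)) (f (map gen (map fst zs)))"
        using rep by (subst W.repr_eq[of f]) (auto simp: W.represents_def gens_def split_beta comp_def)
      ultimately show "\<phi> (gens zs) = 0"
        using True assms(2)[of "map fst zs"] by simp
    qed
  qed (simp add: W.representsD(3)[OF rep])
  then have "\<phi> = 0"
    by (simp add: fun_eq_iff)
  then show ?thesis
    using W.represents_inject[OF rep] W.represents_zero by metis
qed

lemma cochain_eq_0_wcoef:
  assumes "f \<in> Cochains q" "\<And>bs t b j. length bs = q \<Longrightarrow> wcoef f bs t b j = 0"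
  shows "f = 0"
proof (rule cochain_eq_0[OF assms(1)])
  fix bs :: "bool list" assume "length bs = q"
  then have "Poly_Mapping.lookup (f (map gen bs)) t = 0" for t
    using assms(2)[of bs t True] assms(2)[of bs t False]
    by (simp add: wcoef_def prod_eq_iff poly_eq_iff)
  then show "f (map gen bs) = 0"
    by (intro poly_mapping_eqI) simp
qed

text \<open>By Cartan's formula \<open>lie f\<close> is the linear coefficient of \<open>\<theta>\<close> for \<open>(L, \<lambda>)\<close>. On generators the
  argument brackets contribute the weights of the arguments and the action on the value contributes
  the Euler operator.\<close>

lemma wcoef_lie:
  assumes "f \<in> Cochains q"
  shows "wcoef (H1.lie f) bs t b j = of_int (wt bs t b j) * wcoef f bs t b j"
proof -
  obtain \<phi> where rep: "W.represents q f \<phi>"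
    using assms W.cochain_represents by metis
  note alt = W.representsD(2)[OF rep]
  obtain \<chi> where \<chi>: "W.represents q (H1.lie f) \<chi>"
    "\<And>xs. W.has_coeff (Suc 0) (\<lambda>x. W.theta (w1_L, x) \<phi> xs) (\<chi> xs)"
    using W.cartan_represents[OF rep, of w1_L "Suc 0"] unfolding H1.lie_def by blast
  let ?as = "map gen bs :: 'a w1 list"
  have "H1.lie f ?as = weight_op bs (f ?as)"
  proof (rule W.EA.ev_inject)
    fix e
    have "W.theta (w1_L, x) \<phi> (W.zipe ?as e) = W.opr (w1_L, x) (W.EA.evs e (f ?as)) -
      (\<Sum>i<length bs. w1_scale (lcoef (bs ! i) x (e i)) (W.EA.evs (e(i := x + e i)) (f ?as)))" for x
    proof -
      have "\<phi> ((W.zipe ?as e)[i := W.bk (w1_L, x) (W.zipe ?as e ! i)]) =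
          w1_scale (lcoef (bs ! i) x (e i)) (W.EA.evs (e(i := x + e i)) (f ?as))" if i: "i < length bs" for i
      proof -
        have "(W.zipe ?as e)[i := W.bk (w1_L, x) (W.zipe ?as e ! i)] =
            take i (W.zipe ?as e) @ W.bk (w1_L, x) (gen (bs ! i), e i) # drop (Suc i) (W.zipe ?as e)"
          using i by (simp add: upd_conv_take_nth_drop)
        moreover have "take i (W.zipe ?as e) @ (gen (bs ! i), x + e i) # drop (Suc i) (W.zipe ?as e) =
            W.zipe ?as (e(i := x + e i))"
          using i by (subst upd_conv_take_nth_drop[symmetric]) (auto intro!: nth_equalityI simp: nth_list_update)
        ultimately show ?thesis
          by (simp add: alt_bk_L[OF alt] W.representsD(1)[OF rep])
      qed
      then show ?thesis
        by (simp add: W.theta_def W.representsD(1)[OF rep])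
    qed
    then have "W.has_coeff (Suc 0) (\<lambda>x. W.theta (w1_L, x) \<phi> (W.zipe ?as e)) (W.EA.evs e (weight_op bs (f ?as)))"
      using has_coeff_weight[of e "f ?as" bs] by simp
    with \<chi>(2) have "\<chi> (W.zipe ?as e) = W.EA.evs e (weight_op bs (f ?as))"
      by (rule W.has_coeff_unique)
    then show "W.EA.evs e (H1.lie f ?as) = W.EA.evs e (weight_op bs (f ?as))"
      by (simp add: W.representsD(1)[OF \<chi>(1)])
  qed
  then show ?thesis
    by (simp add: wcoef_def lookup_weight_op coeff_euler wt_def algebra_simps)
qed

definition weight_zero :: "nat \<Rightarrow> ('f::field_char_0 w1 list \<Rightarrow> 'f w1 mpoly) set"
  where "weight_zero q = {f \<in> Cochains q. H1.lie f = 0}"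

lemma weight_zero_iff:
  assumes "f \<in> Cochains q"
  shows "f \<in> weight_zero q \<longleftrightarrow> (\<forall>bs t b j. length bs = q \<longrightarrow> wcoef f bs t b j \<noteq> 0 \<longrightarrow> wt bs t b j = 0)"
proof
  assume "f \<in> weight_zero q"
  then have "wcoef (H1.lie f) bs t b j = 0" for bs t b j
    by (simp add: weight_zero_def wcoef_def)
  then show "\<forall>bs t b j. length bs = q \<longrightarrow> wcoef f bs t b j \<noteq> 0 \<longrightarrow> wt bs t b j = 0"
    using assms by (auto simp: wcoef_lie)
next
  assume "\<forall>bs t b j. length bs = q \<longrightarrow> wcoef f bs t b j \<noteq> 0 \<longrightarrow> wt bs t b j = 0"
  then have "H1.lie f = 0"
    using assms by (intro cochain_eq_0_wcoef[OF H1.lie_in[OF assms]]) (auto simp: wcoef_lie)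
  with assms show "f \<in> weight_zero q"
    by (simp add: weight_zero_def)
qed

text \<open>There are finitely many argument lists of generators, and each value is a polynomial.\<close>

lemma finite_weights:
  "finite {wt bs t b j | bs t b j. length bs = q \<and> wcoef f bs t b j \<noteq> 0}"
proof -
  let ?B = "{bs :: bool list. set bs \<subseteq> UNIV \<and> length bs = q}"
  define T where "T = (\<Union>bs\<in>?B. Poly_Mapping.keys (f (map gen bs)))"
  define N where "N bs t = degree (fst (Poly_Mapping.lookup (f (map gen bs)) t)) +
    degree (snd (Poly_Mapping.lookup (f (map gen bs)) t))" for bs t
  have B: "finite ?B"
    by (rule finite_lists_length_eq) simp
  then have T: "finite T"
    by (simp add: T_def)
  have "{wt bs t b j | bs t b j. length bs = q \<and> wcoef f bs t b j \<noteq> 0} \<subseteq>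
      (\<Union>bs\<in>?B. \<Union>t\<in>T. \<Union>b\<in>UNIV. \<Union>j\<in>{..N bs t}. {wt bs t b j})"
  proof
    fix z assume "z \<in> {wt bs t b j | bs t b j. length bs = q \<and> wcoef f bs t b j \<noteq> 0}"
    then obtain bs t b j where *: "wcoef f bs t b j \<noteq> 0" "length bs = q" "z = wt bs t b j"
      by blast
    then have "Poly_Mapping.lookup (f (map gen bs)) t \<noteq> 0"
      by (auto simp: wcoef_def split: if_splits)
    then have "t \<in> T"
      using * by (auto simp: T_def in_keys_iff)
    moreover have "j \<le> N bs t"
      using * le_degree by (fastforce simp: wcoef_def N_def split: if_splits)
    ultimately show "z \<in> (\<Union>bs\<in>?B. \<Union>t\<in>T. \<Union>b\<in>UNIV. \<Union>j\<in>{..N bs t}. {wt bs t b j})"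
      using * by blast
  qed
  then show ?thesis
    by (rule finite_subset) (use B T in simp)
qed

text \<open>For \<open>w \<noteq> 0\<close> the operator \<open>1 - lie / w\<close> kills the component of weight \<open>w\<close>, fixes the one of
  weight 0, commutes with the differential and is homotopic to the identity. Finitely many of
  these operators project a cochain to weight 0.\<close>

lemma weight_zero_projection:
  assumes "f \<in> Cochains q"
  obtains f0 where "f0 \<in> weight_zero q" "diff f \<in> weight_zero (Suc q) \<Longrightarrow> diff f0 = diff f"
    "diff f = 0 \<Longrightarrow> f - f0 \<in> H1.coboundaries q"
proof -
  define ws where "ws f = {wt bs t b j | bs t b j. length bs = q \<and> wcoef f bs t b j \<noteq> 0}"
    for f :: "'a w1 list \<Rightarrow> 'a w1 mpoly"
  have step: "\<exists>f0. f0 \<in> weight_zero q \<and> (diff f \<in> weight_zero (Suc q) \<longrightarrow> diff f0 = diff f) \<and>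
    (diff f = 0 \<longrightarrow> f - f0 \<in> H1.coboundaries q)"
    if "finite A" "0 \<notin> A" "f \<in> Cochains q" "ws f \<subseteq> insert 0 A" for A f
    using that
  proof (induction A arbitrary: f rule: finite_induct)
    case empty
    then have "f \<in> weight_zero q"
      unfolding weight_zero_iff[OF empty.prems(2)] ws_def by blast
    moreover have "f - f \<in> H1.coboundaries q"
      unfolding diff_self by (rule W.Cochains.subspace_0[OF H1.coboundaries_subspace])
    ultimately show ?case
      by blast
  next
    case (insert w A)
    note f = insert.prems(2)
    have w: "w \<noteq> 0"
      using insert.prems(1) by auto
    \<comment> \<open>The coordinates of weight \<open>v\<close> are multiplied by \<open>1 - v / w\<close>.\<close>
    define g where "g = f - W.smulc (inverse (of_int w)) (H1.lie f)"
    have g: "g \<in> Cochains q"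
      unfolding g_def by (intro H1.C_diff H1.C_scale H1.lie_in f)
    have "wcoef g bs t b j = (1 - of_int (wt bs t b j) / of_int w) * wcoef f bs t b j" for bs t b j
      by (simp add: g_def wcoef_diff wcoef_smulc wcoef_lie[OF f] field_simps)
    then have wcg: "wcoef g bs t b j \<noteq> 0 \<Longrightarrow> wcoef f bs t b j \<noteq> 0 \<and> wt bs t b j \<noteq> w" for bs t b j
      using w by auto
    have ws_g: "ws g \<subseteq> insert 0 A"
    proof
      fix z assume "z \<in> ws g"
      then obtain bs t b j where z: "z = wt bs t b j" "length bs = q" "wcoef g bs t b j \<noteq> 0"
        by (auto simp: ws_def)
      then have "wcoef f bs t b j \<noteq> 0" "z \<noteq> w"
        using wcg by blast+
      then have "z \<in> ws f" "z \<noteq> w"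
        using z by (auto simp: ws_def)
      then show "z \<in> insert 0 A"
        using insert.prems(3) by auto
    qed
    have "0 \<notin> A"
      using insert.prems(1) by simp
    from insert.IH[OF this g ws_g] obtain f0 where f0: "f0 \<in> weight_zero q"
      "diff g \<in> weight_zero (Suc q) \<Longrightarrow> diff f0 = diff g" "diff g = 0 \<Longrightarrow> g - f0 \<in> H1.coboundaries q"
      by blast
    have dg: "diff g = diff f" if "H1.lie (diff f) = 0"
      unfolding g_def H1.d_diff[OF f H1.C_scale[OF H1.lie_in[OF f]]] H1.d_scale[OF H1.lie_in[OF f]]
        H1.d_lie[OF f] that by simp
    have "f - f0 \<in> H1.coboundaries q" if "diff f = 0"
    proof -
      have "H1.lie f = diff (W.ctr w1_L (Suc 0) f)"
        unfolding H1.lie_def that H1.h_zero by (rule add_0_right)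
      then have "f - g \<in> H1.coboundaries q"
        using H1.dh_coboundary[OF f] W.Cochains.subspace_scale[OF H1.coboundaries_subspace]
        by (simp add: g_def)
      moreover have "g - f0 \<in> H1.coboundaries q"
        by (rule f0(3)) (simp only: dg that H1.lie_0)
      ultimately show ?thesis
        using W.Cochains.subspace_add[OF H1.coboundaries_subspace, of "f - g" q "g - f0"]
        by (simp only: diff_add_cancel add_diff_eq)
    qed
    moreover have "diff f0 = diff f" if "diff f \<in> weight_zero (Suc q)"
    proof -
      have "diff g = diff f"
        using that by (intro dg) (simp only: weight_zero_def mem_Collect_eq)
      then show ?thesis
        using f0(2) that by (simp only:)
    qed
    ultimately show ?case
      using f0(1) by blast
  qed
  have "finite (ws f - {0})"
    using finite_weights[of q f] by (simp add: ws_def)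
  then have "\<exists>f0. f0 \<in> weight_zero q \<and> (diff f \<in> weight_zero (Suc q) \<longrightarrow> diff f0 = diff f) \<and>
    (diff f = 0 \<longrightarrow> f - f0 \<in> H1.coboundaries q)"
    by (rule step) (use assms in auto)
  then show thesis
    using that by blast
qed

text \<open>The contraction with \<open>L\<close> at \<open>\<lambda> = 0\<close> recovers the action of \<open>\<partial>\<close>, because \<open>L\<^sub>(\<^sub>0\<^sub>)\<close> acts as
  \<open>\<partial>\<close> both on the algebra and on the module.\<close>

lemma cochain_D_lie: "f \<in> Cochains q \<Longrightarrow> W1.adjoint.cochain_D f = H0.lie f"
  unfolding H0.lie_def by (rule W.cochain_D_eq_cartan) (simp_all add: w1_br_L_coeff_0)

interpretation H0: injective_contraction W.smulc Cochains diff "W.ctr w1_L 0"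
proof
  fix f :: "'a w1 list \<Rightarrow> 'a w1 mpoly" and q
  assume f: "f \<in> Cochains q" and 0: "H0.lie f = 0"
  have "W.EA.evs e (f as) = 0" for e as
  proof -
    define m where "m = W.EA.evs e (f as)"
    define s where "s = (\<Sum>k<length as. e k)"
    have "W.EA.evs e (W1.adjoint.cochain_D f as) = w1_D m + w1_scale s m"
      using W.EA.ev_map[of w1_D, OF w1_D_add w1_D_scale]
      by (simp add: W1.adjoint.cochain_D_def m_def s_def)
    then have "w1_D m + w1_scale s m = 0"
      using f 0 by (simp add: cochain_D_lie)
    then have "[:s, 1:] * fst m = 0" "[:s, 1:] * snd m = 0"
      by (simp_all add: w1_D_def w1_scale_def prod_eq_iff add.commute)
    then have "fst m = 0" "snd m = 0"
      by (simp_all only: mult_eq_0_iff) auto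
    then show ?thesis
      by (simp add: m_def prod_eq_iff)
  qed
  then have "f as = 0" for as
    by (rule W.EA.ev_eq_0)
  then show "f = 0"
    by (simp add: fun_eq_iff)
qed

section \<open>Coefficients of a cochain on the generators\<close>

primrec expo :: "nat list \<Rightarrow> (nat \<Rightarrow>\<^sub>0 nat)"
  where "expo [] = 0" | "expo (n # ns) = exp_cons n (expo ns)"

text \<open>The coefficients on the generators, with arguments and exponents collected in one list of
  pairs (generator, exponent), so that skew-symmetry permutes the entries of the list.\<close>

definition kap :: "('f::field_char_0 w1 list \<Rightarrow> 'f w1 mpoly) \<Rightarrow> (bool \<times> nat) list \<Rightarrow> 'f w1"
  where "kap f zs = Poly_Mapping.lookup (f (map (gen \<circ> fst) zs)) (expo (map snd zs))"

lemma kap_Cons: "kap f (z # zs) = kap (W.ctr (gen (fst z)) (snd z) f) zs"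
  by (simp add: kap_def W.ctr_def lookup_coef0)

lemma kap_plus [simp]: "kap (f + g) zs = kap f zs + kap g zs"
  and kap_diff [simp]: "kap (f - g) zs = kap f zs - kap g zs"
  and kap_uminus [simp]: "kap (- f) zs = - kap f zs"
  and kap_zero [simp]: "kap 0 zs = 0"
  by (simp_all add: kap_def lookup_add lookup_minus)

lemma kap_smulc [simp]: "kap (W.smulc c f) zs = w1_scale c (kap f zs)"
  by (simp add: kap_def W.smulc_def W.lookup_mmult_mconst)

lemma lookup_expo: "Poly_Mapping.lookup (expo ns) i = (if i < length ns then ns ! i else 0)"
proof (induction ns arbitrary: i)
  case (Cons n ns)
  then show ?case by (cases i) simp_all
qed simp

definition pweight :: "bool \<times> nat \<Rightarrow> int"
  where "pweight z = int (snd z) + sg (fst z)"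

lemma lweight_expo: "lweight (map fst zs) (expo (map snd zs)) = sum_list (map pweight zs)"
  by (simp add: lweight_def lookup_expo pweight_def sum_list_sum_nth atLeast0LessThan)

definition kco :: "(bool \<times> nat) list \<Rightarrow> bool \<Rightarrow> nat \<Rightarrow> ('f::field_char_0 w1 list \<Rightarrow> 'f w1 mpoly) \<Rightarrow> 'f"
  where "kco zs b j f = coeff ((if b then fst else snd) (kap f zs)) j"

lemma kco_wcoef: "kco zs b j f = wcoef f (map fst zs) (expo (map snd zs)) b j"
  by (simp add: kco_def wcoef_def kap_def)

lemma cochain_keys:
  assumes "f \<in> Cochains q" "Poly_Mapping.lookup (f (map gen bs)) t \<noteq> 0"
  obtains zs where "length zs = q" "bs = map fst zs" "t = expo (map snd zs)"
proof -
  note C = assms(1)[unfolded W1.adjoint.cochains_def mem_Collect_eq]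
  have "length bs = q"
    using C[THEN conjunct1, rule_format, of "map gen bs"] assms(2) by (metis length_map lookup_zero)
  moreover have "Poly_Mapping.keys t \<subseteq> {..<q}"
    using C[THEN conjunct2, THEN conjunct1] assms(2) by (simp add: in_keys_iff)
  then have "t = expo (map (Poly_Mapping.lookup t) [0..<q])"
    by (intro poly_mapping_eqI) (auto simp: lookup_expo in_keys_iff)
  ultimately show thesis
    by (intro that[of "zip bs (map (Poly_Mapping.lookup t) [0..<q])"]) simp_all
qed

lemma weight_zero_kco:
  assumes "f \<in> Cochains q"
  shows "f \<in> weight_zero q \<longleftrightarrow> (\<forall>zs b j. length zs = q \<longrightarrow> kco zs b j f \<noteq> 0 \<longrightarrow>
    sum_list (map pweight zs) + int j + (if b then 2 else 0) = 0)"
proof -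
  have "wt (map fst zs) (expo (map snd zs)) b j = sum_list (map pweight zs) + int j + (if b then 2 else 0)" for zs b j
    by (simp add: wt_def lweight_expo)
  note wt = this
  show ?thesis
  proof
    assume "f \<in> weight_zero q"
    then have "wt (map fst zs) (expo (map snd zs)) b j = 0" if "length zs = q" "kco zs b j f \<noteq> 0" for zs b j
      using that unfolding weight_zero_iff[OF assms] kco_wcoef by (metis length_map)
    then show "\<forall>zs b j. length zs = q \<longrightarrow> kco zs b j f \<noteq> 0 \<longrightarrow>
        sum_list (map pweight zs) + int j + (if b then 2 else 0) = 0"
      by (simp add: wt)
  next
    assume *: "\<forall>zs b j. length zs = q \<longrightarrow> kco zs b j f \<noteq> 0 \<longrightarrow>
        sum_list (map pweight zs) + int j + (if b then 2 else 0) = 0"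
    show "f \<in> weight_zero q"
      unfolding weight_zero_iff[OF assms]
    proof (intro allI impI)
      fix bs t b j assume "length bs = q" and nz: "wcoef f bs t b j \<noteq> 0"
      then have "Poly_Mapping.lookup (f (map gen bs)) t \<noteq> 0"
        by (auto simp: wcoef_def split: if_splits)
      from cochain_keys[OF assms this] obtain zs where zs: "length zs = q" "bs = map fst zs" "t = expo (map snd zs)"
        by blast
      then show "wt bs t b j = 0"
        using * nz by (simp add: wt kco_wcoef)
    qed
  qed
qed

lemma cochain_eq_0_kco:
  assumes "f \<in> Cochains q" "\<And>zs b j. length zs = q \<Longrightarrow> kco zs b j f = 0"
  shows "f = 0"
proof (rule cochain_eq_0[OF assms(1)])
  fix bs :: "bool list"
  have "Poly_Mapping.lookup (f (map gen bs)) t = 0" for t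
  proof (rule ccontr)
    assume nz: "Poly_Mapping.lookup (f (map gen bs)) t \<noteq> 0"
    from cochain_keys[OF assms(1) this] obtain zs where zs: "length zs = q" "bs = map fst zs" "t = expo (map snd zs)"
      by blast
    have "kap f zs = 0"
      using assms(2)[OF zs(1), of True] assms(2)[OF zs(1), of False]
      by (simp add: kco_def prod_eq_iff poly_eq_iff)
    with zs nz show False
      by (simp add: kap_def)
  qed
  then show "f (map gen bs) = 0"
    by (intro poly_mapping_eqI) simp
qed

lemma mono_val_map_key:
  assumes "bij \<pi>"
  shows "mono_val (\<lambda>i. e (\<pi> i)) t = mono_val e (Poly_Mapping.map_key (inv \<pi>) t)"
proof -
  have inj: "inj (inv \<pi>)"
    using assms by (simp add: bij_imp_bij_inv bij_is_inj)
  have "mono_val e (Poly_Mapping.map_key (inv \<pi>) t) =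
      (\<Prod>i\<in>\<pi> ` Poly_Mapping.keys t. e i ^ Poly_Mapping.lookup t (inv \<pi> i))"
    using assms by (simp add: mono_val_def keys_map_key inj map_key.rep_eq bij_vimage_eq_inv_image
        bij_imp_bij_inv inv_inv_eq)
  also have "\<dots> = mono_val (\<lambda>i. e (\<pi> i)) t"
    using assms by (subst prod.reindex) (auto simp: mono_val_def bij_def inj_on_def)
  finally show ?thesis ..
qed

text \<open>Exchanging the first two arguments and the first two variables changes the sign; comparing
  coefficients, this exchanges the first two pairs.\<close>

lemma kap_swap_hd:
  assumes "f \<in> Cochains q" "length zs + 2 = q"
  shows "kap f (x # y # zs) = - kap f (y # x # zs)"
proof -
  obtain \<phi> where rep: "W.represents q f \<phi>"
    using assms(1) W.cochain_represents by metis
  define \<pi> :: "nat \<Rightarrow> nat" where "\<pi> = transpose 0 1"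
  have bij: "bij \<pi>" and inv: "inv \<pi> = \<pi>"
    by (simp_all add: \<pi>_def)
  have inj: "inj (Poly_Mapping.map_key \<pi> :: (nat \<Rightarrow>\<^sub>0 nat) \<Rightarrow> _)"
  proof (rule injI)
    fix s t :: "nat \<Rightarrow>\<^sub>0 nat" assume *: "Poly_Mapping.map_key \<pi> s = Poly_Mapping.map_key \<pi> t"
    have "Poly_Mapping.lookup s i = Poly_Mapping.lookup t i" for i
      using arg_cong[OF *, of "\<lambda>u. Poly_Mapping.lookup u (\<pi> i)"] bij
      by (simp add: map_key.rep_eq bij_is_inj) (simp add: \<pi>_def)
    then show "s = t"
      by (rule poly_mapping_eqI)
  qed
  have invol: "Poly_Mapping.map_key \<pi> (Poly_Mapping.map_key \<pi> t) = t" for t :: "nat \<Rightarrow>\<^sub>0 nat"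
    using bij by (intro poly_mapping_eqI) (simp add: map_key.rep_eq bij_is_inj, simp add: \<pi>_def)
  define as :: "bool \<times> nat \<Rightarrow> bool \<times> nat \<Rightarrow> 'a w1 list"
    where "as z z' = gen (fst z) # gen (fst z') # map (gen \<circ> fst) zs" for z z'
  have "W.EA.evs e (Poly_Mapping.map_key (Poly_Mapping.map_key \<pi>) (f (as x y))) = W.EA.evs e (- f (as y x))" for e
  proof -
    have ev: "W.EA.evs (\<lambda>i. e (\<pi> i)) v = W.EA.evs e (Poly_Mapping.map_key (Poly_Mapping.map_key \<pi>) v)"
      for v :: "'a w1 mpoly"
    proof (induction v rule: poly_mapping_add_induct)
      case (single t m)
      have "Poly_Mapping.map_key (Poly_Mapping.map_key \<pi>) (Poly_Mapping.single t m) =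
          Poly_Mapping.single (Poly_Mapping.map_key \<pi> t) m"
        by (rule map_key_single[OF inj, of "Poly_Mapping.map_key \<pi> t" m, unfolded invol])
      then show ?case
        unfolding W.EA.ev_single mono_val_map_key[OF bij] inv by (simp only: W.EA.ev_single)
    next
      case zero
      show ?case
        unfolding map_key_zero[OF inj] W.EA.ev_zero ..
    next
      case (add v w)
      then show ?case
        unfolding map_key_plus[OF inj] W.EA.ev_add by (simp only:)
    qed
    have "W.zipe (as x y) (\<lambda>i. e (\<pi> i)) = (gen (fst x), e 1) # (gen (fst y), e 0) # W.zipe (map (gen \<circ> fst) zs) (\<lambda>i. e (Suc (Suc i)))"
      by (simp add: as_def W.zipe_Cons \<pi>_def transpose_def)
    moreover have "W.zipe (as y x) e = (gen (fst y), e 0) # (gen (fst x), e 1) # W.zipe (map (gen \<circ> fst) zs) (\<lambda>i. e (Suc (Suc i)))"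
      by (simp add: as_def W.zipe_Cons)
    ultimately show ?thesis
      using W.alt_swap_hd[OF W.representsD(2)[OF rep], of "(gen (fst x), e 1)" "(gen (fst y), e 0)"
          "W.zipe (map (gen \<circ> fst) zs) (\<lambda>i. e (Suc (Suc i)))"]
      by (simp only: ev[symmetric] W.EA.ev_minus W.representsD(1)[OF rep])
  qed
  then have eq: "Poly_Mapping.map_key (Poly_Mapping.map_key \<pi>) (f (as x y)) = - f (as y x)"
    by (rule W.EA.ev_inject)
  have lk: "Poly_Mapping.lookup (Poly_Mapping.map_key (Poly_Mapping.map_key \<pi>) v) t =
      Poly_Mapping.lookup v (Poly_Mapping.map_key \<pi> t)" for v :: "'a w1 mpoly" and t
    using inj by (simp add: map_key.rep_eq)
  have sw: "Poly_Mapping.lookup (f (as x y)) (Poly_Mapping.map_key \<pi> t) = - Poly_Mapping.lookup (f (as y x)) t" for t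
    unfolding lk[symmetric] eq lookup_uminus ..
  have ex: "Poly_Mapping.map_key \<pi> (expo (map snd (y # x # zs))) = expo (map snd (x # y # zs))"
  proof (rule poly_mapping_eqI)
    fix i
    have \<pi>: "\<pi> 0 = Suc 0" "\<pi> (Suc 0) = 0" "\<pi> (Suc (Suc k)) = Suc (Suc k)" for k
      by (simp_all add: \<pi>_def transpose_def)
    have "Poly_Mapping.lookup (Poly_Mapping.map_key \<pi> (expo (map snd (y # x # zs)))) i =
        Poly_Mapping.lookup (expo (map snd (y # x # zs))) (\<pi> i)"
      using bij_is_inj[OF bij] by (simp only: map_key.rep_eq if_True comp_apply)
    also have "\<dots> = Poly_Mapping.lookup (expo (map snd (x # y # zs))) i"
    proof (cases i)
      case (Suc j)
      then show ?thesis
        by (cases j) (simp_all add: \<pi>)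
    qed (simp add: \<pi>)
    finally show "Poly_Mapping.lookup (Poly_Mapping.map_key \<pi> (expo (map snd (y # x # zs)))) i =
        Poly_Mapping.lookup (expo (map snd (x # y # zs))) i" .
  qed
  have "kap f (u # v # zs) = Poly_Mapping.lookup (f (as u v)) (expo (map snd (u # v # zs)))" for u v
    by (simp add: kap_def as_def)
  then show ?thesis
    by (simp only: ex[symmetric] sw)
qed

lemma ctr_in: "f \<in> Cochains (Suc q) \<Longrightarrow> W.ctr a n f \<in> Cochains q"
  using W.cochain_represents W.ctr_represents W.represents_cochain by metis

lemma ctr_in_0: "f \<in> Cochains 0 \<Longrightarrow> W.ctr a n f = 0"
  using W.cochain_represents W.ctr_represents by metis

lemma kap_swap:
  "f \<in> Cochains q \<Longrightarrow> length us + length vs + 2 = q \<Longrightarrow> kap f (us @ x # y # vs) = - kap f (us @ y # x # vs)"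
proof (induction us arbitrary: f q)
  case Nil
  then show ?case using kap_swap_hd[of f q vs x y] by simp
next
  case (Cons u us)
  then obtain r where "q = Suc r"
    by (cases q) auto
  then show ?case
    using Cons.IH[of "W.ctr (gen (fst u)) (snd u) f" r] Cons.prems ctr_in[of f r] by (simp add: kap_Cons)
qed

lemma kap_move:
  "f \<in> Cochains q \<Longrightarrow> length us + length vs + length ws + 1 = q \<Longrightarrow>
    kap f (us @ x # vs @ ws) = w1_scale ((- 1) ^ length vs) (kap f (us @ vs @ x # ws))"
proof (induction vs arbitrary: us)
  case (Cons v vs)
  then show ?case
    using kap_swap[of f q us "vs @ ws" x v] Cons.IH[of "us @ [v]"] by simp
qed simp

lemma kap_not_distinct:
  assumes "f \<in> Cochains q" "length zs = q" "\<not> distinct zs"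
  shows "kap f zs = 0"
proof -
  obtain us x vs ws where zs: "zs = us @ [x] @ vs @ [x] @ ws"
    using not_distinct_decomp[OF assms(3)] by blast
  have "kap f zs = w1_scale ((- 1) ^ length vs) (kap f (us @ vs @ x # x # ws))"
    using kap_move[OF assms(1), of us vs "x # ws" x] assms(2) zs by simp
  moreover have "kap f (us @ vs @ x # x # ws) = - kap f (us @ vs @ x # x # ws)"
    using kap_swap[OF assms(1), of "us @ vs" ws x x] assms(2) zs by simp
  then have "w1_scale 2 (kap f (us @ vs @ x # x # ws)) = 0"
    by (simp add: w1_scale_2 eq_neg_iff_add_eq_0)
  then have "kap f (us @ vs @ x # x # ws) = 0"
    by (simp add: w1.scale_eq_0_iff)
  ultimately show ?thesis by simp
qed

lemma kap_mset:
  "f \<in> Cochains q \<Longrightarrow> length zs = q \<Longrightarrow> mset zs = mset ws \<Longrightarrow> kap f ws = 0 \<Longrightarrow> kap f zs = 0"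
proof (induction zs arbitrary: f q ws)
  case (Cons z zs)
  note C = Cons.prems(1)
  obtain r where r: "q = Suc r" "length zs = r"
    using Cons.prems(2) by auto
  have "z \<in> set ws"
    using Cons.prems(3) by (metis list.set_intros(1) mset_eq_setD)
  then obtain us vs where ws: "ws = us @ z # vs"
    by (metis split_list)
  have mset: "mset zs = mset (us @ vs)"
    using Cons.prems(3) by (simp add: ws)
  then have "length zs = length (us @ vs)"
    by (metis size_mset)
  then have "kap f (z # us @ vs) = 0"
    using kap_move[OF C, of "[]" us vs z] Cons.prems(4) r by (simp add: ws)
  then have "kap (W.ctr (gen (fst z)) (snd z) f) (us @ vs) = 0"
    by (simp add: kap_Cons)
  moreover have "W.ctr (gen (fst z)) (snd z) f \<in> Cochains r"
    using C unfolding r by (rule ctr_in)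
  ultimately show ?case
    unfolding kap_Cons using Cons.IH r(2) mset by blast
qed simp

section \<open>Cochains of weight zero\<close>

abbreviation (input) "L0 \<equiv> (True, 0 :: nat)"
abbreviation (input) "L1 \<equiv> (True, Suc 0)"
abbreviation (input) "L2 \<equiv> (True, Suc (Suc 0))"
abbreviation (input) "H0 \<equiv> (False, 0 :: nat)"

lemma pweight_pos: "z \<noteq> L0 \<Longrightarrow> z \<noteq> L1 \<Longrightarrow> pweight z \<ge> 1"
  by (cases z; cases "fst z") (auto simp: pweight_def sg_def)

text \<open>Apart from \<open>L0\<close> of weight \<open>- 1\<close> and \<open>L1\<close> of weight 0 every pair has weight at least 1, and
  weight exactly 1 only for \<open>L2\<close> and \<open>H0\<close>.\<close>

lemma weights_of_sets:
  assumes "finite S"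
  shows "sum pweight S \<ge> - 1"
    and "sum pweight S = - 1 \<Longrightarrow> S \<in> {{L0}, {L1, L0}}"
    and "sum pweight S = 0 \<Longrightarrow> S \<in> {{}, {L1}, {L2, L0}, {L0, H0}, {L2, L1, L0}, {L1, L0, H0}}"
proof -
  define T where "T = S - {L0, L1}"
  have T: "finite T"
    using assms by (simp add: T_def)
  have "sum pweight S = sum pweight (S \<inter> {L0, L1}) + sum pweight T"
    using assms unfolding T_def by (metis Int_Diff_disjoint Int_Diff_Un finite_Diff finite_Int sum.union_disjoint)
  also have "sum pweight (S \<inter> {L0, L1}) = (if L0 \<in> S then - 1 else 0)"
  proof -
    have "S \<inter> {L0, L1} = (if L0 \<in> S then {L0} else {}) \<union> (if L1 \<in> S then {L1} else {})"
      by auto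
    then show ?thesis
      by (auto simp: pweight_def sg_def)
  qed
  finally have S: "sum pweight S = (if L0 \<in> S then - 1 else 0) + sum pweight T" .
  have card: "int (card T) \<le> sum pweight T"
  proof -
    have "(\<Sum>z\<in>T. 1) \<le> sum pweight T"
      by (rule sum_mono) (auto simp: T_def intro: pweight_pos)
    then show ?thesis by simp
  qed
  then show "sum pweight S \<ge> - 1"
    using S by (auto split: if_splits)
  have S_T: "S = (if L0 \<in> S then {L0} else {}) \<union> (if L1 \<in> S then {L1} else {}) \<union> T"
    by (auto simp: T_def)
  have T0: "T = {}" if "sum pweight T \<le> 0"
  proof -
    have "card T = 0"
      using card that by linarith
    then show ?thesis
      using T by simp
  qed
  have T1: "T = {L2} \<or> T = {H0}" if "sum pweight T = 1"
  proof -
    have "T \<noteq> {}"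
      using that by auto
    then have "card T = 1"
      using card that T by (metis card_0_eq le_antisym less_one not_le of_nat_1 of_nat_le_iff linorder_le_less_linear)
    then obtain z where z: "T = {z}"
      by (auto simp: card_Suc_eq card_1_singleton_iff)
    then have "pweight z = 1"
      using that by simp
    then have "z = L2 \<or> z = H0"
      by (cases z; cases "fst z") (auto simp: pweight_def sg_def)
    then show ?thesis
      using z by auto
  qed
  show "S \<in> {{L0}, {L1, L0}}" if "sum pweight S = - 1"
  proof -
    have "L0 \<in> S" "T = {}"
      using that S T0 card by (auto split: if_splits)
    then show ?thesis
      using S_T by (cases "L1 \<in> S") auto
  qed
  show "S \<in> {{}, {L1}, {L2, L0}, {L0, H0}, {L2, L1, L0}, {L1, L0, H0}}" if "sum pweight S = 0"
  proof (cases "L0 \<in> S")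
    case True
    then have "T = {L2} \<or> T = {H0}"
      using that S T1 by simp
    then show ?thesis
      using S_T True by (cases "L1 \<in> S") auto
  next
    case False
    then have "T = {}"
      using that S T0 by simp
    then show ?thesis
      using S_T False by (cases "L1 \<in> S") auto
  qed
qed

text \<open>An entry \<open>(ws, j)\<close> stands for the wedge product of the one-forms in \<open>ws\<close> with value \<open>\<partial>\<^sup>j H\<close>.
  The target \<open>L\<close> contributes at least 2 to the weight and cannot occur.\<close>

definition monomials :: "((bool \<times> nat) list \<times> nat) set"
  where "monomials = {([], 0), ([L0], 1), ([L1], 0), ([L1, L0], 1), ([L2, L0], 0), ([L0, H0], 0),
    ([L2, L1, L0], 0), ([L1, L0, H0], 0)}"

text \<open>A nonzero coordinate belongs to distinct pairs by skew-symmetry, and the weights leave only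
  the listed sets of pairs. Skew-symmetry then transports the vanishing from the listed order to
  all orders.\<close>

lemma weight_zero_eq_0:
  assumes f: "f \<in> weight_zero q" and 0: "\<And>ws j. (ws, j) \<in> monomials \<Longrightarrow> length ws = q \<Longrightarrow> kco ws False j f = 0"
  shows "f = 0"
proof -
  have C: "f \<in> Cochains q"
    using f by (simp add: weight_zero_def)
  have wt: "sum_list (map pweight zs) + int j + (if b then 2 else 0) = 0" if "length zs = q" "kco zs b j f \<noteq> 0" for zs b j
    using f that weight_zero_kco[OF C] by blast
  show ?thesis
  proof (rule cochain_eq_0_kco[OF C], rule ccontr)
    fix zs b j assume len: "length zs = q" and nz: "kco zs b j f \<noteq> 0"
    then have "kap f zs \<noteq> 0"
      by (auto simp: kco_def split: if_splits)
    then have dist: "distinct zs"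
      using kap_not_distinct[OF C len] by blast
    then have sum: "sum_list (map pweight zs) = sum pweight (set zs)"
      by (simp add: sum_list_distinct_conv_sum_set)
    have b: "\<not> b"
      using wt[OF len nz] weights_of_sets(1)[of "set zs"] sum by (auto split: if_splits)
    have "(j = 0 \<and> sum pweight (set zs) = 0) \<or> (j = 1 \<and> sum pweight (set zs) = - 1)"
      using wt[OF len nz] weights_of_sets(1)[of "set zs"] sum b by auto
    then have "\<exists>ws. (ws, j) \<in> monomials \<and> distinct ws \<and> set ws = set zs"
    proof
      assume "j = 0 \<and> sum pweight (set zs) = 0"
      then have "j = 0" "set zs \<in> {{}, {L1}, {L2, L0}, {L0, H0}, {L2, L1, L0}, {L1, L0, H0}}"
        using weights_of_sets(3)[of "set zs"] by auto
      then have "set zs \<in> set ` {[], [L1], [L2, L0], [L0, H0], [L2, L1, L0], [L1, L0, H0]}"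
        by simp
      then obtain ws where ws: "ws \<in> {[], [L1], [L2, L0], [L0, H0], [L2, L1, L0], [L1, L0, H0]}" "set zs = set ws"
        by blast
      then show ?thesis
        using \<open>j = 0\<close> by (intro exI[of _ ws]) (auto simp: monomials_def)
    next
      assume "j = 1 \<and> sum pweight (set zs) = - 1"
      then have "j = 1" "set zs \<in> {{L0}, {L1, L0}}"
        using weights_of_sets(2)[of "set zs"] by auto
      then have "set zs \<in> set ` {[L0], [L1, L0]}"
        by simp
      then obtain ws where ws: "ws \<in> {[L0], [L1, L0]}" "set zs = set ws"
        by blast
      then show ?thesis
        using \<open>j = 1\<close> by (intro exI[of _ ws]) (auto simp: monomials_def)
    qed
    then obtain ws where ws: "(ws, j) \<in> monomials" "distinct ws" "set ws = set zs"
      by blast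
    then have mset: "mset zs = mset ws"
      using dist by (simp add: set_eq_iff_mset_eq_distinct)
    then have lws: "length ws = q"
      using len by (metis size_mset)
    have "kap f ws = 0"
    proof -
      have "kco ws b' j' f = 0" for b' j'
      proof (rule ccontr)
        assume nz': "kco ws b' j' f \<noteq> 0"
        have "sum_list (map pweight ws) = sum_list (map pweight zs)"
          using mset by (metis mset_map sum_mset_sum_list)
        then have "int j' + (if b' then 2 else 0) = int j"
          using wt[OF lws nz'] wt[OF len nz] b by simp
        moreover have "\<not> b'"
          using wt[OF lws nz'] weights_of_sets(1)[of "set ws"] ws(2)
          by (auto simp: sum_list_distinct_conv_sum_set split: if_splits)
        ultimately show False
          using nz' 0[OF ws(1) lws] by simp
      qed
      from this[of True] this[of False] show ?thesis
        by (simp add: kco_def prod_eq_iff poly_eq_iff)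
    qed
    then have "kap f zs = 0"
      using kap_mset[OF C len mset] by blast
    then show False
      using nz by (cases b) (simp_all add: kco_def)
  qed
qed

section \<open>Wedge products of one-forms\<close>

text \<open>The one-form that is \<open>\<lambda>\<^sup>n\<close> on one generator and 0 on the other, extended by \<open>\<partial> = - \<lambda>\<close>. Its
  wedge product with a cochain is defined twice, for alternating functions and for polynomials,
  the second representing the first.\<close>

definition oneform :: "bool \<times> nat \<Rightarrow> 'f::field_char_0 w1 \<times> 'f \<Rightarrow> 'f"
  where "oneform w x = snd x ^ snd w * poly (if fst w then fst (fst x) else snd (fst x)) (- snd x)"

definition wedge_form :: "bool \<times> nat \<Rightarrow> 'f::field_char_0 form \<Rightarrow> 'f form"
  where "wedge_form w \<phi> xs =
    (\<Sum>k<length xs. w1_scale ((- 1) ^ k) (w1_scale (oneform w (xs ! k)) (\<phi> (sel (\<lambda>i. i \<noteq> k) xs))))"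

definition wedge :: "bool \<times> nat \<Rightarrow> ('f::field_char_0 w1 list \<Rightarrow> 'f w1 mpoly) \<Rightarrow> 'f w1 list \<Rightarrow> 'f w1 mpoly"
  where "wedge w f as =
    (\<Sum>k<length as.
       let I = filter (\<lambda>i. i \<noteq> k) [0..<length as] in
       mmult w1_scale ((- 1) ^ k * (mvar k ^ snd w *
           at_var (*) (- mvar k) (if fst w then fst (as ! k) else snd (as ! k))))
         (msubst w1_scale (map mvar I) (f (map ((!) as) I))))"

lemma oneform_add: "oneform w (a + b, l) = oneform w (a, l) + oneform w (b, l)"
  by (cases "fst w") (simp_all add: oneform_def distrib_left)

lemma oneform_scale: "oneform w (w1_scale c a, l) = c * oneform w (a, l)"
  by (cases "fst w") (simp_all add: oneform_def w1_scale_def)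

lemma oneform_D: "oneform w (w1_D a, l) = - l * oneform w (a, l)"
  by (cases "fst w") (simp_all add: oneform_def w1_D_def)

lemma oneform_gen: "oneform w (gen b, x) = (if fst w = b then x ^ snd w else 0)"
  by (simp add: oneform_def gen_def w1_L_def w1_H_def)

lemma wedge_form_Nil [simp]: "wedge_form w \<phi> [] = 0"
  by (simp add: wedge_form_def)

lemma wedge_form_Cons:
  "wedge_form w \<phi> (x # xs) = w1_scale (oneform w x) (\<phi> xs) - wedge_form w (W.iota x \<phi>) xs"
  unfolding wedge_form_def length_Cons sum.lessThan_Suc_shift
  by (simp add: sel_Cons W.iota_apply sum_negf)

lemma wedge_form_plus: "wedge_form w (\<phi> + \<psi>) xs = wedge_form w \<phi> xs + wedge_form w \<psi> xs"
  by (simp add: wedge_form_def w1.scale_right_distrib sum.distrib)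

lemma wedge_form_uminus: "wedge_form w (- \<phi>) xs = - wedge_form w \<phi> xs"
  by (simp add: wedge_form_def sum_negf)

lemma wedge_form_smul: "wedge_form w (W.smul c \<phi>) xs = w1_scale c (wedge_form w \<phi> xs)"
proof -
  have *: "w1_scale a (w1_scale b (w1_scale c m)) = w1_scale c (w1_scale a (w1_scale b m))" for a b and m :: "'a w1"
    by (simp only: w1.scale_scale mult_ac)
  show ?thesis
    unfolding wedge_form_def W.smul_apply * w1.scale_sum_right ..
qed

text \<open>By induction on the position with the rule \<open>\<iota>\<^sub>x (\<omega> \<and> \<phi>) = \<omega>(x) \<phi> - \<omega> \<and> \<iota>\<^sub>x \<phi>\<close>.\<close>

lemma alt_wedge_form:
  assumes "W.alt \<phi>"
  shows "W.alt (wedge_form w \<phi>)"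
proof (rule W.altI)
  fix us vs :: "('a w1 \<times> 'a) list" and a b :: "'a w1" and l c :: 'a
  show "wedge_form w \<phi> (us @ (a + b, l) # vs) = wedge_form w \<phi> (us @ (a, l) # vs) + wedge_form w \<phi> (us @ (b, l) # vs)"
    using assms
  proof (induction us arbitrary: \<phi>)
    case Nil
    then show ?case
      by (simp add: wedge_form_Cons oneform_add w1.scale_left_distrib W.iota_hd(1) wedge_form_plus)
  next
    case (Cons u us)
    show ?case
      by (simp add: wedge_form_Cons Cons.IH[OF W.alt_iota[OF Cons.prems]] W.alt_add[OF Cons.prems] w1.scale_right_distrib)
  qed
  show "wedge_form w \<phi> (us @ (w1_scale c a, l) # vs) = w1_scale c (wedge_form w \<phi> (us @ (a, l) # vs))"
    using assms
  proof (induction us arbitrary: \<phi>)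
    case Nil
    then show ?case
      by (simp add: wedge_form_Cons oneform_scale W.iota_hd(2) wedge_form_smul w1.scale_right_diff_distrib)
  next
    case (Cons u us)
    show ?case
      by (simp add: wedge_form_Cons Cons.IH[OF W.alt_iota[OF Cons.prems]] W.alt_scale[OF Cons.prems]
          w1.scale_right_diff_distrib mult.commute)
  qed
  show "wedge_form w \<phi> (us @ (w1_D a, l) # vs) = w1_scale (- l) (wedge_form w \<phi> (us @ (a, l) # vs))"
    using assms
  proof (induction us arbitrary: \<phi>)
    case Nil
    show ?case
      by (simp only: append_Nil wedge_form_Cons oneform_D W.iota_hd(3)[OF Nil] wedge_form_smul
          w1.scale_right_diff_distrib w1.scale_scale)
  next
    case (Cons u us)
    have "w1_scale (oneform w u) (w1_scale (- l) m) = w1_scale (- l) (w1_scale (oneform w u) m)" for m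
      by (simp only: w1.scale_scale mult.commute)
    then show ?case
      by (simp only: append_Cons wedge_form_Cons Cons.IH[OF W.alt_iota[OF Cons.prems]] W.alt_D[OF Cons.prems]
          w1.scale_right_diff_distrib)
  qed
next
  fix us vs :: "('a w1 \<times> 'a) list" and y z
  show "wedge_form w \<phi> (us @ y # z # vs) = - wedge_form w \<phi> (us @ z # y # vs)"
    using assms
  proof (induction us arbitrary: \<phi>)
    case Nil
    have "wedge_form w (W.iota z (W.iota y \<phi>)) vs = - wedge_form w (W.iota y (W.iota z \<phi>)) vs"
      by (subst W.iota_hd(4)[OF Nil]) (rule wedge_form_uminus)
    then show ?case
      by (simp add: wedge_form_Cons W.iota_apply)
  next
    case (Cons u us)
    show ?case
      using W.alt_swap[OF Cons.prems, of us y z vs] Cons.IH[OF W.alt_iota[OF Cons.prems, of u]]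
      by (simp add: wedge_form_Cons)
  qed
qed

lemma length_sel_omit: "k < length xs \<Longrightarrow> length (sel (\<lambda>i. i \<noteq> k) xs) = length xs - 1"
proof (induction xs arbitrary: k)
  case (Cons x xs)
  then show ?case
    by (cases k) (auto simp: sel_Cons)
qed simp

lemma peval_field: "scalar.pevs x p = poly p x"
  by (induction p) simp_all

lemma represents_wedge:
  assumes "W.represents q f \<phi>"
  shows "W.represents (Suc q) (wedge w f) (wedge_form w \<phi>)"
proof -
  note rep = W.representsD(1)[OF assms]
  have "W.EA.evs e (wedge w f as) = wedge_form w \<phi> (W.zipe as e)" for as e
  proof -
    have "W.EA.evs e (let I = filter (\<lambda>i. i \<noteq> k) [0..<length as] in
       mmult w1_scale ((- 1) ^ k * (mvar k ^ snd w *
           at_var (*) (- mvar k) (if fst w then fst (as ! k) else snd (as ! k))))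
         (msubst w1_scale (map mvar I) (f (map ((!) as) I)))) =
      w1_scale ((- 1) ^ k) (w1_scale (oneform w (W.zipe as e ! k)) (\<phi> (sel (\<lambda>i. i \<noteq> k) (W.zipe as e))))"
      if "k < length as" for k
    proof -
      define I where "I = filter (\<lambda>i. i \<noteq> k) [0..<length as]"
      have "W.zipe (map ((!) as) I) (\<lambda>i. evF e (map mvar I ! i)) = sel (\<lambda>i. i \<noteq> k) (W.zipe as e)"
        by (rule W.zipe_sel[OF I_def]) simp
      then show ?thesis
        using that unfolding Let_def I_def[symmetric]
        by (simp add: rep oneform_def peval_field del: nth_map)
    qed
    then show ?thesis
      unfolding wedge_def wedge_form_def W.EA.ev_sum W.length_zipe by (intro sum.cong refl) auto
  qed
  moreover have "wedge_form w \<phi> xs = 0" if "length xs \<noteq> Suc q" for xs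
  proof -
    have "\<phi> (sel (\<lambda>i. i \<noteq> k) xs) = 0" if "k < length xs" for k
      using \<open>length xs \<noteq> Suc q\<close> that by (intro W.representsD(3)[OF assms]) (auto simp: length_sel_omit)
    then show ?thesis
      by (simp add: wedge_form_def)
  qed
  ultimately show ?thesis
    using alt_wedge_form[OF W.representsD(2)[OF assms]] by (simp add: W.represents_def W.repr_def)
qed

lemma wedge_in: "f \<in> Cochains q \<Longrightarrow> wedge w f \<in> Cochains (Suc q)"
  using W.cochain_represents represents_wedge W.represents_cochain by metis

text \<open>The contraction is an antiderivation of the wedge product.\<close>

lemma ctr_wedge:
  assumes "f \<in> Cochains q"
  shows "W.ctr (gen b) n (wedge w f) = (if w = (b, n) then f else 0) - wedge w (W.ctr (gen b) n f)"
proof -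
  obtain \<phi> where rep: "W.represents q f \<phi>"
    using assms W.cochain_represents by metis
  obtain \<psi> where \<psi>: "\<And>xs. W.has_coeff n (\<lambda>x. \<phi> ((gen b, x) # xs)) (\<psi> xs)"
    "q = 0 \<Longrightarrow> W.ctr (gen b) n f = 0 \<and> \<psi> = 0" "\<And>r. q = Suc r \<Longrightarrow> W.represents r (W.ctr (gen b) n f) \<psi>"
    using W.ctr_represents[OF rep, where a = "gen b" and n = n] by blast
  obtain \<chi> where \<chi>: "\<And>xs. W.has_coeff n (\<lambda>x. wedge_form w \<phi> ((gen b, x) # xs)) (\<chi> xs)"
    "W.represents q (W.ctr (gen b) n (wedge w f)) \<chi>"
    using W.ctr_represents[OF represents_wedge[OF rep, of w], where a = "gen b" and n = n] by blast
  have rw: "W.repr (wedge w (W.ctr (gen b) n f)) (wedge_form w \<psi>)"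
  proof (cases q)
    case 0
    have "W.represents (Suc 0) (wedge w 0) (wedge_form w 0)"
      by (rule represents_wedge[OF W.represents_zero])
    then show ?thesis
      unfolding conjunct1[OF \<psi>(2)[OF 0]] conjunct2[OF \<psi>(2)[OF 0]] W.represents_def by (rule conjunct1)
  next
    case (Suc r)
    then show ?thesis
      using represents_wedge[OF \<psi>(3)[OF Suc]] by (simp add: W.represents_def)
  qed
  have "\<chi> xs = (if w = (b, n) then \<phi> xs else 0) - wedge_form w \<psi> xs" for xs
  proof (rule W.has_coeff_unique[OF \<chi>(1)])
    have "W.has_coeff n (\<lambda>x. w1_scale (oneform w (gen b, x)) (\<phi> xs)) (if w = (b, n) then \<phi> xs else 0)"
    proof (cases "fst w = b")
      case True
      have u: "w1_scale (oneform w (gen b, x)) (\<phi> xs) = w1_scale (poly (monom 1 (snd w)) x) (\<phi> xs)" for x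
        using True by (simp add: oneform_gen poly_monom)
      have v: "(if w = (b, n) then \<phi> xs else 0) = w1_scale (coeff (monom 1 (snd w)) n) (\<phi> xs)"
        using True by (cases w) simp
      show ?thesis
        unfolding u v by (rule has_coeff_poly)
    next
      case False
      then have "w \<noteq> (b, n)" "oneform w (gen b, x) = 0" for x :: 'a
        by (auto simp: oneform_gen)
      then show ?thesis
        using W.has_coeff_0 by simp
    qed
    moreover have "W.has_coeff n (\<lambda>x. wedge_form w (W.iota (gen b, x) \<phi>) xs) (wedge_form w \<psi> xs)"
      unfolding wedge_form_def W.iota_apply
      by (intro W.has_coeff_sum W.has_coeff_scale \<psi>(1))
    ultimately show "W.has_coeff n (\<lambda>x. wedge_form w \<phi> ((gen b, x) # xs))
        ((if w = (b, n) then \<phi> xs else 0) - wedge_form w \<psi> xs)"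
      unfolding wedge_form_Cons diff_conv_add_uminus
      by (intro W.has_coeff_add W.has_coeff_minus)
  qed
  note \<chi>_eq = this
  show ?thesis
  proof (rule ext, rule W.EA.ev_inject)
    fix as e
    show "W.EA.evs e (W.ctr (gen b) n (wedge w f) as) =
        W.EA.evs e (((if w = (b, n) then f else 0) - wedge w (W.ctr (gen b) n f)) as)"
      using rw by (simp add: W.representsD(1)[OF \<chi>(2)] \<chi>_eq W.representsD(1)[OF rep] W.repr_def)
  qed
qed

lemma wedge_plus: "f \<in> Cochains q \<Longrightarrow> g \<in> Cochains q \<Longrightarrow> wedge w (f + g) = wedge w f + wedge w g"
proof -
  assume "f \<in> Cochains q" "g \<in> Cochains q"
  then obtain \<phi> \<psi> where *: "W.represents q f \<phi>" "W.represents q g \<psi>"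
    using W.cochain_represents by metis
  have eq: "wedge_form w (\<phi> + \<psi>) = wedge_form w \<phi> + wedge_form w \<psi>"
    by (rule ext) (simp add: wedge_form_plus)
  show ?thesis
  proof (rule W.represents_inject)
    show "W.represents (Suc q) (wedge w (f + g)) (wedge_form w (\<phi> + \<psi>))"
      by (intro represents_wedge W.represents_plus *)
    show "W.represents (Suc q) (wedge w f + wedge w g) (wedge_form w (\<phi> + \<psi>))"
      unfolding eq by (intro represents_wedge W.represents_plus *)
  qed
qed

lemma wedge_zero [simp]: "wedge w 0 = 0"
  by (simp add: wedge_def fun_eq_iff Let_def msubst_def)

text \<open>The wedge product of the one-forms in the list, with value \<open>\<partial>\<^sup>j H\<close>.\<close>

primrec cmono :: "nat \<Rightarrow> (bool \<times> nat) list \<Rightarrow> 'f::field_char_0 w1 list \<Rightarrow> 'f w1 mpoly"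
  where
    "cmono j [] = (\<lambda>as. if as = [] then mconst (0, monom 1 j) else 0)"
  | "cmono j (w # ws) = wedge w (cmono j ws)"

declare cmono.simps [simp del]

primrec cmono_form :: "nat \<Rightarrow> (bool \<times> nat) list \<Rightarrow> 'f::field_char_0 form"
  where
    "cmono_form j [] = (\<lambda>xs. if xs = [] then (0, monom 1 j) else 0)"
  | "cmono_form j (w # ws) = wedge_form w (cmono_form j ws)"

lemma represents_mono: "W.represents (length ws) (cmono j ws) (cmono_form j ws)"
proof (induction ws)
  case Nil
  have "W.zipe as e = [] \<longleftrightarrow> as = []" for as :: "'a w1 list" and e
    by (metis W.length_zipe length_0_conv)
  then show ?case
    by (simp add: W.represents_def W.repr_def W.alt_def cmono.simps)
qed (simp add: represents_wedge cmono.simps)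

lemma mono_in: "cmono j ws \<in> Cochains (length ws)"
  using represents_mono by (rule W.represents_cochain)

text \<open>Weights add up, as the antiderivation rule shows one coordinate pair after the other.\<close>

lemma kco_wedge:
  assumes "f \<in> Cochains q" "length zs = Suc q"
    and "\<And>zs b j. length zs = q \<Longrightarrow> kco zs b j f \<noteq> 0 \<Longrightarrow> sum_list (map pweight zs) + int j + (if b then 2 else 0) = s"
    and "kco zs b j (wedge w f) \<noteq> 0"
  shows "sum_list (map pweight zs) + int j + (if b then 2 else 0) = s + pweight w"
  using assms
proof (induction zs arbitrary: q f s)
  case (Cons z zs)
  have len: "length zs = q"
    using Cons.prems(2) by simp
  have "kap (wedge w f) (z # zs) = (if w = z then kap f zs else 0) - kap (wedge w (W.ctr (gen (fst z)) (snd z) f)) zs"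
    unfolding kap_Cons ctr_wedge[OF Cons.prems(1)] by (cases z) simp
  then have "kco (z # zs) b j (wedge w f) =
      (if w = z then kco zs b j f else 0) - kco zs b j (wedge w (W.ctr (gen (fst z)) (snd z) f))"
    by (simp add: kco_def)
  with Cons.prems(4) have "w = z \<and> kco zs b j f \<noteq> 0 \<or> kco zs b j (wedge w (W.ctr (gen (fst z)) (snd z) f)) \<noteq> 0"
    by (auto split: if_splits)
  then show ?case
  proof
    assume *: "w = z \<and> kco zs b j f \<noteq> 0"
    then show ?thesis
      using Cons.prems(3)[OF len, of b j] by simp
  next
    assume *: "kco zs b j (wedge w (W.ctr (gen (fst z)) (snd z) f)) \<noteq> 0"
    show ?thesis
    proof (cases q)
      case 0
      then have "W.ctr (gen (fst z)) (snd z) f = 0"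
        using Cons.prems(1) by (intro ctr_in_0) simp
      then have "kco zs b j (wedge w (W.ctr (gen (fst z)) (snd z) f)) = 0"
        by (simp only: wedge_zero kco_def kap_zero) simp
      with * show ?thesis by simp
    next
      case (Suc r)
      have "sum_list (map pweight zs) + int j + (if b then 2 else 0) = (s - pweight z) + pweight w"
      proof (rule Cons.IH[OF _ _ _ *])
        show "W.ctr (gen (fst z)) (snd z) f \<in> Cochains r"
          using Cons.prems(1) Suc by (simp add: ctr_in)
        show "length zs = Suc r"
          using len Suc by simp
        fix us b' j' assume "length us = r" "kco us b' j' (W.ctr (gen (fst z)) (snd z) f) \<noteq> 0"
        then show "sum_list (map pweight us) + int j' + (if b' then 2 else 0) = s - pweight z"
          using Cons.prems(3)[of "z # us" b' j'] Suc by (simp add: kco_def kap_Cons)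
      qed
      then show ?thesis by simp
    qed
  qed
qed simp

lemma kco_mono_weight:
  "length zs = length ws \<Longrightarrow> kco zs b j (cmono k ws) \<noteq> 0 \<Longrightarrow>
    sum_list (map pweight zs) + int j + (if b then 2 else 0) = int k + sum_list (map pweight ws)"
proof (induction ws arbitrary: zs b j)
  case Nil
  then show ?case
    by (auto simp: kco_def kap_def mconst_def cmono.simps split: if_splits)
next
  case (Cons w ws)
  have "sum_list (map pweight zs) + int j + (if b then 2 else 0) =
      (int k + sum_list (map pweight ws)) + pweight w"
    by (rule kco_wedge[OF mono_in[of k ws]]) (use Cons in \<open>auto simp: cmono.simps\<close>)
  then show ?case by simp
qed

lemma mono_weight_zero:
  assumes "int k + sum_list (map pweight ws) = 0" "length ws = q"
  shows "cmono k ws \<in> weight_zero q" (is "?f \<in> _")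
proof -
  have C: "?f \<in> Cochains q"
    using mono_in[of k ws] assms(2) by simp
  show ?thesis
    unfolding weight_zero_kco[OF C]
  proof (intro allI impI)
    fix zs :: "(bool \<times> nat) list" and b j assume "length zs = q" "kco zs b j ?f \<noteq> 0"
    with kco_mono_weight[of zs ws b j k, where ?'a = 'a] assms show "sum_list (map pweight zs) + int j + (if b then 2 else 0) = 0"
      by simp
  qed
qed

lemma mono_weight_zero_monomials: "(ws, j) \<in> monomials \<Longrightarrow> length ws = q \<Longrightarrow> cmono j ws \<in> weight_zero q"
  by (rule mono_weight_zero) (auto simp: monomials_def pweight_def sg_def)

lemma ctr_mono: "W.ctr (gen b) n (cmono j []) = 0"
    "W.ctr (gen b) n (cmono j (w # ws)) = (if w = (b, n) then cmono j ws else 0) - wedge w (W.ctr (gen b) n (cmono j ws))"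
proof -
  show "W.ctr (gen b) n (cmono j []) = 0"
    by (rule ctr_in_0) (use mono_in[of j "[]"] in simp)
  show "W.ctr (gen b) n (cmono j (w # ws)) = (if w = (b, n) then cmono j ws else 0) - wedge w (W.ctr (gen b) n (cmono j ws))"
    using ctr_wedge[OF mono_in[of j ws], of b n w] by (simp only: cmono.simps)
qed

lemma kco_mono_Nil [simp]: "kco [] False k (cmono j []) = (if j = k then 1 else 0)"
  by (simp add: kco_def kap_def mconst_def cmono.simps)

lemma kco_Cons: "kco (z # zs) b j f = kco zs b j (W.ctr (gen (fst z)) (snd z) f)"
  by (simp add: kco_def kap_Cons)

lemma kco_linear [simp]:
  "kco zs b j (f + g) = kco zs b j f + kco zs b j g"
  "kco zs b j (f - g) = kco zs b j f - kco zs b j g"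
  "kco zs b j (- f) = - kco zs b j f"
  "kco zs b j 0 = 0"
  "kco zs b j (W.smulc c f) = c * kco zs b j f"
  by (simp_all add: kco_def w1_scale_def)

lemma wedge_diff: "f \<in> Cochains q \<Longrightarrow> g \<in> Cochains q \<Longrightarrow> wedge w (f - g) = wedge w f - wedge w g"
  using wedge_plus[of "f - g" q g w] H1.C_diff[of f q g] by simp

text \<open>The coordinates of a wedge product of one-forms are determinants of Kronecker symbols.\<close>

lemma kco_mono_1: "kco [z] False k (cmono j [w] :: 'f::field_char_0 w1 list \<Rightarrow> 'f w1 mpoly) = (if w = z \<and> j = k then 1 else 0)"
proof -
  have "W.ctr (gen (fst z)) (snd z) (cmono j [w] :: 'f::field_char_0 w1 list \<Rightarrow> 'f w1 mpoly) = (if w = z then cmono j [] else 0)"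
    unfolding ctr_mono diff_zero wedge_zero by (cases z) simp
  then show ?thesis
    unfolding kco_Cons[of z] by simp
qed

lemma kco_mono_2:
  "kco [z, z'] False k (cmono j [w, w'] :: 'f::field_char_0 w1 list \<Rightarrow> 'f w1 mpoly) =
    (if w = z \<and> w' = z' \<and> j = k then 1 else 0) - (if w' = z \<and> w = z' \<and> j = k then 1 else 0)"
proof -
  have "W.ctr (gen (fst z)) (snd z) (cmono j [w, w'] :: 'f::field_char_0 w1 list \<Rightarrow> 'f w1 mpoly) =
      (if w = z then cmono j [w'] else 0) - (if w' = z then cmono j [w] else 0)"
    unfolding ctr_mono diff_zero wedge_zero by (cases z) (simp add: cmono.simps(2))
  note eq = this
  have "kco [z, z'] False k (cmono j [w, w'] :: 'f w1 list \<Rightarrow> 'f w1 mpoly) =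
      (if w = z then kco [z'] False k (cmono j [w'] :: 'f w1 list \<Rightarrow> 'f w1 mpoly) else 0) -
      (if w' = z then kco [z'] False k (cmono j [w] :: 'f w1 list \<Rightarrow> 'f w1 mpoly) else 0)"
    unfolding kco_Cons[of z] eq kco_linear(2) if_distrib[of "kco _ _ _"] kco_linear(4) ..
  also have "\<dots> = (if w = z \<and> w' = z' \<and> j = k then 1 else 0) - (if w' = z \<and> w = z' \<and> j = k then 1 else 0)"
    unfolding kco_mono_1 by (intro arg_cong2[where f = "(-)"]) simp_all
  finally show ?thesis .
qed

lemma kco_mono_3:
  "kco [z, z', z''] False k (cmono j [w, w', w''] :: 'f::field_char_0 w1 list \<Rightarrow> 'f w1 mpoly) =
    (if w = z then kco [z', z''] False k (cmono j [w', w'']) else 0) -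
    (if w' = z then kco [z', z''] False k (cmono j [w, w'']) else 0) +
    (if w'' = z then kco [z', z''] False k (cmono j [w, w']) else 0)"
proof -
  define A where "A = (if w' = z then (cmono j [w''] :: 'f::field_char_0 w1 list \<Rightarrow> 'f w1 mpoly) else 0)"
  define B where "B = (if w'' = z then (cmono j [w'] :: 'f::field_char_0 w1 list \<Rightarrow> 'f w1 mpoly) else 0)"
  have in1: "A \<in> Cochains 1" "B \<in> Cochains 1"
    using mono_in[of j "[w'']"] mono_in[of j "[w']"] H1.C_0[of 1] by (auto simp: A_def B_def)
  have "W.ctr (gen (fst z)) (snd z) (cmono j [w', w''] :: 'f::field_char_0 w1 list \<Rightarrow> 'f w1 mpoly) = A - B"
    unfolding A_def B_def ctr_mono diff_zero wedge_zero by (cases z) (simp add: cmono.simps(2))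
  then have eq: "W.ctr (gen (fst z)) (snd z) (cmono j [w, w', w''] :: 'f::field_char_0 w1 list \<Rightarrow> 'f w1 mpoly) =
      (if w = z then cmono j [w', w''] else 0) - (wedge w A - wedge w B)"
    unfolding ctr_mono(2)[of "fst z" "snd z" j w "[w', w'']"] wedge_diff[OF in1, symmetric] by simp
  have A: "wedge w A = (if w' = z then cmono j [w, w''] else 0)"
    unfolding A_def if_distrib[of "wedge w"] wedge_zero cmono.simps(2) ..
  have B: "wedge w B = (if w'' = z then cmono j [w, w'] else 0)"
    unfolding B_def if_distrib[of "wedge w"] wedge_zero cmono.simps(2) ..
  show ?thesis
    unfolding kco_Cons[of z] eq A B kco_linear(2) if_distrib[of "kco _ _ _"] kco_linear(4)
    by (simp only: diff_diff_eq2 add_diff_eq diff_add_eq)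
qed

section \<open>The differentials between cochains of weight zero\<close>

lemma alt_bk_gen:
  assumes "W.alt \<phi>"
  shows "\<phi> (W.bk (gen b, x) (gen c, y) # vs) =
    w1_scale (if b then lcoef c x y else if c then x + y else 0) (\<phi> ((gen (b \<and> c), x + y) # vs))"
  using alt_bk_L[OF assms, of "[]" x c y vs] alt_bk_H[OF assms, of "[]" x y vs]
  by (cases b; cases c) (simp_all add: gen_def)

lemma delta_1: "W.delta \<phi> [x] = W.opr x (\<phi> [])"
  and delta_2: "W.delta \<phi> [x, y] = W.opr x (\<phi> [y]) - W.opr y (\<phi> [x]) - \<phi> [W.bk x y]"
  and delta_3: "W.delta \<phi> [x, y, z] = W.opr x (\<phi> [y, z]) - W.opr y (\<phi> [x, z]) + W.opr z (\<phi> [x, y]) -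
    \<phi> [W.bk x y, z] + \<phi> [W.bk x z, y] - \<phi> [W.bk y z, x]"
  by (simp_all add: W.delta_def sel_Cons)

lemma wedge_form_1: "wedge_form w \<phi> [x] = w1_scale (oneform w x) (\<phi> [])"
  and wedge_form_2: "wedge_form w \<phi> [x, y] = w1_scale (oneform w x) (\<phi> [y]) - w1_scale (oneform w y) (\<phi> [x])"
  by (simp_all add: wedge_form_def sel_Cons)

lemma opr_gen_H: "W.opr (gen b, x) (0, 1) = (if b then (0, monom 1 (Suc 0)) else 0)"
proof -
  have "W.opr (gen b, x) w1_H = (if b then w1_D w1_H else 0)"
    by (simp add: gen_def W.opr_def w1_br_L_H w1_br_H_H)
  then show ?thesis
    by (simp add: w1_H_def w1_D_def monom_altdef)
qed

lemma cochain_eqI: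
  assumes "W.represents q f \<phi>" "W.represents q g \<psi>" "\<And>zs. length zs = q \<Longrightarrow> \<phi> (gens zs) = \<psi> (gens zs)"
  shows "f = g"
proof -
  have "(\<phi> - \<psi>) xs = 0" for xs
  proof (cases "length xs = q")
    case True
    show ?thesis
      by (rule alt_determined[OF W.alt_diff[OF W.representsD(2)[OF assms(1)] W.representsD(2)[OF assms(2)]]])
        (simp add: True assms(3))
  qed (simp add: W.representsD(3)[OF assms(1)] W.representsD(3)[OF assms(2)])
  then have "\<phi> = \<psi>"
    by (simp add: fun_eq_iff)
  then show ?thesis
    using assms W.represents_inject by blast
qed

lemma represents_diff_mono: "length ws = q \<Longrightarrow> W.represents (Suc q) (diff (cmono j ws)) (W.delta (cmono_form j ws))"
  using W.represents_differential[OF represents_mono[of ws j]] by simp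

lemma represents_uminus: "W.represents q f \<phi> \<Longrightarrow> W.represents q (- f) (- \<phi>)"
  by (simp add: W.represents_def W.repr_def W.alt_uminus)

text \<open>Because \<open>[L\<^sub>\<lambda> H] = \<partial> H\<close> and \<open>[H\<^sub>\<lambda> H] = 0\<close>.\<close>

lemma diff_mono_H: "diff (cmono 0 []) = cmono 1 [L0]"
proof (rule cochain_eqI)
  show "W.represents (Suc 0) (diff (cmono 0 [])) (W.delta (cmono_form 0 []))"
    by (rule represents_diff_mono) simp
  show "W.represents (Suc 0) (cmono 1 [L0]) (cmono_form 1 [L0])"
    using represents_mono[of "[L0]" 1] by simp
  fix zs :: "(bool \<times> 'a) list" assume "length zs = Suc 0"
  then obtain b x where "zs = [(b, x)]"
    by (auto simp: length_Suc_conv)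
  then show "W.delta (cmono_form 0 []) (gens zs) = cmono_form 1 [L0] (gens zs)"
    by (simp add: delta_1 wedge_form_1 oneform_gen opr_gen_H)
qed

text \<open>On \<open>(L, x)\<close>, \<open>(L, y)\<close> the action contributes \<open>(y - x) \<partial> H\<close> and the bracket
  \<open>- (x - y) (x + y) H = - (x\<^sup>2 - y\<^sup>2) H\<close>. On a pair of arguments that contains \<open>H\<close> everything
  vanishes.\<close>

lemma diff_mono_L1: "diff (cmono 0 [L1]) = - (cmono 1 [L1, L0] + cmono 0 [L2, L0])"
proof (rule cochain_eqI)
  show "W.represents 2 (diff (cmono 0 [L1])) (W.delta (cmono_form 0 [L1]))"
    using represents_diff_mono[of "[L1]" 1 0] by (simp add: numeral_2_eq_2)
  show "W.represents 2 (- (cmono 1 [L1, L0] + cmono 0 [L2, L0])) (- (cmono_form 1 [L1, L0] + cmono_form 0 [L2, L0]))"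
    using represents_mono[of "[L1, L0]" 1] represents_mono[of "[L2, L0]" 0]
    by (intro represents_uminus W.represents_plus) (simp_all add: numeral_2_eq_2)
  have alt: "W.alt (cmono_form 0 [L1])"
    using represents_mono by (rule W.representsD(2))
  fix zs :: "(bool \<times> 'a) list" assume "length zs = 2"
  then obtain b x c y where zs: "zs = [(b, x), (c, y)]"
    by (auto simp: numeral_2_eq_2 length_Suc_conv)
  have 1: "cmono_form 0 [L1] [(gen b, x)] = w1_scale (if b then x else 0) (0, 1)" for b and x :: 'a
    by (simp add: wedge_form_1 oneform_gen)
  have 2: "cmono_form (Suc 0) [L1, L0] [(gen b, x), (gen c, y)] = w1_scale (if b \<and> c then x - y else 0) (0, monom 1 (Suc 0))"
    by (simp add: wedge_form_1 wedge_form_2 oneform_gen w1.scale_left_diff_distrib)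
  have 3: "cmono_form 0 [L2, L0] [(gen b, x), (gen c, y)] = w1_scale (if b \<and> c then x * x - y * y else 0) (0, 1)"
    by (simp add: wedge_form_1 wedge_form_2 oneform_gen w1.scale_left_diff_distrib)
  have sq: "(x - y) * (x + y) = x * x - y * y"
    by (simp add: algebra_simps)
  show "W.delta (cmono_form 0 [L1]) (gens zs) = (- (cmono_form 1 [L1, L0] + cmono_form 0 [L2, L0])) (gens zs)"
    unfolding zs gens_simps fst_conv snd_conv delta_2 alt_bk_gen[OF alt] 1 W.opr_scale opr_gen_H uminus_apply
      plus_fun_apply One_nat_def 2 3
    by (cases b; cases c) (simp_all add: lcoef_def w1.scale_left_diff_distrib sq)
qed

text \<open>The bracket of two generators at \<open>x\<close> and \<open>y\<close> under an alternating function is this multiple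
  of one generator at \<open>x + y\<close>.\<close>

definition bco :: "bool \<Rightarrow> bool \<Rightarrow> 'f::field_char_0 \<Rightarrow> 'f \<Rightarrow> 'f"
  where "bco a b x y = (if a then lcoef b x y else if b then x + y else 0)"

text \<open>The values of a 2-cochain with target \<open>H\<close> are \<open>g\<close> times \<open>H\<close>. Its differential has a multiple
  of \<open>\<partial> H\<close> from the action and a multiple of \<open>H\<close> from the brackets; the two conditions say that
  these vanish.\<close>

lemma diff_mono_2:
  fixes g :: "bool \<Rightarrow> bool \<Rightarrow> 'f::field_char_0 \<Rightarrow> 'f \<Rightarrow> 'f"
  assumes g: "\<And>b c x y. cmono_form 0 ws [(gen b, x), (gen c, y)] = w1_scale (g b c x y) (0, 1)"
    and len: "length ws = 2"
    and 1: "\<And>a b c x y z. (if a then g b c y z else 0) - (if b then g a c x z else 0) + (if c then g a b x y else 0) = 0"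
    and 2: "\<And>a b c x y z. - (bco a b x y * g (a \<and> b) c (x + y) z) + bco a c x z * g (a \<and> c) b (x + z) y -
      bco b c y z * g (b \<and> c) a (y + z) x = 0"
  shows "diff (cmono 0 ws :: 'f w1 list \<Rightarrow> 'f w1 mpoly) = 0"
proof (rule cochain_eqI[OF represents_diff_mono[OF len, of 0] W.represents_zero])
  have alt: "W.alt (cmono_form 0 ws :: 'f form)"
    using represents_mono by (rule W.representsD(2))
  fix zs :: "(bool \<times> 'f) list" assume "length zs = Suc 2"
  then obtain a x b y c z where zs: "zs = [(a, x), (b, y), (c, z)]"
    by (auto simp: numeral_2_eq_2 length_Suc_conv)
  have op: "W.opr (gen a, x) (w1_scale c (0, 1)) = w1_scale (if a then c else 0) (0, monom 1 (Suc 0))" for a x c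
    by (simp add: W.opr_scale opr_gen_H)
  have bk: "cmono_form 0 ws [W.bk (gen a, x) (gen b, y), (gen c, z)] =
      w1_scale (bco a b x y * g (a \<and> b) c (x + y) z) (0, 1)" for a b c x y z
    unfolding alt_bk_gen[OF alt] g bco_def by (simp only: w1.scale_scale)
  have comb: "w1_scale A m - w1_scale B m + w1_scale C m - w1_scale p n + w1_scale q n - w1_scale r n =
      w1_scale (A - B + C) m + w1_scale (- p + q - r) n" for A B C p q r and m n :: "'f w1"
    unfolding w1.scale_left_distrib w1.scale_left_diff_distrib w1.scale_minus_left by simp
  have "W.delta (cmono_form 0 ws) (gens zs) =
      w1_scale ((if a then g b c y z else 0) - (if b then g a c x z else 0) + (if c then g a b x y else 0)) (0, monom 1 (Suc 0)) +
      w1_scale (- (bco a b x y * g (a \<and> b) c (x + y) z) + bco a c x z * g (a \<and> c) b (x + z) y -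
        bco b c y z * g (b \<and> c) a (y + z) x) (0, 1)"
    unfolding zs gens_simps fst_conv snd_conv delta_3 bk g op by (rule comb)
  then show "W.delta (cmono_form 0 ws) (gens zs) = 0 (gens zs)"
    unfolding 1 2 by simp
qed

lemma diff_mono_L2L0: "diff (cmono 0 [L2, L0]) = 0"
proof (rule diff_mono_2)
  let ?g = "\<lambda>b c x y :: 'a. if b \<and> c then x * x - y * y else 0"
  show "cmono_form 0 [L2, L0] [(gen b, x), (gen c, y)] = w1_scale (?g b c x y) (0, 1)" for b c x y
    by (simp add: wedge_form_1 wedge_form_2 oneform_gen w1.scale_left_diff_distrib)
  show "(if a then ?g b c y z else 0) - (if b then ?g a c x z else 0) + (if c then ?g a b x y else 0) = 0" for a b c x y z
    by simp
  show "- (bco a b x y * ?g (a \<and> b) c (x + y) z) + bco a c x z * ?g (a \<and> c) b (x + z) y -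
      bco b c y z * ?g (b \<and> c) a (y + z) x = 0" for a b c x y z
  proof (cases "a \<and> b \<and> c")
    case True
    have "- ((x - y) * ((x + y) * (x + y) - z * z)) + (x - z) * ((x + z) * (x + z) - y * y) -
        (y - z) * ((y + z) * (y + z) - x * x) = 0"
      by algebra
    then show ?thesis
      using True by (simp only: bco_def lcoef_def if_True simp_thms)
  next
    case False
    then show ?thesis
      by (cases a; cases b; cases c) (simp_all add: bco_def)
  qed
qed simp

lemma diff_mono_L0H0: "diff (cmono 0 [L0, H0]) = 0"
proof (rule diff_mono_2)
  let ?g = "\<lambda>b c x y :: 'a. if b \<and> \<not> c then 1 else if \<not> b \<and> c then - 1 else 0 :: 'a"
  show "cmono_form 0 [L0, H0] [(gen b, x), (gen c, y)] = w1_scale (?g b c x y) (0, 1)" for b c x y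
    by (simp add: wedge_form_1 wedge_form_2 oneform_gen)
  show "(if a then ?g b c y z else 0) - (if b then ?g a c x z else 0) + (if c then ?g a b x y else 0) = 0" for a b c x y z
    by simp
  show "- (bco a b x y * ?g (a \<and> b) c (x + y) z) + bco a c x z * ?g (a \<and> c) b (x + z) y -
      bco b c y z * ?g (b \<and> c) a (y + z) x = 0" for a b c x y z
    by (cases a; cases b; cases c) (simp_all add: bco_def lcoef_def)
qed simp

section \<open>The cohomology\<close>

lemma weight_zero_subspace: "W.Cochains.subspace (weight_zero q)"
proof (rule W.Cochains.subspaceI)
  show "0 \<in> weight_zero q"
    unfolding weight_zero_def using H1.C_0 H1.lie_0 by blast
  show "f + g \<in> weight_zero q" if "f \<in> weight_zero q" "g \<in> weight_zero q" for f g
  proof -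
    have *: "f \<in> Cochains q" "H1.lie f = 0" "g \<in> Cochains q" "H1.lie g = 0"
      using that unfolding weight_zero_def by blast+
    have "H1.lie (f + g) = 0"
      by (simp only: H1.lie_add[OF *(1,3)] *(2,4) add_0)
    then show ?thesis
      unfolding weight_zero_def using H1.C_add[OF *(1,3)] by blast
  qed
  show "W.smulc c f \<in> weight_zero q" if "f \<in> weight_zero q" for c f
  proof -
    have *: "f \<in> Cochains q" "H1.lie f = 0"
      using that unfolding weight_zero_def by blast+
    have "H1.lie (W.smulc c f) = 0"
      by (simp only: H1.lie_scale[OF *(1)] *(2) W.Cochains.scale_zero_right)
    then show ?thesis
      unfolding weight_zero_def using H1.C_scale[OF *(1)] by blast
  qed
qed

lemma diff_weight_zero:
  assumes "f \<in> weight_zero q"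
  shows "diff f \<in> weight_zero (Suc q)"
proof -
  have *: "f \<in> Cochains q" "H1.lie f = 0"
    using assms unfolding weight_zero_def by blast+
  have "H1.lie (diff f) = 0"
    by (simp only: H1.d_lie[OF *(1), symmetric] *(2) H1.d_0)
  then show ?thesis
    unfolding weight_zero_def using H1.d_in[OF *(1)] by blast
qed

lemma weight_zero_eqI:
  assumes "f \<in> weight_zero q" "g \<in> weight_zero q"
    and "\<And>ws j. (ws, j) \<in> monomials \<Longrightarrow> length ws = q \<Longrightarrow> kco ws False j f = kco ws False j g"
  shows "f = g"
proof -
  have "f - g = 0"
    by (rule weight_zero_eq_0[OF W.Cochains.subspace_diff[OF weight_zero_subspace assms(1,2)]])
      (simp add: assms(3))
  then show ?thesis
    by (simp only: eq_iff_diff_eq_0[symmetric])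
qed

lemma weight_zero_expand:
  "f \<in> weight_zero 0 \<Longrightarrow> f = W.smulc (kco [] False 0 f) (cmono 0 [])"
  "f \<in> weight_zero 1 \<Longrightarrow> f = W.smulc (kco [L0] False 1 f) (cmono 1 [L0]) + W.smulc (kco [L1] False 0 f) (cmono 0 [L1])"
  "f \<in> weight_zero 2 \<Longrightarrow> f = W.smulc (kco [L1, L0] False 1 f) (cmono 1 [L1, L0]) +
    W.smulc (kco [L2, L0] False 0 f) (cmono 0 [L2, L0]) + W.smulc (kco [L0, H0] False 0 f) (cmono 0 [L0, H0])"
  "f \<in> weight_zero 3 \<Longrightarrow> f = W.smulc (kco [L2, L1, L0] False 0 f) (cmono 0 [L2, L1, L0]) +
    W.smulc (kco [L1, L0, H0] False 0 f) (cmono 0 [L1, L0, H0])"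
  "q > 3 \<Longrightarrow> f \<in> weight_zero q \<Longrightarrow> f = 0"
proof -
  note sub = W.Cochains.subspace_add[OF weight_zero_subspace] W.Cochains.subspace_scale[OF weight_zero_subspace]
    mono_weight_zero_monomials
  show "f = W.smulc (kco [] False 0 f) (cmono 0 [])" if "f \<in> weight_zero 0"
  proof (rule weight_zero_eqI[OF that])
    show "W.smulc (kco [] False 0 f) (cmono 0 []) \<in> weight_zero 0"
      by (intro sub) (simp_all add: monomials_def)
  qed (auto simp: monomials_def)
  show "f = W.smulc (kco [L0] False 1 f) (cmono 1 [L0]) + W.smulc (kco [L1] False 0 f) (cmono 0 [L1])"
    if "f \<in> weight_zero 1"
  proof (rule weight_zero_eqI[OF that])
    show "W.smulc (kco [L0] False 1 f) (cmono 1 [L0]) + W.smulc (kco [L1] False 0 f) (cmono 0 [L1]) \<in> weight_zero 1"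
      by (intro sub) (simp_all add: monomials_def)
  qed (auto simp: monomials_def kco_mono_1)
  show "f = W.smulc (kco [L1, L0] False 1 f) (cmono 1 [L1, L0]) +
      W.smulc (kco [L2, L0] False 0 f) (cmono 0 [L2, L0]) + W.smulc (kco [L0, H0] False 0 f) (cmono 0 [L0, H0])"
    if "f \<in> weight_zero 2"
  proof (rule weight_zero_eqI[OF that])
    show "W.smulc (kco [L1, L0] False 1 f) (cmono 1 [L1, L0]) +
        W.smulc (kco [L2, L0] False 0 f) (cmono 0 [L2, L0]) + W.smulc (kco [L0, H0] False 0 f) (cmono 0 [L0, H0])
      \<in> weight_zero 2"
      by (intro sub) (simp_all add: monomials_def)
  qed (auto simp: monomials_def kco_mono_2)
  show "f = W.smulc (kco [L2, L1, L0] False 0 f) (cmono 0 [L2, L1, L0]) +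
      W.smulc (kco [L1, L0, H0] False 0 f) (cmono 0 [L1, L0, H0])" if "f \<in> weight_zero 3"
  proof (rule weight_zero_eqI[OF that])
    show "W.smulc (kco [L2, L1, L0] False 0 f) (cmono 0 [L2, L1, L0]) +
        W.smulc (kco [L1, L0, H0] False 0 f) (cmono 0 [L1, L0, H0]) \<in> weight_zero 3"
      by (intro sub) (simp_all add: monomials_def)
  qed (auto simp: monomials_def kco_mono_3 kco_mono_2)
  show "f = 0" if "q > 3" "f \<in> weight_zero q"
    by (rule weight_zero_eq_0[OF that(2)]) (use that(1) in \<open>auto simp: monomials_def\<close>)
qed

text \<open>The weight-zero subcomplex computes the cohomology: every class has a representative of
  weight zero, and a coboundary of weight zero bounds within weight zero.\<close>

lemma cocycle_weight_zero:
  assumes "z \<in> H1.cocycles q"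
  obtains f where "f \<in> weight_zero q" "diff f = 0" "z - f \<in> H1.coboundaries q"
proof -
  have z: "z \<in> Cochains q" "diff z = 0"
    using assms unfolding H1.cocycles_def by blast+
  have "diff z \<in> weight_zero (Suc q)"
    unfolding z(2) by (rule W.Cochains.subspace_0[OF weight_zero_subspace])
  with weight_zero_projection[OF z(1)] z(2) that show thesis
    by metis
qed

lemma coboundary_weight_zero:
  assumes "b \<in> H1.coboundaries (Suc q)" "b \<in> weight_zero (Suc q)"
  obtains u where "u \<in> weight_zero q" "b = diff u"
proof -
  obtain v where v: "v \<in> Cochains q" "b = diff v"
    using assms(1) unfolding H1.coboundaries_def by auto
  with weight_zero_projection[OF v(1)] assms(2) that show thesis
    by metis
qed

lemma acyclic_basis:
  assumes "\<And>f :: 'f::field_char_0 w1 list \<Rightarrow> 'f w1 mpoly. f \<in> weight_zero q \<Longrightarrow> diff f = 0 \<Longrightarrow> f \<in> H1.coboundaries q"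
  shows "W.Cochains.basis_mod (H1.cocycles q :: ('f w1 list \<Rightarrow> 'f w1 mpoly) set) (H1.coboundaries q) []"
proof -
  have "z \<in> H1.coboundaries q" if "z \<in> H1.cocycles q" for z :: "'f w1 list \<Rightarrow> 'f w1 mpoly"
  proof -
    obtain f where f: "f \<in> weight_zero q" "diff f = 0" "z - f \<in> H1.coboundaries q"
      using cocycle_weight_zero[OF \<open>z \<in> H1.cocycles q\<close>] by blast
    have "z - f + f \<in> H1.coboundaries q"
      using f(3) assms[OF f(1,2)] by (rule W.Cochains.subspace_add[OF H1.coboundaries_subspace])
    then show ?thesis
      by (simp only: diff_add_cancel)
  qed
  then show ?thesis
    unfolding W.Cochains.basis_mod_def by auto
qed

text \<open>A multiple of \<open>H\<close> is a cocycle only if it is zero, since its differential is that multiple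
  of \<open>L\<^sub>0 \<partial> H\<close>.\<close>

lemma basis_0: "W.Cochains.basis_mod (H1.cocycles 0 :: ('f::field_char_0 w1 list \<Rightarrow> 'f w1 mpoly) set) (H1.coboundaries 0) []"
proof (rule acyclic_basis)
  fix f :: "'f w1 list \<Rightarrow> 'f w1 mpoly" assume f: "f \<in> weight_zero 0" and df: "diff f = 0"
  define c where "c = kco [] False 0 f"
  have fc: "f = W.smulc c (cmono 0 [])"
    unfolding c_def by (rule weight_zero_expand(1)[OF f])
  have "diff f = W.smulc c (cmono 1 [L0])"
    unfolding fc using H1.d_scale[OF mono_in[of 0 "[]"], of c] by (simp only: diff_mono_H)
  then have "kco [L0] False 1 (W.smulc c (cmono 1 [L0])) = 0"
    unfolding df by (simp only: kco_linear(4) flip: \<open>diff f = W.smulc c (cmono 1 [L0])\<close>)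
  then have "c = 0"
    by (simp add: kco_mono_1)
  then have "f = 0"
    unfolding fc by (simp only: W.Cochains.scale_zero_left)
  then show "f \<in> H1.coboundaries 0"
    by (simp only: W.Cochains.subspace_0[OF H1.coboundaries_subspace])
qed

lemma mono_Cochains: "cmono j [] \<in> Cochains 0" "cmono j [w] \<in> Cochains 1" "cmono j [w, w'] \<in> Cochains 2"
  using mono_in[of j "[]"] mono_in[of j "[w]"] mono_in[of j "[w, w']"] by (simp_all add: numeral_2_eq_2)

lemma diff_mono_L0: "diff (cmono 1 [L0]) = 0"
  unfolding diff_mono_H[symmetric] by (rule H1.d_d[OF mono_Cochains(1)])

text \<open>The sum of \<open>L\<^sub>1 L\<^sub>0 \<partial> H\<close> and the cocycle \<open>L\<^sub>2 L\<^sub>0 H\<close> is, up to sign, the differential of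
  \<open>L\<^sub>1 H\<close>.\<close>

lemma diff_mono_L1L0: "diff (cmono 1 [L1, L0]) = 0"
proof -
  have "diff (- (cmono 1 [L1, L0] + cmono 0 [L2, L0])) = 0"
    unfolding diff_mono_L1[symmetric] by (rule H1.d_d[OF mono_Cochains(2)])
  then have "diff (W.smulc (- 1) (cmono 1 [L1, L0] + cmono 0 [L2, L0])) = 0"
    by (simp only: W.Cochains.scale_minus_left W.Cochains.scale_one)
  then have "W.smulc (- 1) (diff (cmono 1 [L1, L0])) = 0"
    unfolding H1.d_scale[OF H1.C_add[OF mono_Cochains(3,3)]] H1.d_add[OF mono_Cochains(3,3)] diff_mono_L2L0
    by (simp only: add_0_right)
  then show ?thesis
    by (simp only: W.Cochains.scale_minus_left W.Cochains.scale_one neg_equal_0_iff_equal)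
qed

lemma diff_weight_zero_1:
  assumes "f \<in> weight_zero 1"
  shows "diff f = W.smulc (- kco [L1] False 0 f) (cmono 1 [L1, L0] + cmono 0 [L2, L0])"
proof -
  note C = H1.C_scale[OF mono_Cochains(2)]
  define a b where "a = kco [L0] False 1 f" and "b = kco [L1] False 0 f"
  have f: "f = W.smulc a (cmono 1 [L0]) + W.smulc b (cmono 0 [L1])"
    unfolding a_def b_def by (rule weight_zero_expand(2)[OF assms])
  have "diff f = W.smulc b (diff (cmono 0 [L1]))"
    unfolding f H1.d_add[OF C C] H1.d_scale[OF mono_Cochains(2)] diff_mono_L0
    by (simp only: W.Cochains.scale_zero_right add_0)
  then show ?thesis
    unfolding diff_mono_L1 b_def by (simp only: W.Cochains.scale_minus_right W.Cochains.scale_minus_left)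
qed

lemma diff_coboundary: "f \<in> Cochains q \<Longrightarrow> diff f \<in> H1.coboundaries (Suc q)"
  unfolding H1.coboundaries_def by simp

text \<open>The kernel of the differential in weight zero is spanned by \<open>L\<^sub>0 \<partial> H\<close>, which is the
  differential of \<open>H\<close>.\<close>

lemma basis_1: "W.Cochains.basis_mod (H1.cocycles 1 :: ('f::field_char_0 w1 list \<Rightarrow> 'f w1 mpoly) set) (H1.coboundaries 1) []"
proof (rule acyclic_basis)
  fix f :: "'f w1 list \<Rightarrow> 'f w1 mpoly" assume f: "f \<in> weight_zero 1" and df: "diff f = 0"
  have "kco [L1, L0] False 1 (diff f) = - kco [L1] False 0 f"
    unfolding diff_weight_zero_1[OF f] by (simp add: kco_mono_2)
  then have "kco [L1] False 0 f = 0"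
    unfolding df by (simp only: kco_linear(4)) simp
  then have "f = W.smulc (kco [L0] False 1 f) (cmono 1 [L0])"
    using weight_zero_expand(2)[OF f] by (simp only: W.Cochains.scale_zero_left add_0_right)
  also have "\<dots> = diff (W.smulc (kco [L0] False 1 f) (cmono 0 []))"
    unfolding H1.d_scale[OF mono_Cochains(1)] diff_mono_H ..
  also have "\<dots> \<in> H1.coboundaries 1"
    unfolding One_nat_def by (rule diff_coboundary[OF H1.C_scale[OF mono_Cochains(1)]])
  finally show "f \<in> H1.coboundaries 1" .
qed

lemma mono_cocycle:
  assumes "diff (cmono j ws :: 'f::field_char_0 w1 list \<Rightarrow> 'f w1 mpoly) = 0" "length ws = q"
  shows "(cmono j ws :: 'f::field_char_0 w1 list \<Rightarrow> 'f w1 mpoly) \<in> H1.cocycles q"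
  unfolding H1.cocycles_def using assms(1) mono_in[of j ws, unfolded assms(2)] by blast

lemma diff_weight_zero_2:
  assumes "f \<in> weight_zero 2"
  shows "diff f = 0"
proof -
  note C = H1.C_scale[OF mono_Cochains(3)]
  show ?thesis
    by (subst weight_zero_expand(3)[OF assms])
      (simp only: H1.d_add[OF H1.C_add[OF C C] C] H1.d_add[OF C C] H1.d_scale[OF mono_Cochains(3)]
        diff_mono_L1L0 diff_mono_L2L0 diff_mono_L0H0 W.Cochains.scale_zero_right add_0)
qed

lemma (in ambient_space) replace_generator:
  "z - (scale (b - a) u + (scale c v + 0)) = (z - (scale a m + scale b u + scale c v)) + scale a (m + u)"
  by (simp add: scale_left_diff_distrib scale_right_distrib)

lemma length_2_cases: "length cs = length [x, y] \<Longrightarrow> \<exists>a b. cs = [a, b]"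
  by (auto simp: length_Suc_conv)

text \<open>All three monomials are cocycles, and the differential of \<open>L\<^sub>1 H\<close> identifies \<open>L\<^sub>1 L\<^sub>0 \<partial> H\<close>
  with \<open>- L\<^sub>2 L\<^sub>0 H\<close>.\<close>

lemma basis_2: "W.Cochains.basis_mod (H1.cocycles 2 :: ('f::field_char_0 w1 list \<Rightarrow> 'f w1 mpoly) set) (H1.coboundaries 2) [cmono 0 [L2, L0], cmono 0 [L0, H0]]"
  unfolding W.Cochains.basis_mod_def
proof (intro conjI ballI allI impI)
  show "set [cmono 0 [L2, L0], cmono 0 [L0, H0]] \<subseteq> H1.cocycles 2"
    unfolding list.set insert_subset
    by (intro conjI mono_cocycle[OF diff_mono_L2L0] mono_cocycle[OF diff_mono_L0H0] empty_subsetI) simp_all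
next
  fix z :: "'f w1 list \<Rightarrow> 'f w1 mpoly" assume "z \<in> H1.cocycles 2"
  then obtain f where f: "f \<in> weight_zero 2" "z - f \<in> H1.coboundaries 2"
    using cocycle_weight_zero by blast
  define a b c where "a = kco [L1, L0] False 1 f" and "b = kco [L2, L0] False 0 f" and "c = kco [L0, H0] False 0 f"
  have f_eq: "f = W.smulc a (cmono 1 [L1, L0]) + W.smulc b (cmono 0 [L2, L0]) + W.smulc c (cmono 0 [L0, H0])"
    unfolding a_def b_def c_def by (rule weight_zero_expand(3)[OF f(1)])
  note C = mono_Cochains(2)
  have "W.smulc a (cmono 1 [L1, L0] + cmono 0 [L2, L0]) = diff (W.smulc (- a) (cmono 0 [L1]))"
    unfolding H1.d_scale[OF C] diff_mono_L1 by (simp only: W.Cochains.scale_minus_right W.Cochains.scale_minus_left minus_minus)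
  also have "\<dots> \<in> H1.coboundaries 2"
    using diff_coboundary[OF H1.C_scale[OF C]] by (simp only: numeral_2_eq_2 One_nat_def)
  finally have cb: "z - W.Cochains.comb [b - a, c] [cmono 0 [L2, L0], cmono 0 [L0, H0]] \<in> H1.coboundaries 2"
    unfolding W.Cochains.comb_simps W.Cochains.replace_generator[of z b a _ c _ "cmono 1 [L1, L0]"] f_eq[symmetric]
    by (intro W.Cochains.subspace_add[OF H1.coboundaries_subspace] f(2))
  show "\<exists>cs. length cs = length [cmono 0 [L2, L0], cmono 0 [L0, H0]] \<and>
      z - W.Cochains.comb cs [cmono 0 [L2, L0], cmono 0 [L0, H0]] \<in> H1.coboundaries 2"
    by (rule exI[of _ "[b - a, c]"], rule conjI[OF _ cb]) (simp only: list.size)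
next
  fix cs :: "'f list"
  let ?bs = "[cmono 0 [L2, L0], cmono 0 [L0, H0]] :: ('f w1 list \<Rightarrow> 'f w1 mpoly) list"
  assume len: "length cs = length ?bs" and cob: "W.Cochains.comb cs ?bs \<in> H1.coboundaries 2"
  obtain p r where cs: "cs = [p, r]"
    using length_2_cases[OF len] by (elim exE)
  define X :: "'f w1 list \<Rightarrow> 'f w1 mpoly" where "X = W.smulc p (cmono 0 [L2, L0]) + W.smulc r (cmono 0 [L0, H0])"
  have X: "W.Cochains.comb cs ?bs = X"
    unfolding cs W.Cochains.comb_simps X_def by (simp only: add_0_right)
  have "X \<in> weight_zero 2"
    unfolding X_def
    by (intro W.Cochains.subspace_add[OF weight_zero_subspace] W.Cochains.subspace_scale[OF weight_zero_subspace]
        mono_weight_zero_monomials) (simp_all add: monomials_def)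
  moreover have "X \<in> H1.coboundaries (Suc 1)"
    using cob unfolding X by (simp only: numeral_2_eq_2 One_nat_def)
  ultimately obtain u where u: "u \<in> weight_zero 1" "X = diff u"
    using coboundary_weight_zero[of X 1] by (auto simp only: numeral_2_eq_2 One_nat_def)
  \<comment> \<open>The coboundary \<open>X\<close> is a multiple of \<open>L\<^sub>1 L\<^sub>0 \<partial> H + L\<^sub>2 L\<^sub>0 H\<close>, but \<open>L\<^sub>1 L\<^sub>0 \<partial> H\<close> does not occur in it.\<close>
  define s where "s = - kco [L1] False 0 u"
  have Xs: "X = W.smulc s (cmono 1 [L1, L0] + cmono 0 [L2, L0])"
    unfolding u(2) s_def by (rule diff_weight_zero_1[OF u(1)])
  have "kco [L1, L0] False 1 X = s"
    unfolding Xs by (simp add: kco_mono_2)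
  moreover have "kco [L1, L0] False 1 X = 0"
    unfolding X_def by (simp add: kco_mono_2)
  ultimately have "s = 0" by simp
  then have "X = 0"
    unfolding Xs by (simp only: W.Cochains.scale_zero_left)
  moreover have "kco [L2, L0] False 0 X = p" "kco [L0, H0] False 0 X = r"
    unfolding X_def by (simp_all add: kco_mono_2)
  ultimately have "p = 0" "r = 0"
    by (simp_all only: kco_linear(4))
  then show "set cs \<subseteq> {0}"
    by (simp add: cs)
qed

lemma diff_weight_zero_3: "f \<in> weight_zero 3 \<Longrightarrow> diff f = 0"
  by (rule weight_zero_expand(5)[OF _ diff_weight_zero]) simp_all

text \<open>There are no weight-zero cochains of degree 4 and all those of degree 2 are cocycles, so
  both monomials survive.\<close>

lemma basis_3: "W.Cochains.basis_mod (H1.cocycles 3 :: ('f::field_char_0 w1 list \<Rightarrow> 'f w1 mpoly) set) (H1.coboundaries 3) [cmono 0 [L2, L1, L0], cmono 0 [L1, L0, H0]]"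
  unfolding W.Cochains.basis_mod_def
proof (intro conjI ballI allI impI)
  show "set [cmono 0 [L2, L1, L0], cmono 0 [L1, L0, H0]] \<subseteq> H1.cocycles 3"
    unfolding list.set insert_subset
    by (intro conjI mono_cocycle diff_weight_zero_3 mono_weight_zero_monomials empty_subsetI)
      (simp_all add: monomials_def)
next
  fix z :: "'f w1 list \<Rightarrow> 'f w1 mpoly" assume "z \<in> H1.cocycles 3"
  then obtain f where f: "f \<in> weight_zero 3" "z - f \<in> H1.coboundaries 3"
    using cocycle_weight_zero by blast
  define a b where "a = kco [L2, L1, L0] False 0 f" and "b = kco [L1, L0, H0] False 0 f"
  have f_eq: "f = W.smulc a (cmono 0 [L2, L1, L0]) + W.smulc b (cmono 0 [L1, L0, H0])"
    unfolding a_def b_def by (rule weight_zero_expand(4)[OF f(1)])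
  have cb: "z - W.Cochains.comb [a, b] [cmono 0 [L2, L1, L0], cmono 0 [L1, L0, H0]] \<in> H1.coboundaries 3"
    unfolding W.Cochains.comb_simps add_0_right f_eq[symmetric] by (rule f(2))
  show "\<exists>cs. length cs = length [cmono 0 [L2, L1, L0], cmono 0 [L1, L0, H0]] \<and>
      z - W.Cochains.comb cs [cmono 0 [L2, L1, L0], cmono 0 [L1, L0, H0]] \<in> H1.coboundaries 3"
    by (rule exI[of _ "[a, b]"], rule conjI[OF _ cb]) (simp only: list.size)
next
  fix cs :: "'f list"
  let ?bs = "[cmono 0 [L2, L1, L0], cmono 0 [L1, L0, H0]] :: ('f w1 list \<Rightarrow> 'f w1 mpoly) list"
  assume len: "length cs = length ?bs" and cob: "W.Cochains.comb cs ?bs \<in> H1.coboundaries 3"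
  obtain p r where cs: "cs = [p, r]"
    using length_2_cases[OF len] by (elim exE)
  define X :: "'f w1 list \<Rightarrow> 'f w1 mpoly" where "X = W.smulc p (cmono 0 [L2, L1, L0]) + W.smulc r (cmono 0 [L1, L0, H0])"
  have X: "W.Cochains.comb cs ?bs = X"
    unfolding cs W.Cochains.comb_simps X_def by (simp only: add_0_right)
  have "X \<in> weight_zero 3"
    unfolding X_def
    by (intro W.Cochains.subspace_add[OF weight_zero_subspace] W.Cochains.subspace_scale[OF weight_zero_subspace]
        mono_weight_zero_monomials) (simp_all add: monomials_def)
  moreover have "X \<in> H1.coboundaries (Suc 2)"
    using cob unfolding X by (simp only: numeral_3_eq_3 numeral_2_eq_2)
  ultimately obtain u where u: "u \<in> weight_zero 2" "X = diff u"
    using coboundary_weight_zero[of X 2] by (auto simp only: numeral_3_eq_3 numeral_2_eq_2)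
  then have "X = 0"
    using diff_weight_zero_2[OF u(1)] by (simp only:)
  moreover have "kco [L2, L1, L0] False 0 X = p" "kco [L1, L0, H0] False 0 X = r"
    unfolding X_def by (simp_all add: kco_mono_3 kco_mono_2)
  ultimately have "p = 0" "r = 0"
    by (simp_all only: kco_linear(4))
  then show "set cs \<subseteq> {0}"
    by (simp add: cs)
qed

lemma basis_above_3:
  assumes "q > 3"
  shows "W.Cochains.basis_mod (H1.cocycles q :: ('f::field_char_0 w1 list \<Rightarrow> 'f w1 mpoly) set) (H1.coboundaries q) []"
proof (rule acyclic_basis)
  fix f :: "'f w1 list \<Rightarrow> 'f w1 mpoly" assume "f \<in> weight_zero q"
  then have "f = 0"
    by (rule weight_zero_expand(5)[OF assms])
  then show "f \<in> H1.coboundaries q"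
    by (simp only: W.Cochains.subspace_0[OF H1.coboundaries_subspace])
qed

lemma basis:
  "W.Cochains.basis_mod (H1.cocycles q) (H1.coboundaries q)
    (if q = 2 then [cmono 0 [L2, L0], cmono 0 [L0, H0]]
     else if q = 3 then [cmono 0 [L2, L1, L0], cmono 0 [L1, L0, H0]] else [])"
proof -
  consider "q = 0" | "q = 1" | "q = 2" | "q = 3" | "q > 3" "q \<noteq> 2" "q \<noteq> 3"
    by linarith
  then show ?thesis
  proof cases
    case 5
    then show ?thesis
      using basis_above_3 by (simp only: if_False)
  qed (simp_all only: basis_0 basis_1 basis_2 basis_3 if_True if_False refl
        zero_neq_numeral one_eq_numeral_iff num.distinct numeral_eq_iff num.inject split: if_splits)
qed

theorem theorem4p5:
  fixes q :: nat
  shows "has_dim (W1.adjoint.basic_cohomology q :: ('f::field_char_0, _) vspace)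
           (if q = 2 \<or> q = 3 then 2 else 0) \<and>
         has_dim (W1.adjoint.reduced_cohomology q :: ('f::field_char_0, _) vspace)
           (if q = 1 \<or> q = 3 then 2 else if q = 2 then 4 else 0)"
proof
  have "has_dim (W1.adjoint.basic_cohomology q :: ('f, _) vspace)
      (length (if q = 2 then [cmono 0 [L2, L0], cmono 0 [L0, H0] :: 'f w1 list \<Rightarrow> 'f w1 mpoly]
        else if q = 3 then [cmono 0 [L2, L1, L0], cmono 0 [L1, L0, H0]] else []))"
    unfolding W1.adjoint.basic_cohomology_def
    by (rule H0.basic_cohomology_has_dim[OF W.basic_complex_eq basis])
  then show "has_dim (W1.adjoint.basic_cohomology q :: ('f, _) vspace) (if q = 2 \<or> q = 3 then 2 else 0)"
    by (auto simp: numeral_2_eq_2 split: if_splits)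
  have lie: "W1.adjoint.cochain_D ` Cochains q = H0.lie ` Cochains q" for q
    by (rule image_cong[OF refl]) (rule cochain_D_lie)
  have "has_dim (W1.adjoint.reduced_cohomology q :: ('f, _) vspace)
      (length (if q = 2 then [cmono 0 [L2, L0], cmono 0 [L0, H0] :: 'f w1 list \<Rightarrow> 'f w1 mpoly]
        else if q = 3 then [cmono 0 [L2, L1, L0], cmono 0 [L1, L0, H0]] else []) +
       length (if Suc q = 2 then [cmono 0 [L2, L0], cmono 0 [L0, H0] :: 'f w1 list \<Rightarrow> 'f w1 mpoly]
        else if Suc q = 3 then [cmono 0 [L2, L1, L0], cmono 0 [L1, L0, H0]] else []))"
    unfolding W1.adjoint.reduced_cohomology_def
  proof (rule H0.reduced_cohomology_has_dim[OF W.basic_complex_eq basis basis])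
    show "W1.adjoint.reduced_complex q = quotient_space (W1.adjoint.basic_complex q) (H0.lie ` Cochains q)" for q
      unfolding W1.adjoint.reduced_complex_def lie ..
    show "W1.adjoint.reduced_differential q X =
        (\<Union>f\<in>X. coset (W1.adjoint.basic_complex (Suc q)) (H0.lie ` Cochains (Suc q)) (diff f))" for q X
      unfolding W1.adjoint.reduced_differential_def lie ..
  qed
  then show "has_dim (W1.adjoint.reduced_cohomology q :: ('f, _) vspace)
      (if q = 1 \<or> q = 3 then 2 else if q = 2 then 4 else 0)"
    by (auto simp: numeral_2_eq_2 numeral_3_eq_3 eval_nat_numeral split: if_splits)
qed

end
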